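(* Let $(x_d)$ be the stationary sequence of column sizes of a directed column-convex polyomino (dcc), with vertical perimeter contributions $T_d=|w_d|+z_d$ as defined in the context, and let $X(m)=\sum_{d=1}^m x_d$ and $Q(m)=\sum_{d=1}^m T_d$. Put $$\mu_2=\sqrt5,\qquad \sigma_2^2=2,\qquad \mu_3=\frac{6\sqrt5-4}{5},\qquad \sigma_Q^2=\frac{229}{50}+\frac{\sqrt5}{25}.$$ Then, as $\nu\to\infty$, the following convergences in distribution hold (as processes in $t\in[0,1]$): $$\frac{X(\lfloor \nu t\rfloor)-\mu_2\nu t}{\sqrt\nu\,\sigma_2}\longrightarrow B_1(t),\qquad \frac{Q(\lfloor \nu t\rfloor)-\mu_3\nu t}{\sqrt\nu\,\sigma_Q}\longrightarrow B_2(t),$$ where $B_1$ and $B_2$ are standard Brownian motions.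
   Context: A directed column-convex polyomino (dcc) on the square lattice is made of consecutive non-empty columns of vertically contiguous cells such that the base (lowest) cell of each column other than the first is adjacent to some cell of the previous column. Its asymptotic (conditioned on the width) probabilistic description is as follows. Let $\rho=\frac{3-\sqrt5}{2}$. The column sizes $x_d$ form the stationary Markov chain with transition matrix $\Pi(k,j)=j\rho^j$ and stationary distribution $\pi_2(k)=k\rho^k$, $k,j\ge1$ (so the $x_d$ are independent and identically distributed with $\mathbb P(x_d=k)=k\rho^k$). Conditionally on the column sizes, the variables $u_d$ are independent, $u_d$ depends only on $x_d$ and is uniformly distributed on $\{1,\dots,x_d\}$. One sets $$w_d=x_d-u_{d-1},\qquad z_d=x_d-u_d,\qquad T_d=|w_d|+z_d.$$ Geometrically, $w_d$ is the position of the upper cell of column $d$ minus that of column $d-1$, and $z_d\ge0$ is the position of the lower cell of column $d+1$ minus that of column $d$. $X(m)$ is the area and $Q(m)$ the asymptotic vertical perimeter of the first $m$ columns. Convergence of processes is weak convergence in the Skorokhod space $D[0,1]$. *)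

theory Defs
  imports "HOL-Probability.Probability"
begin

section \<open>The Skorokhod space D[0,1]\<close>

text \<open>
  Paths are represented by functions that are \<^const>\<open>undefined\<close> outside [0,1], so that
  two paths are equal iff they agree on [0,1].
\<close>

definition cadlag_paths :: "(real \<Rightarrow> real) set" where
  "cadlag_paths = {f \<in> extensional {0..1}.
     (\<forall>t\<in>{0..<1}. (f \<longlongrightarrow> f t) (at_right t)) \<and>
     (\<forall>t\<in>{0<..1}. \<exists>l. (f \<longlongrightarrow> l) (at_left t))}"

definition time_changes :: "(real \<Rightarrow> real) set" where
  "time_changes = {l. strict_mono_on {0..1} l \<and> continuous_on {0..1} l \<and> l ` {0..1} = {0..1}}"

definition skorokhod_close :: "real \<Rightarrow> (real \<Rightarrow> real) \<Rightarrow> (real \<Rightarrow> real) \<Rightarrow> bool" where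
  "skorokhod_close e f g \<longleftrightarrow>
     (\<exists>l\<in>time_changes. \<forall>t\<in>{0..1}. \<bar>l t - t\<bar> \<le> e \<and> \<bar>f t - g (l t)\<bar> \<le> e)"

text \<open>The value 0 off the carrier is a convention; it has no influence on the topology.\<close>

definition skorokhod_dist :: "(real \<Rightarrow> real) \<Rightarrow> (real \<Rightarrow> real) \<Rightarrow> real" where
  "skorokhod_dist f g =
     (if f \<in> cadlag_paths \<and> g \<in> cadlag_paths then Inf {e. 0 \<le> e \<and> skorokhod_close e f g} else 0)"

definition skorokhod_topology :: "(real \<Rightarrow> real) topology" where
  "skorokhod_topology = Metric_space.mtopology cadlag_paths skorokhod_dist"

subsection \<open>The Skorokhod distance is a metric\<close>

lemma time_change_in: "l \<in> time_changes \<Longrightarrow> t \<in> {0..1} \<Longrightarrow> l t \<in> {0..1}"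
  by (auto simp: time_changes_def)

lemma time_change_id: "(\<lambda>t. t) \<in> time_changes"
  by (auto simp: time_changes_def strict_mono_on_def)

lemma time_change_comp:
  assumes "l \<in> time_changes" "m \<in> time_changes"
  shows "(\<lambda>t. m (l t)) \<in> time_changes"
proof -
  have "(\<lambda>t. m (l t)) ` {0..1} = m ` (l ` {0..1})" by auto
  moreover have "continuous_on {0..1} (\<lambda>t. m (l t))"
    using assms by (intro continuous_on_compose2[of "{0..1}" m "{0..1}" l]) (auto simp: time_changes_def)
  moreover have "strict_mono_on {0..1} (\<lambda>t. m (l t))"
    using assms time_change_in[OF assms(1)]
    by (simp add: time_changes_def strict_mono_on_def)
  ultimately show ?thesis using assms by (simp add: time_changes_def)
qed

lemma time_change_inverse:
  assumes "l \<in> time_changes"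
  obtains m where "m \<in> time_changes" "\<And>t. t \<in> {0..1} \<Longrightarrow> l (m t) = t"
proof
  let ?m = "inv_into {0..1} l"
  have l: "strict_mono_on {0..1} l" "continuous_on {0..1} l" "l ` {0..1} = {0..1}"
    using assms by (auto simp: time_changes_def)
  have inj: "inj_on l {0..1}" using l(1) by (rule strict_mono_on_imp_inj_on)
  show r: "l (?m t) = t" if "t \<in> {0..1}" for t
    using that l(3) by (simp add: f_inv_into_f)
  have im: "?m ` {0..1} = {0..1}"
    using inj l(3) by (metis inv_into_image_cancel subset_refl)
  have "continuous_on (l ` {0..1}) ?m"
    using l inj by (intro continuous_on_inv) auto
  moreover have "strict_mono_on {0..1} ?m"
  proof (rule strict_mono_onI, rule ccontr)
    fix s t :: real assume st: "s \<in> {0..1}" "t \<in> {0..1}" "s < t" "\<not> ?m s < ?m t"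
    have "?m s \<in> {0..1}" "?m t \<in> {0..1}" using st im by blast+
    then have "l (?m t) \<le> l (?m s)"
      using st l(1) by (metis (no_types) linorder_not_less order_le_less strict_mono_onD)
    with st r show False by auto
  qed
  ultimately show "?m \<in> time_changes" using l im by (simp add: time_changes_def)
qed

lemma time_change_1: assumes "l \<in> time_changes" shows "l 1 = 1"
proof -
  have l: "strict_mono_on {0..1} l" "l ` {0..1} = {0..1}"
    using assms by (auto simp: time_changes_def)
  obtain s where s: "s \<in> {0..1}" "l s = 1" using l(2) by (metis atLeastAtMost_iff imageE order_refl zero_le_one)
  then have "s < 1 \<Longrightarrow> l s < l 1" using strict_mono_onD[OF l(1), of s 1] by simp
  moreover have "l 1 \<in> {0..1}" using time_change_in[OF assms, of 1] by simp
  ultimately show ?thesis using s by force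
qed

lemma skorokhod_close_refl: "0 \<le> e \<Longrightarrow> skorokhod_close e f f"
  unfolding skorokhod_close_def by (intro bexI[OF _ time_change_id]) simp

lemma skorokhod_close_sym: assumes "skorokhod_close e f g" shows "skorokhod_close e g f"
proof -
  obtain l where l: "l \<in> time_changes"
    and le: "\<And>t. t \<in> {0..1} \<Longrightarrow> \<bar>l t - t\<bar> \<le> e \<and> \<bar>f t - g (l t)\<bar> \<le> e"
    using assms by (auto simp: skorokhod_close_def)
  obtain m where m: "m \<in> time_changes" "\<And>t. t \<in> {0..1} \<Longrightarrow> l (m t) = t"
    using time_change_inverse[OF l] by blast
  have "\<bar>m t - t\<bar> \<le> e \<and> \<bar>g t - f (m t)\<bar> \<le> e" if "t \<in> {0..1}" for t
    using le[OF time_change_in[OF m(1) that]] m(2)[OF that] by (simp add: abs_minus_commute)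
  with m(1) show ?thesis unfolding skorokhod_close_def by blast
qed

lemma skorokhod_close_trans:
  assumes "skorokhod_close a f g" "skorokhod_close b g h"
  shows "skorokhod_close (a + b) f h"
proof -
  obtain l where l: "l \<in> time_changes"
    and le: "\<And>t. t \<in> {0..1} \<Longrightarrow> \<bar>l t - t\<bar> \<le> a \<and> \<bar>f t - g (l t)\<bar> \<le> a"
    using assms(1) by (auto simp: skorokhod_close_def)
  obtain m where m: "m \<in> time_changes"
    and me: "\<And>t. t \<in> {0..1} \<Longrightarrow> \<bar>m t - t\<bar> \<le> b \<and> \<bar>g t - h (m t)\<bar> \<le> b"
    using assms(2) by (auto simp: skorokhod_close_def)
  have "\<bar>m (l t) - t\<bar> \<le> a + b \<and> \<bar>f t - h (m (l t))\<bar> \<le> a + b" if "t \<in> {0..1}" for t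
    using le[OF that] me[OF time_change_in[OF l that]] by linarith
  with time_change_comp[OF l m] show ?thesis
    unfolding skorokhod_close_def by (intro bexI[of _ "\<lambda>t. m (l t)"]) blast+
qed

lemma cadlag_bounded:
  assumes f: "f \<in> cadlag_paths"
  obtains K where "0 \<le> K" "\<And>t. t \<in> {0..1} \<Longrightarrow> \<bar>f t\<bar> \<le> K"
proof -
  have loc: "\<exists>d>0. \<exists>K. \<forall>s\<in>{0..1}. \<bar>s - t\<bar> < d \<longrightarrow> \<bar>f s\<bar> \<le> K" if t: "t \<in> {0..1}" for t
  proof -
    have "\<exists>K d. t < d \<and> (\<forall>s>t. s < d \<longrightarrow> s \<le> 1 \<longrightarrow> \<bar>f s\<bar> \<le> K)"
    proof (cases "t < 1")
      case True
      then have "(f \<longlongrightarrow> f t) (at_right t)" using f t by (auto simp: cadlag_paths_def)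
      then have "eventually (\<lambda>s. dist (f s) (f t) < 1) (at_right t)"
        by (rule tendstoD) simp
      then obtain d where "t < d" "\<And>s. t < s \<Longrightarrow> s < d \<Longrightarrow> dist (f s) (f t) < 1"
        by (auto simp: eventually_at_right_field)
      then show ?thesis
        by (intro exI[of _ "\<bar>f t\<bar> + 1"] exI[of _ d]) (force simp: dist_real_def)
    qed (auto intro!: exI[of _ 0] exI[of _ "t + 1"])
    then obtain K1 d1 where hi: "t < d1" "\<And>s. t < s \<Longrightarrow> s < d1 \<Longrightarrow> s \<le> 1 \<Longrightarrow> \<bar>f s\<bar> \<le> K1" by blast
    have "\<exists>K d. d < t \<and> (\<forall>s<t. d < s \<longrightarrow> 0 \<le> s \<longrightarrow> \<bar>f s\<bar> \<le> K)"
    proof (cases "0 < t")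
      case True
      with t have "t \<in> {0<..1}" by simp
      then obtain l where "(f \<longlongrightarrow> l) (at_left t)"
        using f unfolding cadlag_paths_def by blast
      then have "eventually (\<lambda>s. dist (f s) l < 1) (at_left t)"
        by (rule tendstoD) simp
      then obtain d where "d < t" "\<And>s. s < t \<Longrightarrow> d < s \<Longrightarrow> dist (f s) l < 1"
        by (auto simp: eventually_at_left_field)
      then show ?thesis
        by (intro exI[of _ "\<bar>l\<bar> + 1"] exI[of _ d]) (force simp: dist_real_def)
    qed (auto intro!: exI[of _ 0] exI[of _ "t - 1"])
    then obtain K2 d2 where lo: "d2 < t" "\<And>s. s < t \<Longrightarrow> d2 < s \<Longrightarrow> 0 \<le> s \<Longrightarrow> \<bar>f s\<bar> \<le> K2" by blast
    have "\<bar>f s\<bar> \<le> max \<bar>f t\<bar> (max K1 K2)"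
      if "s \<in> {0..1}" "\<bar>s - t\<bar> < min (d1 - t) (t - d2)" for s
    proof -
      consider "s = t" | "s < t" | "t < s" by linarith
      then show ?thesis
      proof cases
        case 2
        then have "\<bar>f s\<bar> \<le> K2" using that by (intro lo) auto
        then show ?thesis by simp
      next
        case 3
        then have "\<bar>f s\<bar> \<le> K1" using that by (intro hi) auto
        then show ?thesis by simp
      qed simp
    qed
    moreover have "0 < min (d1 - t) (t - d2)" using hi lo by simp
    ultimately show ?thesis by blast
  qed
  have "\<exists>K. \<forall>s\<in>{0..1}. 0 \<le> s \<longrightarrow> s \<le> 1 \<longrightarrow> \<bar>f s\<bar> \<le> K"
  proof (rule Bolzano[of 0 1 "\<lambda>a b. \<exists>K. \<forall>s\<in>{0..1}. a \<le> s \<longrightarrow> s \<le> b \<longrightarrow> \<bar>f s\<bar> \<le> K"])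
    fix a b c :: real
    assume "\<exists>K. \<forall>s\<in>{0..1}. a \<le> s \<longrightarrow> s \<le> b \<longrightarrow> \<bar>f s\<bar> \<le> K"
      and "\<exists>K. \<forall>s\<in>{0..1}. b \<le> s \<longrightarrow> s \<le> c \<longrightarrow> \<bar>f s\<bar> \<le> K"
    then obtain K L where KL: "\<forall>s\<in>{0..1}. a \<le> s \<longrightarrow> s \<le> b \<longrightarrow> \<bar>f s\<bar> \<le> K"
      "\<forall>s\<in>{0..1}. b \<le> s \<longrightarrow> s \<le> c \<longrightarrow> \<bar>f s\<bar> \<le> L" by blast
    have "\<bar>f s\<bar> \<le> max K L" if "s \<in> {0..1}" "a \<le> s" "s \<le> c" for s
      using KL that by (cases "s \<le> b") (force simp: le_max_iff_disj)+
    then show "\<exists>K. \<forall>s\<in>{0..1}. a \<le> s \<longrightarrow> s \<le> c \<longrightarrow> \<bar>f s\<bar> \<le> K" by blast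
  next
    fix t :: real assume "0 \<le> t" "t \<le> 1"
    then have "t \<in> {0..1}" by simp
    from loc[OF this] obtain d K where dK: "d > 0" "\<And>s. s\<in>{0..1} \<Longrightarrow> \<bar>s - t\<bar> < d \<Longrightarrow> \<bar>f s\<bar> \<le> K"
      by blast
    have "\<bar>f s\<bar> \<le> K" if "a \<le> t" "t \<le> b" "b - a < d" "s \<in> {0..1}" "a \<le> s" "s \<le> b" for a b s
      using that by (intro dK) auto
    with \<open>d > 0\<close> show "\<exists>d>0. \<forall>a b. a \<le> t \<and> t \<le> b \<and> b - a < d \<longrightarrow>
        (\<exists>K. \<forall>s\<in>{0..1}. a \<le> s \<longrightarrow> s \<le> b \<longrightarrow> \<bar>f s\<bar> \<le> K)" by blast
  qed simp
  then obtain K where K: "\<forall>s\<in>{0..1}. \<bar>f s\<bar> \<le> K" by auto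
  then have "0 \<le> K" by (metis abs_ge_zero atLeastAtMost_iff order_refl order_trans zero_le_one)
  with K that show ?thesis by blast
qed

lemma skorokhod_close_exists:
  assumes "f \<in> cadlag_paths" "g \<in> cadlag_paths"
  shows "\<exists>e\<ge>0. skorokhod_close e f g"
proof -
  obtain K where K: "0 \<le> K" "\<And>t. t \<in> {0..1} \<Longrightarrow> \<bar>f t\<bar> \<le> K" using cadlag_bounded[OF assms(1)] by blast
  obtain L where L: "0 \<le> L" "\<And>t. t \<in> {0..1} \<Longrightarrow> \<bar>g t\<bar> \<le> L" using cadlag_bounded[OF assms(2)] by blast
  have "\<bar>f t - g t\<bar> \<le> K + L" if "t \<in> {0..1}" for t
    using K(2)[OF that] L(2)[OF that] by linarith
  then have "skorokhod_close (K + L) f g"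
    unfolding skorokhod_close_def using K(1) L(1)
    by (intro bexI[OF _ time_change_id]) simp
  then show ?thesis using K L by (intro exI[of _ "K + L"]) auto
qed

lemma skorokhod_dist_le:
  assumes "f \<in> cadlag_paths" "g \<in> cadlag_paths" "0 \<le> e" "skorokhod_close e f g"
  shows "skorokhod_dist f g \<le> e"
proof -
  have "bdd_below {e. 0 \<le> e \<and> skorokhod_close e f g}" by (rule bdd_belowI[of _ 0]) simp
  then have "Inf {e. 0 \<le> e \<and> skorokhod_close e f g} \<le> e"
    using assms by (intro cInf_lower) simp_all
  with assms show ?thesis by (simp add: skorokhod_dist_def)
qed

lemma skorokhod_dist_less:
  assumes "f \<in> cadlag_paths" "g \<in> cadlag_paths" "skorokhod_dist f g < e"
  obtains d where "0 \<le> d" "d < e" "skorokhod_close d f g"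
proof -
  have "Inf {e. 0 \<le> e \<and> skorokhod_close e f g} < e"
    using assms by (simp add: skorokhod_dist_def)
  moreover have "{e. 0 \<le> e \<and> skorokhod_close e f g} \<noteq> {}"
    using skorokhod_close_exists[OF assms(1,2)] by blast
  ultimately obtain d where "d \<in> {e. 0 \<le> e \<and> skorokhod_close e f g}" "d < e"
    using cInf_lessD[of "{e. 0 \<le> e \<and> skorokhod_close e f g}" e] by auto
  with that show ?thesis by blast
qed

lemma skorokhod_dist_nonneg: "0 \<le> skorokhod_dist f g"
proof (cases "f \<in> cadlag_paths \<and> g \<in> cadlag_paths")
  case True
  then have "{e. 0 \<le> e \<and> skorokhod_close e f g} \<noteq> {}"
    using skorokhod_close_exists by blast
  then have "0 \<le> Inf {e. 0 \<le> e \<and> skorokhod_close e f g}"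
    by (rule cInf_greatest) simp
  with True show ?thesis by (simp add: skorokhod_dist_def)
qed (auto simp: skorokhod_dist_def)

lemma skorokhod_dist_commute: "skorokhod_dist f g = skorokhod_dist g f"
proof -
  have "{e. 0 \<le> e \<and> skorokhod_close e f g} = {e. 0 \<le> e \<and> skorokhod_close e g f}"
    using skorokhod_close_sym by blast
  then show ?thesis by (simp add: skorokhod_dist_def conj_commute)
qed

text \<open>
  If the distance is 0, then f(t) is either g(t) or the left limit g(t-), hence f(t) is within
  any prescribed error of values of g arbitrarily close to t; right-continuity then gives f = g.
\<close>

lemma skorokhod_dist_0_imp:
  assumes fg: "f \<in> cadlag_paths" "g \<in> cadlag_paths" and d0: "skorokhod_dist f g = 0"
  shows "f = g"
proof (rule extensionalityI)
  show "f \<in> extensional {0..1}" "g \<in> extensional {0..1}"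
    using fg by (auto simp: cadlag_paths_def)
  have near: "\<exists>r\<in>{0..1}. \<bar>r - s\<bar> < e \<and> \<bar>f s - g r\<bar> < e \<and> (s = 1 \<longrightarrow> r = 1)"
    if s: "s \<in> {0..1}" and "e > 0" for s e
  proof -
    from \<open>e > 0\<close> obtain d where "0 \<le> d" "d < e" "skorokhod_close d f g"
      using skorokhod_dist_less[OF fg, of e] d0 by auto
    then obtain l where l: "l \<in> time_changes"
      and le: "\<bar>l s - s\<bar> \<le> d \<and> \<bar>f s - g (l s)\<bar> \<le> d"
      using s by (auto simp: skorokhod_close_def)
    show ?thesis
      using le \<open>d < e\<close> time_change_in[OF l s] time_change_1[OF l]
      by (intro bexI[of _ "l s"]) auto
  qed
  fix t :: real assume t: "t \<in> {0..1}"
  have "\<bar>f t - g t\<bar> \<le> e" if "e > 0" for e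
  proof (cases "t = 1")
    case True
    with near[OF t \<open>e > 0\<close>] show ?thesis by auto
  next
    case False
    with t have t1: "t < 1" by auto
    then have lims: "(f \<longlongrightarrow> f t) (at_right t)" "(g \<longlongrightarrow> g t) (at_right t)"
      using fg t by (auto simp: cadlag_paths_def)
    have e3: "e / 3 > 0" using \<open>e > 0\<close> by simp
    have "eventually (\<lambda>s. dist (f s) (f t) < e/3 \<and> dist (g s) (g t) < e/3) (at_right t)"
      using tendstoD[OF lims(1) e3] tendstoD[OF lims(2) e3] by (rule eventually_conj)
    then obtain b where b: "t < b"
      "\<And>s. t < s \<Longrightarrow> s < b \<Longrightarrow> dist (f s) (f t) < e/3 \<and> dist (g s) (g t) < e/3"
      by (auto simp: eventually_at_right_field)
    define c where "c = min b 1"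
    define s where "s = (t + c) / 2"
    have s: "t < s" "s < c" "c \<le> b" "c \<le> 1" using b(1) t1 by (auto simp: s_def c_def)
    define h where "h = min (e/3) (min (s - t) (c - s))"
    have h: "h > 0" using s \<open>e > 0\<close> by (auto simp: h_def)
    obtain r where r: "\<bar>r - s\<bar> < h" "\<bar>f s - g r\<bar> < h"
      using near[of s h] h s t by auto
    have "t < r" "r < b" "s < b" using r(1) s by (auto simp: h_def)
    then have "\<bar>g r - g t\<bar> < e/3" "\<bar>f s - f t\<bar> < e/3"
      using b(2)[of r] b(2)[of s] s by (auto simp: dist_real_def)
    moreover have "\<bar>f s - g r\<bar> < e/3" using r by (auto simp: h_def)
    ultimately show ?thesis by linarith
  qed
  then have "\<bar>f t - g t\<bar> \<le> 0" by (rule field_le_epsilon) simp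
  then show "f t = g t" by simp
qed

lemma Metric_space_skorokhod: "Metric_space cadlag_paths skorokhod_dist"
proof
  fix f g h
  show "0 \<le> skorokhod_dist f g" by (rule skorokhod_dist_nonneg)
  show "skorokhod_dist f g = skorokhod_dist g f" by (rule skorokhod_dist_commute)
  assume f: "f \<in> cadlag_paths" and g: "g \<in> cadlag_paths"
  show "skorokhod_dist f g = 0 \<longleftrightarrow> f = g"
  proof
    assume "f = g"
    moreover have "skorokhod_dist f f \<le> 0"
      by (rule skorokhod_dist_le[OF f f order_refl skorokhod_close_refl[OF order_refl]])
    ultimately show "skorokhod_dist f g = 0"
      using skorokhod_dist_nonneg[of f f] by simp
  qed (rule skorokhod_dist_0_imp[OF f g])
  assume h: "h \<in> cadlag_paths"
  show "skorokhod_dist f h \<le> skorokhod_dist f g + skorokhod_dist g h"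
  proof (rule field_le_epsilon)
    fix e :: real assume "e > 0"
    then have less: "skorokhod_dist f g < skorokhod_dist f g + e/2"
      "skorokhod_dist g h < skorokhod_dist g h + e/2" by simp_all
    obtain a where a: "0 \<le> a" "a < skorokhod_dist f g + e/2" "skorokhod_close a f g"
      using skorokhod_dist_less[OF f g less(1)] .
    obtain b where b: "0 \<le> b" "b < skorokhod_dist g h + e/2" "skorokhod_close b g h"
      using skorokhod_dist_less[OF g h less(2)] .
    have "0 \<le> a + b" using a b by simp
    then have "skorokhod_dist f h \<le> a + b"
      using skorokhod_close_trans[OF a(3) b(3)] by (rule skorokhod_dist_le[OF f h])
    with a b show "skorokhod_dist f h \<le> skorokhod_dist f g + skorokhod_dist g h + e" by simp
  qed
qed

lemma topspace_skorokhod [simp]: "topspace skorokhod_topology = cadlag_paths"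
  by (simp add: skorokhod_topology_def Metric_space.topspace_mtopology[OF Metric_space_skorokhod])


section \<open>Convergence in distribution\<close>

definition borel_sigma :: "'b topology \<Rightarrow> 'b measure" where
  "borel_sigma T = sigma (topspace T) {U. openin T U}"

text \<open>
  The measurability clauses say that the variables are random elements of the topological space;
  without them the integrals below would be meaningless.
\<close>

definition converges_in_distribution ::
  "'b topology \<Rightarrow> 'a measure \<Rightarrow> ('i \<Rightarrow> 'a \<Rightarrow> 'b) \<Rightarrow> 'i filter \<Rightarrow> 'c measure \<Rightarrow> ('c \<Rightarrow> 'b) \<Rightarrow> bool"
  where
  "converges_in_distribution T M Y F N Z \<longleftrightarrow>
     (\<forall>\<^sub>F i in F. Y i \<in> M \<rightarrow>\<^sub>M borel_sigma T) \<and>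
     Z \<in> N \<rightarrow>\<^sub>M borel_sigma T \<and>
     (\<forall>\<phi>. continuous_map T euclideanreal \<phi> \<longrightarrow> bounded (\<phi> ` topspace T) \<longrightarrow>
        ((\<lambda>i. LINT \<omega>|M. \<phi> (Y i \<omega>)) \<longlongrightarrow> (LINT \<omega>|N. \<phi> (Z \<omega>))) F)"

text \<open>A process indexed by [0,1], viewed as a map into the path space.\<close>

definition sample_path :: "(real \<Rightarrow> 'a \<Rightarrow> real) \<Rightarrow> 'a \<Rightarrow> real \<Rightarrow> real" where
  "sample_path Y \<omega> = (\<lambda>t\<in>{0..1}. Y t \<omega>)"


section \<open>Standard Brownian motion on [0,1]\<close>

definition standard_brownian_motion :: "'a measure \<Rightarrow> (real \<Rightarrow> 'a \<Rightarrow> real) \<Rightarrow> bool" where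
  "standard_brownian_motion N B \<longleftrightarrow>
     prob_space N \<and>
     (\<forall>t\<in>{0..1}. B t \<in> borel_measurable N) \<and>
     (\<forall>\<omega>\<in>space N. B 0 \<omega> = 0 \<and> continuous_on {0..1} (\<lambda>t. B t \<omega>)) \<and>
     (\<forall>s t. 0 \<le> s \<longrightarrow> s < t \<longrightarrow> t \<le> 1 \<longrightarrow>
        distributed N lborel (\<lambda>\<omega>. B t \<omega> - B s \<omega>) (normal_density 0 (sqrt (t - s)))) \<and>
     (\<forall>(n::nat) \<tau>. mono_on {..n} \<tau> \<longrightarrow> \<tau> ` {..n} \<subseteq> {0..1} \<longrightarrow>
        prob_space.indep_vars N (\<lambda>_. borel) (\<lambda>i \<omega>. B (\<tau> (Suc i)) \<omega> - B (\<tau> i) \<omega>) {..<n})"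


section \<open>The asymptotic column process of a directed column-convex polyomino\<close>

text \<open>
  Stationary Markov chain with values in the natural numbers, transition probabilities P
  and stationary distribution p; the transition property is the Markov property on finite
  histories, multiplied out to avoid conditioning on null events.
\<close>

definition stationary_markov_chain ::
  "'a measure \<Rightarrow> (nat \<Rightarrow> 'a \<Rightarrow> nat) \<Rightarrow> (nat \<Rightarrow> nat \<Rightarrow> real) \<Rightarrow> (nat \<Rightarrow> real) \<Rightarrow> bool" where
  "stationary_markov_chain M x P p \<longleftrightarrow>
     (\<forall>d. x d \<in> M \<rightarrow>\<^sub>M count_space UNIV) \<and>
     (\<forall>d k. \<P>(\<omega> in M. x d \<omega> = k) = p k) \<and>
     (\<forall>n k. \<P>(\<omega> in M. \<forall>i\<le>Suc n. x i \<omega> = k i) =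
        \<P>(\<omega> in M. \<forall>i\<le>n. x i \<omega> = k i) * P (k n) (k (Suc n)))"

definition dcc_rho :: real where
  "dcc_rho = (3 - sqrt 5) / 2"

text \<open>
  Columns are indexed from 0, so that the offset of column 1 relative to its predecessor is
  defined. The state 0 carries no mass, since j * rho ^ j vanishes at j = 0. The conditional law
  of the u's given all column sizes is expressed through conditioning on the first n + 1
  columns, for every n: given these, the first n + 1 of the u's are independent and uniform on
  {1..x d}. (Because n is arbitrary, this covers conditioning on any larger number of columns.)
\<close>

locale dcc_columns = prob_space M
  for M :: "'a measure" and x u :: "nat \<Rightarrow> 'a \<Rightarrow> nat" +
  assumes sizes: "stationary_markov_chain M x (\<lambda>k j. real j * dcc_rho ^ j) (\<lambda>k. real k * dcc_rho ^ k)"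
    and u_measurable: "\<And>d. u d \<in> M \<rightarrow>\<^sub>M count_space UNIV"
    and u_uniform: "\<And>n k j. \<P>(\<omega> in M. \<forall>i\<le>n. x i \<omega> = k i) > 0 \<Longrightarrow>
      \<P>(\<omega> in M. (\<forall>i\<le>n. u i \<omega> = j i) \<bar> (\<forall>i\<le>n. x i \<omega> = k i)) =
        (\<Prod>i\<le>n. pmf (pmf_of_set {1..k i}) (j i))"

text \<open>Only the indices d >= 1 are meaningful in \<open>dcc_w\<close> and \<open>dcc_T\<close>.\<close>

definition dcc_w :: "(nat \<Rightarrow> 'a \<Rightarrow> nat) \<Rightarrow> (nat \<Rightarrow> 'a \<Rightarrow> nat) \<Rightarrow> nat \<Rightarrow> 'a \<Rightarrow> int" where
  "dcc_w x u d \<omega> = int (x d \<omega>) - int (u (d - 1) \<omega>)"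

definition dcc_z :: "(nat \<Rightarrow> 'a \<Rightarrow> nat) \<Rightarrow> (nat \<Rightarrow> 'a \<Rightarrow> nat) \<Rightarrow> nat \<Rightarrow> 'a \<Rightarrow> int" where
  "dcc_z x u d \<omega> = int (x d \<omega>) - int (u d \<omega>)"

definition dcc_T :: "(nat \<Rightarrow> 'a \<Rightarrow> nat) \<Rightarrow> (nat \<Rightarrow> 'a \<Rightarrow> nat) \<Rightarrow> nat \<Rightarrow> 'a \<Rightarrow> int" where
  "dcc_T x u d \<omega> = \<bar>dcc_w x u d \<omega>\<bar> + dcc_z x u d \<omega>"

definition dcc_area :: "(nat \<Rightarrow> 'a \<Rightarrow> nat) \<Rightarrow> nat \<Rightarrow> 'a \<Rightarrow> nat" where
  "dcc_area x m \<omega> = (\<Sum>d=1..m. x d \<omega>)"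

definition dcc_perimeter :: "(nat \<Rightarrow> 'a \<Rightarrow> nat) \<Rightarrow> (nat \<Rightarrow> 'a \<Rightarrow> nat) \<Rightarrow> nat \<Rightarrow> 'a \<Rightarrow> int" where
  "dcc_perimeter x u m \<omega> = (\<Sum>d=1..m. dcc_T x u d \<omega>)"

end

theory Submission
  imports Defs
begin

text \<open>
  Both processes are sums over columns. The pairs \<open>p d = (u d, x d)\<close> turn out to be independent and
  identically distributed: since \<open>dcc_rho\<close> satisfies \<open>(1 - dcc_rho)\<^sup>2 = dcc_rho\<close>, the joint mass
  \<open>dcc_rho ^ x\<close> on \<open>1 \<le> u \<le> x\<close> factorises, and \<open>u - 1\<close> and \<open>x - u\<close> are independent geometric variables.
  The area is therefore a random walk. The perimeter is not, because \<open>T d\<close> involves \<open>u (d - 1)\<close> and \<open>p d\<close>;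
  but with \<open>h j = E \<bar>x - j\<bar>\<close> the corrected increment \<open>T d + h (u d) - h (u (d - 1)) - \<mu>\<close> has conditional
  mean zero given the past. So, up to a telescoping term that is negligible after rescaling, both
  processes are martingales whose \<open>d\<close>-th increment is a function \<open>f (p (d - 1)) (p d)\<close> of two
  consecutive members of an independent sequence, and the theorem is an instance of an invariance
  principle for such martingales (\<open>invariance_principle\<close>); its variance parameter is the second moment of
  the corrected increment, an explicit finite combination of geometric moments.
  
  The invariance principle rests on three facts.
  
  \<^item> Fourth moments of partial sums grow quadratically (\<open>S_fourth_moment\<close>), and the Doob-type bound
    \<open>maximal_inequality\<close> transfers this to running maxima. Hence a rescaled path is close to the step
    path that it induces on a grid of mesh \<open>1/m\<close>, except on an event whose probability tends to 0
    with \<open>1/m\<close>.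
  
  \<^item> The characteristic functions of partial sums satisfy the recursion of a Gaussian up to an
    error of third order (\<open>cf_step\<close>), because the conditional variance of an increment is nearly
    independent of the earlier sum: only one common variable connects them. So increments over a grid
    cell are asymptotically normal.
  
  \<^item> Deleting the first increment of every cell makes the cells exactly independent. By Skorohod's
    representation theorem, independent coordinates that converge in law converge jointly
    (\<open>weak_conv_PiM\<close>), so the step paths converge to the step path of a Brownian motion.
  
  The uniform distance dominates the Skorokhod distance, so these estimates decide the limit of
  expectations of bounded Lipschitz functionals; this suffices for all bounded continuous functionals
  (\<open>portmanteau_Lipschitz\<close>). The limit process is given, so no tightness argument and no construction
  of Wiener measure are involved (\<open>donsker_criterion\<close>).
\<close>

section \<open>Lipschitz test functions in a metric space\<close>

lemma (in Metric_space) continuous_map_real_iff: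
  fixes f :: "'a \<Rightarrow> real"
  shows "continuous_map mtopology euclideanreal f \<longleftrightarrow>
    (\<forall>a\<in>M. \<forall>e>0. \<exists>\<delta>>0. \<forall>x\<in>M. d a x < \<delta> \<longrightarrow> \<bar>f a - f x\<bar> < e)"
proof -
  have "continuous_map mtopology (Met_TC.mtopology) f \<longleftrightarrow>
    f ` M \<subseteq> UNIV \<and> (\<forall>a\<in>M. \<forall>e>0. \<exists>\<delta>>0. \<forall>x. x \<in> M \<and> d a x < \<delta> \<longrightarrow> dist (f a) (f x) < e)"
    by (subst metric_continuous_map) (simp_all add: Met_TC.Metric_space_axioms)
  then show ?thesis by (simp add: dist_real_def) blast
qed

lemma (in Metric_space) continuous_map_Lipschitz:
  fixes f :: "'a \<Rightarrow> real"
  assumes L: "\<And>x y. x \<in> M \<Longrightarrow> y \<in> M \<Longrightarrow> \<bar>f x - f y\<bar> \<le> L * d x y"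
  shows "continuous_map mtopology euclideanreal f"
  unfolding continuous_map_real_iff
proof (intro ballI allI impI)
  fix a and e :: real assume "a \<in> M" "e > 0"
  have "\<bar>f a - f x\<bar> < e" if "x \<in> M" "d a x < e / (\<bar>L\<bar> + 1)" for x
  proof -
    have "\<bar>f a - f x\<bar> \<le> L * d a x" using L \<open>a \<in> M\<close> that by blast
    also have "\<dots> \<le> (\<bar>L\<bar> + 1) * d a x" by (intro mult_right_mono) auto
    also have "\<dots> < e" using that by (simp add: field_simps)
    finally show ?thesis .
  qed
  moreover have "e / (\<bar>L\<bar> + 1) > 0" using \<open>e > 0\<close> by simp
  ultimately show "\<exists>\<delta>>0. \<forall>x\<in>M. d a x < \<delta> \<longrightarrow> \<bar>f a - f x\<bar> < e" by blast
qed

text \<open>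
  The largest \<open>k\<close>-Lipschitz minorant of \<open>\<phi>\<close>. It increases to \<open>\<phi>\<close> with \<open>k\<close> wherever \<open>\<phi>\<close> is continuous,
  which approximates a continuous function from below by Lipschitz functions with the same bound.
\<close>

definition (in Metric_space) inf_convolution :: "('a \<Rightarrow> real) \<Rightarrow> nat \<Rightarrow> 'a \<Rightarrow> real" where
  "inf_convolution \<phi> k x = (INF y\<in>M. \<phi> y + real k * d x y)"

context Metric_space
begin

context
  fixes \<phi> :: "'a \<Rightarrow> real" and K :: real
  assumes bnd: "\<And>x. x \<in> M \<Longrightarrow> \<bar>\<phi> x\<bar> \<le> K"
begin

lemma inf_convolution_le:
  assumes "x \<in> M" "y \<in> M"
  shows "inf_convolution \<phi> k x \<le> \<phi> y + real k * d x y"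
  unfolding inf_convolution_def
proof (rule cINF_lower)
  show "bdd_below ((\<lambda>y. \<phi> y + real k * d x y) ` M)"
  proof (rule bdd_belowI2)
    fix y assume "y \<in> M"
    then show "- K \<le> \<phi> y + real k * d x y"
      using bnd[of y] by (smt (verit) mult_nonneg_nonneg nonneg of_nat_0_le_iff)
  qed
qed fact

lemma inf_convolution_ge:
  assumes "x \<in> M" "\<And>y. y \<in> M \<Longrightarrow> c \<le> \<phi> y + real k * d x y"
  shows "c \<le> inf_convolution \<phi> k x"
  unfolding inf_convolution_def using assms by (intro cINF_greatest) auto

lemma inf_convolution_below: "x \<in> M \<Longrightarrow> inf_convolution \<phi> k x \<le> \<phi> x"
  using inf_convolution_le[of x x k] by simp

lemma inf_convolution_bounded:
  assumes "x \<in> M" shows "\<bar>inf_convolution \<phi> k x\<bar> \<le> K"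
proof -
  have "- K \<le> inf_convolution \<phi> k x"
  proof (rule inf_convolution_ge[OF assms])
    fix y assume "y \<in> M"
    then show "- K \<le> \<phi> y + real k * d x y"
      using bnd[of y] by (smt (verit) mult_nonneg_nonneg nonneg of_nat_0_le_iff)
  qed
  then show ?thesis using inf_convolution_below[OF assms, of k] bnd[OF assms] by linarith
qed

lemma inf_convolution_Lipschitz:
  assumes "x \<in> M" "x' \<in> M"
  shows "\<bar>inf_convolution \<phi> k x - inf_convolution \<phi> k x'\<bar> \<le> real k * d x x'"
proof -
  have *: "inf_convolution \<phi> k x - real k * d x x' \<le> inf_convolution \<phi> k x'"
    if "x \<in> M" "x' \<in> M" for x x'
  proof (rule inf_convolution_ge[OF that(2)])
    fix y assume y: "y \<in> M"
    have "real k * d x y \<le> real k * (d x x' + d x' y)"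
      using triangle that y by (intro mult_left_mono) auto
    then show "inf_convolution \<phi> k x - real k * d x x' \<le> \<phi> y + real k * d x' y"
      using inf_convolution_le[OF that(1) y, of k] by (simp add: algebra_simps)
  qed
  show ?thesis using *[OF assms] *[OF assms(2,1)] by (simp add: commute abs_le_iff)
qed

text \<open>
  A point \<open>y\<close> at distance at least \<open>\<delta>\<close> from \<open>x\<close> costs \<open>k * \<delta>\<close>, which exceeds the oscillation \<open>2 * K\<close> once
  \<open>k\<close> is large; the points closer than \<open>\<delta>\<close> are controlled by continuity.
\<close>

lemma inf_convolution_tendsto:
  assumes "continuous_map mtopology euclideanreal \<phi>" "x \<in> M"
  shows "(\<lambda>k. inf_convolution \<phi> k x) \<longlonglongrightarrow> \<phi> x"
proof (rule LIMSEQ_I)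
  fix e :: real assume "e > 0"
  then have "e / 2 > 0" by simp
  then obtain \<delta> where \<delta>: "\<delta> > 0" "\<And>y. y \<in> M \<Longrightarrow> d x y < \<delta> \<Longrightarrow> \<bar>\<phi> x - \<phi> y\<bar> < e / 2"
    using assms unfolding continuous_map_real_iff by blast
  obtain n :: nat where n: "real n > 2 * K / \<delta>" using reals_Archimedean2 by blast
  have "norm (inf_convolution \<phi> k x - \<phi> x) < e" if "k \<ge> n" for k
  proof -
    have "\<phi> x - e / 2 \<le> inf_convolution \<phi> k x"
    proof (rule inf_convolution_ge[OF assms(2)])
      fix y assume y: "y \<in> M"
      show "\<phi> x - e / 2 \<le> \<phi> y + real k * d x y"
      proof (cases "d x y < \<delta>")
        case True
        have "0 \<le> real k * d x y" by simp
        then show ?thesis using \<delta>(2)[OF y True] by linarith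
      next
        case False
        have "2 * K < real n * \<delta>" using n \<delta>(1) by (simp add: field_simps)
        also have "\<dots> \<le> real k * d x y" using that False \<delta>(1) by (intro mult_mono) auto
        finally show ?thesis using bnd[OF assms(2)] bnd[OF y] \<open>e > 0\<close> by linarith
      qed
    qed
    then show ?thesis using inf_convolution_below[OF assms(2), of k] \<open>e > 0\<close> by simp
  qed
  then show "\<exists>n. \<forall>k\<ge>n. norm (inf_convolution \<phi> k x - \<phi> x) < e" by blast
qed

end

text \<open>
  Approximating \<open>\<phi>\<close> from below by Lipschitz minorants gives a lower bound for the limit inferior of the
  expectations; on the side of the limit variable the loss vanishes by dominated convergence. The bound for
  \<open>- \<phi>\<close> is the upper bound.
\<close>

lemma portmanteau_Lipschitz:
  fixes Y :: "'i \<Rightarrow> 'b \<Rightarrow> 'a" and Z :: "'c \<Rightarrow> 'a"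
  assumes P: "prob_space P" and Q: "prob_space Q"
    and Y: "\<forall>\<^sub>F i in F. \<forall>\<omega>\<in>space P. Y i \<omega> \<in> M" and Z: "\<And>\<omega>. \<omega> \<in> space Q \<Longrightarrow> Z \<omega> \<in> M"
    and mY: "\<And>\<phi> :: 'a \<Rightarrow> real. continuous_map mtopology euclideanreal \<phi> \<Longrightarrow>
      \<forall>\<^sub>F i in F. (\<lambda>\<omega>. \<phi> (Y i \<omega>)) \<in> borel_measurable P"
    and mZ: "\<And>\<phi> :: 'a \<Rightarrow> real. continuous_map mtopology euclideanreal \<phi> \<Longrightarrow>
      (\<lambda>\<omega>. \<phi> (Z \<omega>)) \<in> borel_measurable Q"
    and Lip: "\<And>\<phi> K L. \<lbrakk>\<And>x. x \<in> M \<Longrightarrow> \<bar>\<phi> x\<bar> \<le> K; 0 \<le> L;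
        \<And>x y. x \<in> M \<Longrightarrow> y \<in> M \<Longrightarrow> \<bar>\<phi> x - \<phi> y\<bar> \<le> L * d x y\<rbrakk>
      \<Longrightarrow> ((\<lambda>i. LINT \<omega>|P. \<phi> (Y i \<omega>)) \<longlongrightarrow> (LINT \<omega>|Q. \<phi> (Z \<omega>))) F"
    and \<phi>: "continuous_map mtopology euclideanreal \<phi>" "\<And>x. x \<in> M \<Longrightarrow> \<bar>\<phi> x\<bar> \<le> K"
  shows "((\<lambda>i. LINT \<omega>|P. \<phi> (Y i \<omega>)) \<longlongrightarrow> (LINT \<omega>|Q. \<phi> (Z \<omega>))) F"
proof -
  interpret P: prob_space P by fact
  interpret Q: prob_space Q by fact
  have lower: "\<forall>\<^sub>F i in F. (LINT \<omega>|Q. \<phi> (Z \<omega>)) - e < (LINT \<omega>|P. \<phi> (Y i \<omega>))"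
    if \<phi>: "continuous_map mtopology euclideanreal \<phi>" "\<And>x. x \<in> M \<Longrightarrow> \<bar>\<phi> x\<bar> \<le> K" and "e > 0"
    for \<phi> and e :: real
  proof -
    have cont: "continuous_map mtopology euclideanreal (inf_convolution \<phi> k)" for k
      by (rule continuous_map_Lipschitz[where L = "real k"]) (rule inf_convolution_Lipschitz[OF \<phi>(2)])
    have "(\<lambda>k. LINT \<omega>|Q. inf_convolution \<phi> k (Z \<omega>)) \<longlonglongrightarrow> (LINT \<omega>|Q. \<phi> (Z \<omega>))"
      by (rule integral_dominated_convergence[where w = "\<lambda>_. K"])
        (use mZ[OF \<phi>(1)] mZ[OF cont] inf_convolution_tendsto[OF \<phi>(2) \<phi>(1)] Z
          inf_convolution_bounded[OF \<phi>(2)] in auto)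
    then have "\<forall>\<^sub>F k in sequentially. (LINT \<omega>|Q. \<phi> (Z \<omega>)) - e / 2 < (LINT \<omega>|Q. inf_convolution \<phi> k (Z \<omega>))"
      using \<open>e > 0\<close> by (intro order_tendstoD(1)) auto
    then obtain k where k: "(LINT \<omega>|Q. \<phi> (Z \<omega>)) - e / 2 < (LINT \<omega>|Q. inf_convolution \<phi> k (Z \<omega>))"
      using eventually_happens'[OF sequentially_bot] by blast
    have "((\<lambda>i. LINT \<omega>|P. inf_convolution \<phi> k (Y i \<omega>)) \<longlongrightarrow> (LINT \<omega>|Q. inf_convolution \<phi> k (Z \<omega>))) F"
      by (rule Lip[of "inf_convolution \<phi> k" K "real k"])
        (auto intro: inf_convolution_bounded[OF \<phi>(2)] inf_convolution_Lipschitz[OF \<phi>(2)])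
    then have "\<forall>\<^sub>F i in F. (LINT \<omega>|Q. inf_convolution \<phi> k (Z \<omega>)) - e / 2
        < (LINT \<omega>|P. inf_convolution \<phi> k (Y i \<omega>))"
      using \<open>e > 0\<close> by (intro order_tendstoD(1)) auto
    with Y mY[OF \<phi>(1)] mY[OF cont[of k]] show ?thesis
    proof eventually_elim
      case (elim i)
      have "integrable P (\<lambda>\<omega>. inf_convolution \<phi> k (Y i \<omega>))"
        by (rule P.integrable_const_bound[where B = K])
          (use elim inf_convolution_bounded[OF \<phi>(2)] in auto)
      moreover have "integrable P (\<lambda>\<omega>. \<phi> (Y i \<omega>))"
        by (rule P.integrable_const_bound[where B = K]) (use elim \<phi>(2) in auto)
      ultimately have "(LINT \<omega>|P. inf_convolution \<phi> k (Y i \<omega>)) \<le> (LINT \<omega>|P. \<phi> (Y i \<omega>))"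
        using elim(1) by (intro integral_mono inf_convolution_below[where K = K] \<phi>(2)) auto
      then show ?case using elim k by linarith
    qed
  qed
  have neg: "continuous_map mtopology euclideanreal (\<lambda>x. - \<phi> x)"
    using \<phi>(1) by (rule continuous_map_minus)
  show ?thesis
  proof (rule tendstoI)
    fix e :: real assume "e > 0"
    have "\<forall>\<^sub>F i in F. (LINT \<omega>|Q. - \<phi> (Z \<omega>)) - e < (LINT \<omega>|P. - \<phi> (Y i \<omega>))"
      by (rule lower[OF neg _ \<open>e > 0\<close>]) (use \<phi>(2) in auto)
    moreover have "\<forall>\<^sub>F i in F. (LINT \<omega>|Q. \<phi> (Z \<omega>)) - e < (LINT \<omega>|P. \<phi> (Y i \<omega>))"
      by (rule lower[OF \<phi>(1) _ \<open>e > 0\<close>]) (use \<phi>(2) in auto)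
    ultimately show "\<forall>\<^sub>F i in F. dist (LINT \<omega>|P. \<phi> (Y i \<omega>)) (LINT \<omega>|Q. \<phi> (Z \<omega>)) < e"
      by eventually_elim (simp add: dist_real_def abs_less_iff)
  qed
qed

end

section \<open>Step paths in the Skorokhod space\<close>

lemma skorokhod_dist_uniform:
  assumes "f \<in> cadlag_paths" "g \<in> cadlag_paths" "0 \<le> e" "\<And>t. t \<in> {0..1} \<Longrightarrow> \<bar>f t - g t\<bar> \<le> e"
  shows "skorokhod_dist f g \<le> e"
proof (rule skorokhod_dist_le[OF assms(1,2,3)])
  show "skorokhod_close e f g"
    unfolding skorokhod_close_def using assms(3,4) by (intro bexI[OF _ time_change_id]) simp
qed

lemma cadlag_continuous:
  assumes "continuous_on {0..1} f" shows "restrict f {0..1} \<in> cadlag_paths"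
  unfolding cadlag_paths_def
proof (intro CollectI conjI ballI restrict_extensional)
  have ev: "\<forall>\<^sub>F x in F. restrict f {0..1} x = f x" if "\<forall>\<^sub>F x in F. x \<in> {0..1}" for F
    using that by eventually_elim simp
  fix t :: real
  { assume t: "t \<in> {0..<1}"
    have *: "\<forall>\<^sub>F x in at_right t. x \<in> {0..1}"
      using t unfolding eventually_at_right_field by (intro exI[of _ 1]) auto
    have "(f \<longlongrightarrow> f t) (at_right t)"
    proof -
      have "(f \<longlongrightarrow> f t) (at t within {0..1})" using assms t by (auto simp: continuous_on)
      moreover have "filterlim (\<lambda>x. x) (at t within {0..1}) (at_right t)"
        unfolding filterlim_at using * by (auto simp: tendsto_ident_at eventually_at_filter elim: eventually_mono)
      ultimately show ?thesis by (rule filterlim_compose)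
    qed
    then show "(restrict f {0..1} \<longlongrightarrow> restrict f {0..1} t) (at_right t)"
      using t ev[OF *] by (simp cong: filterlim_cong add: tendsto_cong) }
  { assume t: "t \<in> {0<..1}"
    have *: "\<forall>\<^sub>F x in at_left t. x \<in> {0..1}"
      using t unfolding eventually_at_left_field by (intro exI[of _ 0]) auto
    have "(f \<longlongrightarrow> f t) (at_left t)"
    proof -
      have "(f \<longlongrightarrow> f t) (at t within {0..1})" using assms t by (auto simp: continuous_on)
      moreover have "filterlim (\<lambda>x. x) (at t within {0..1}) (at_left t)"
        unfolding filterlim_at using * by (auto simp: tendsto_ident_at eventually_at_filter elim: eventually_mono)
      ultimately show ?thesis by (rule filterlim_compose)
    qed
    then show "\<exists>l. (restrict f {0..1} \<longlongrightarrow> l) (at_left t)"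
      using ev[OF *] by (intro exI[of _ "f t"]) (simp cong: filterlim_cong add: tendsto_cong) }
qed

lemma floor_mult_at_right:
  assumes "0 < (c::real)" shows "\<forall>\<^sub>F x in at_right t. \<lfloor>c * x\<rfloor> = \<lfloor>c * t\<rfloor>"
  unfolding eventually_at_right_field
proof (intro exI[of _ "(of_int \<lfloor>c * t\<rfloor> + 1) / c"] conjI allI impI)
  show "t < (of_int \<lfloor>c * t\<rfloor> + 1) / c"
    using assms by (simp add: pos_less_divide_eq mult.commute)
  fix x assume "x > t" "x < (of_int \<lfloor>c * t\<rfloor> + 1) / c"
  then have "c * t < c * x" "c * x < of_int \<lfloor>c * t\<rfloor> + 1"
    using assms by (simp_all add: pos_less_divide_eq mult.commute)
  then show "\<lfloor>c * x\<rfloor> = \<lfloor>c * t\<rfloor>" by linarith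
qed

lemma floor_mult_at_left:
  assumes "0 < (c::real)" shows "\<forall>\<^sub>F x in at_left t. \<lfloor>c * x\<rfloor> = \<lceil>c * t\<rceil> - 1"
  unfolding eventually_at_left_field
proof (intro exI[of _ "(of_int \<lceil>c * t\<rceil> - 1) / c"] conjI allI impI)
  show "(of_int \<lceil>c * t\<rceil> - 1) / c < t"
    using assms by (simp add: pos_divide_less_eq mult.commute) linarith
  fix x assume "x < t" "(of_int \<lceil>c * t\<rceil> - 1) / c < x"
  then have "c * x < c * t" "of_int \<lceil>c * t\<rceil> - 1 < c * x"
    using assms by (simp_all add: pos_divide_less_eq mult.commute)
  then show "\<lfloor>c * x\<rfloor> = \<lceil>c * t\<rceil> - 1" by linarith
qed

text \<open>
  On one side of any point the integer part of \<open>c * t\<close> is eventually constant, so a function of it has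
  one-sided limits. The linear term is there for the centring \<open>- \<mu> * \<nu> * t\<close> of the rescaled processes.
\<close>

lemma cadlag_step:
  fixes a :: "nat \<Rightarrow> real"
  assumes "0 < c" shows "(\<lambda>t\<in>{0..1}. a (nat \<lfloor>c * t\<rfloor>) + b * t) \<in> cadlag_paths"
  unfolding cadlag_paths_def
proof (intro CollectI conjI ballI restrict_extensional)
  fix t :: real
  { assume t: "t \<in> {0..<1}"
    have "\<forall>\<^sub>F x in at_right t. x \<in> {0..1}"
      using t unfolding eventually_at_right_field by (intro exI[of _ 1]) auto
    with floor_mult_at_right[OF assms, of t]
    have "\<forall>\<^sub>F x in at_right t. a (nat \<lfloor>c * t\<rfloor>) + b * x = (\<lambda>t\<in>{0..1}. a (nat \<lfloor>c * t\<rfloor>) + b * t) x"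
      by eventually_elim simp
    moreover have "((\<lambda>x. a (nat \<lfloor>c * t\<rfloor>) + b * x) \<longlongrightarrow> a (nat \<lfloor>c * t\<rfloor>) + b * t) (at_right t)"
      by (intro tendsto_intros)
    ultimately show "((\<lambda>t\<in>{0..1}. a (nat \<lfloor>c * t\<rfloor>) + b * t) \<longlongrightarrow> (\<lambda>t\<in>{0..1}. a (nat \<lfloor>c * t\<rfloor>) + b * t) t) (at_right t)"
      using t by (auto intro: Lim_transform_eventually) }
  { assume t: "t \<in> {0<..1}"
    have "\<forall>\<^sub>F x in at_left t. x \<in> {0..1}"
      using t unfolding eventually_at_left_field by (intro exI[of _ 0]) auto
    with floor_mult_at_left[OF assms, of t]
    have "\<forall>\<^sub>F x in at_left t. a (nat (\<lceil>c * t\<rceil> - 1)) + b * x = (\<lambda>t\<in>{0..1}. a (nat \<lfloor>c * t\<rfloor>) + b * t) x"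
      by eventually_elim simp
    from Lim_transform_eventually[OF tendsto_add[OF tendsto_const tendsto_mult[OF tendsto_const tendsto_ident_at]] this]
    show "\<exists>l. ((\<lambda>t\<in>{0..1}. a (nat \<lfloor>c * t\<rfloor>) + b * t) \<longlongrightarrow> l) (at_left t)"
      by (rule exI) }
qed

text \<open>
  The path with increment \<open>z k\<close> over the \<open>k\<close>-th cell of the grid of mesh \<open>1/m\<close>, realised as a jump at the
  right end of the cell. Parametrising by increments rather than by values keeps independence visible.
\<close>

definition step_path :: "nat \<Rightarrow> (nat \<Rightarrow> real) \<Rightarrow> real \<Rightarrow> real" where
  "step_path m z = (\<lambda>t\<in>{0..1}. \<Sum>k<nat \<lfloor>real m * t\<rfloor>. z k)"

lemma step_path_cadlag: "0 < m \<Longrightarrow> step_path m z \<in> cadlag_paths"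
  using cadlag_step[of "real m" "\<lambda>n. \<Sum>k<n. z k" 0] by (simp add: step_path_def)

lemma step_path_dist_le:
  assumes "0 < m" shows "skorokhod_dist (step_path m z) (step_path m z') \<le> (\<Sum>k<m. \<bar>z k - z' k\<bar>)"
proof (rule skorokhod_dist_uniform[OF step_path_cadlag step_path_cadlag])
  fix t :: real assume t: "t \<in> {0..1}"
  have "real m * t \<le> real m" using t by (simp add: mult_left_le)
  then have "nat \<lfloor>real m * t\<rfloor> \<le> m" by linarith
  then have "(\<Sum>k<nat \<lfloor>real m * t\<rfloor>. \<bar>z k - z' k\<bar>) \<le> (\<Sum>k<m. \<bar>z k - z' k\<bar>)"
    by (intro sum_mono2) auto
  then show "\<bar>step_path m z t - step_path m z' t\<bar> \<le> (\<Sum>k<m. \<bar>z k - z' k\<bar>)"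
    using t order_trans[OF sum_abs[of "\<lambda>k. z k - z' k" "{..<nat \<lfloor>real m * t\<rfloor>}"]]
    by (simp add: step_path_def flip: sum_subtractf)
qed (use assms in \<open>auto intro: sum_nonneg\<close>)

lemma step_path_cong: "(\<And>k. k < m \<Longrightarrow> z k = z' k) \<Longrightarrow> step_path m z = step_path m z'"
proof (rule ext)
  fix t :: real assume eq: "\<And>k. k < m \<Longrightarrow> z k = z' k"
  show "step_path m z t = step_path m z' t"
  proof (cases "t \<in> {0..1}")
    case True
    then have "real m * t \<le> real m" by (simp add: mult_left_le)
    then have "nat \<lfloor>real m * t\<rfloor> \<le> m" by linarith
    then show ?thesis using True eq by (simp add: step_path_def)
  qed (auto simp: step_path_def)
qed

lemma step_path_grid_increments:
  assumes "t \<in> {0..1}" "b 0 = 0"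
  shows "step_path m (\<lambda>k. b ((real k + 1) / real m) - b (real k / real m)) t
    = b (real (nat \<lfloor>real m * t\<rfloor>) / real m)"
  using assms sum_lessThan_telescope[of "\<lambda>k. b (real k / real m)" "nat \<lfloor>real m * t\<rfloor>"]
  by (simp add: step_path_def add.commute)

text \<open>
  The step path of the grid increments samples \<open>b\<close> at the last grid point before \<open>t\<close>, so this is uniform
  continuity of \<open>b\<close>.
\<close>

lemma step_path_uniform_approx:
  assumes "continuous_on {0..1} b" "b 0 = 0" "0 < e"
  shows "\<forall>\<^sub>F m in sequentially. \<forall>t\<in>{0..1}.
    \<bar>step_path m (\<lambda>k. b ((real k + 1) / real m) - b (real k / real m)) t - b t\<bar> \<le> e"
proof -
  have "uniformly_continuous_on {0..1} b"
    using assms(1) by (intro compact_uniformly_continuous) auto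
  then obtain \<delta> where \<delta>: "\<delta> > 0"
    "\<And>s t. s \<in> {0..1} \<Longrightarrow> t \<in> {0..1} \<Longrightarrow> dist s t < \<delta> \<Longrightarrow> dist (b s) (b t) < e"
    using \<open>0 < e\<close> unfolding uniformly_continuous_on_def by metis
  obtain n :: nat where n: "real n > 1 / \<delta>" using reals_Archimedean2 by blast
  have "\<bar>step_path m (\<lambda>k. b ((real k + 1) / real m) - b (real k / real m)) t - b t\<bar> \<le> e"
    if m: "m \<ge> n" and t: "t \<in> {0..1}" for m t
  proof -
    have "0 < 1 / \<delta>" using \<delta>(1) by simp
    then have m0: "0 < real m" "1 / \<delta> < real m" using m n by linarith+
    define s where "s = real (nat \<lfloor>real m * t\<rfloor>) / real m"
    have s': "real m * s = of_int \<lfloor>real m * t\<rfloor>" using m0 t by (simp add: s_def)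
    then have "real m * s \<le> real m * t" "real m * t < real m * s + 1" by linarith+
    then have "s \<le> t" "real m * (t - s) < 1" using m0 by (auto simp: right_diff_distrib)
    moreover have "t - s < 1 / real m" using \<open>real m * (t - s) < 1\<close> m0 by (simp add: field_simps)
    moreover have "1 / real m < \<delta>" using m0 \<delta>(1) by (simp add: field_simps)
    moreover have "0 \<le> s" by (simp add: s_def)
    ultimately have "dist (b s) (b t) < e" using t by (intro \<delta>(2)) (auto simp: dist_real_def)
    then show ?thesis
      using step_path_grid_increments[where b = b and m = m, OF t assms(2)] by (simp add: s_def dist_real_def)
  qed
  then show ?thesis unfolding eventually_sequentially by blast
qed

section \<open>Random elements of the path space\<close>

lemma space_borel_sigma [simp]: "space (borel_sigma T) = topspace T"
  unfolding borel_sigma_def by (rule space_measure_of) (auto dest: openin_subset)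

lemma measurable_borel_sigmaI:
  assumes "\<And>\<omega>. \<omega> \<in> space N \<Longrightarrow> f \<omega> \<in> topspace T"
    and "\<And>U. openin T U \<Longrightarrow> f -` U \<inter> space N \<in> sets N"
  shows "f \<in> N \<rightarrow>\<^sub>M borel_sigma T"
  unfolding borel_sigma_def
proof (rule measurable_measure_of)
  show "{U. openin T U} \<subseteq> Pow (topspace T)" using openin_subset by blast
  show "f \<in> space N \<rightarrow> topspace T" using assms(1) by blast
qed (use assms(2) in blast)

lemma measurable_continuous_functional:
  fixes \<phi> :: "'b \<Rightarrow> real"
  assumes f: "f \<in> N \<rightarrow>\<^sub>M borel_sigma T" and \<phi>: "continuous_map T euclideanreal \<phi>"
  shows "(\<lambda>\<omega>. \<phi> (f \<omega>)) \<in> borel_measurable N"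
proof (rule borel_measurableI)
  fix S :: "real set" assume "open S"
  then have U: "openin T {x \<in> topspace T. \<phi> x \<in> S}"
    using \<phi> unfolding continuous_map_def by simp
  then have "{x \<in> topspace T. \<phi> x \<in> S} \<in> sets (borel_sigma T)"
    unfolding borel_sigma_def by (subst sets_measure_of) (blast dest: openin_subset)+
  then have "f -` {x \<in> topspace T. \<phi> x \<in> S} \<inter> space N \<in> sets N"
    by (rule measurable_sets[OF f])
  also have "f -` {x \<in> topspace T. \<phi> x \<in> S} \<inter> space N = (\<lambda>\<omega>. \<phi> (f \<omega>)) -` S \<inter> space N"
    using measurable_space[OF f] by auto
  finally show "(\<lambda>\<omega>. \<phi> (f \<omega>)) -` S \<inter> space N \<in> sets N" .
qed

lemma measurable_map_countable:
  fixes X :: "'i \<Rightarrow> 'a \<Rightarrow> 'b::countable"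
  assumes X: "\<And>i. i \<in> set js \<Longrightarrow> X i \<in> N \<rightarrow>\<^sub>M count_space UNIV"
  shows "(\<lambda>\<omega>. map (\<lambda>i. X i \<omega>) js) \<in> N \<rightarrow>\<^sub>M count_space UNIV"
proof (subst measurable_count_space_eq2_countable, intro conjI ballI)
  fix l :: "'b list"
  have "(\<lambda>\<omega>. map (\<lambda>i. X i \<omega>) js) -` {l} \<inter> space N =
    (if length l = length js then {\<omega>\<in>space N. \<forall>i\<in>{..<length js}. X (js ! i) \<omega> = l ! i} else {})"
  proof (cases "length l = length js")
    case True
    then have "map (\<lambda>i. X i \<omega>) js = l \<longleftrightarrow> (\<forall>i\<in>{..<length js}. X (js ! i) \<omega> = l ! i)" for \<omega>
      unfolding list_eq_iff_nth_eq by auto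
    then show ?thesis using True by auto
  qed auto
  moreover have "{\<omega>\<in>space N. \<forall>i\<in>{..<length js}. X (js ! i) \<omega> = l ! i} \<in> sets N"
  proof (rule sets.sets_Collect_finite_All)
    fix i assume "i \<in> {..<length js}"
    then have [measurable]: "X (js ! i) \<in> N \<rightarrow>\<^sub>M count_space UNIV" using X by simp
    show "{\<omega> \<in> space N. X (js ! i) \<omega> = l ! i} \<in> sets N" by measurable
  qed simp
  ultimately show "(\<lambda>\<omega>. map (\<lambda>i. X i \<omega>) js) -` {l} \<inter> space N \<in> sets N" by simp
qed auto

text \<open>
  A variable with countably many values is measurable for every sigma-algebra on its range, and
  pointwise limits in a metric space preserve Borel measurability. This avoids any description of the
  Borel sets of the Skorokhod space.
\<close>

lemma (in Metric_space) measurable_limit_of_countable_valued: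
  fixes X :: "nat \<Rightarrow> 'b \<Rightarrow> 'c::countable"
  assumes X: "\<And>n. X n \<in> N \<rightarrow>\<^sub>M count_space UNIV" and G: "\<And>n c. G n c \<in> M"
    and Z: "\<And>\<omega>. \<omega> \<in> space N \<Longrightarrow> Z \<omega> \<in> M"
    and lim: "\<And>\<omega>. \<omega> \<in> space N \<Longrightarrow> (\<lambda>n. d (G n (X n \<omega>)) (Z \<omega>)) \<longlonglongrightarrow> 0"
  shows "Z \<in> N \<rightarrow>\<^sub>M borel_sigma mtopology"
proof (rule measurable_borel_sigmaI)
  fix U assume "openin mtopology U"
  then have U: "U \<subseteq> M" "\<And>x. x \<in> U \<Longrightarrow> \<exists>r>0. mball x r \<subseteq> U"
    by (auto simp: openin_mtopology)
  \<comment> \<open>Eventually not only the approximations but balls of a fixed radius around them lie in U; the fixed radius is what forces the limit itself into U.\<close>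
  have "Z -` U \<inter> space N = {\<omega>\<in>space N. \<exists>k::nat. \<exists>n0. \<forall>n\<in>{n0..}. mball (G n (X n \<omega>)) (1 / real (Suc k)) \<subseteq> U}"
  proof (intro set_eqI iffI)
    fix \<omega> assume "\<omega> \<in> Z -` U \<inter> space N"
    then have \<omega>: "\<omega> \<in> space N" "Z \<omega> \<in> U" by auto
    then obtain r where r: "r > 0" "mball (Z \<omega>) r \<subseteq> U" using U(2) by blast
    then obtain k :: nat where k: "1 / real (Suc k) < r / 2"
      using nat_approx_posE[of "r / 2"] by auto
    have "\<forall>\<^sub>F n in sequentially. d (G n (X n \<omega>)) (Z \<omega>) < r / 2"
      using lim[OF \<omega>(1)] r(1) by (intro order_tendstoD(2)) auto
    then obtain n0 where n0: "\<And>n. n \<ge> n0 \<Longrightarrow> d (G n (X n \<omega>)) (Z \<omega>) < r / 2"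
      unfolding eventually_sequentially by blast
    have "mball (G n (X n \<omega>)) (1 / real (Suc k)) \<subseteq> U" if n: "n \<ge> n0" for n
    proof
      fix y assume y: "y \<in> mball (G n (X n \<omega>)) (1 / real (Suc k))"
      then have "d (Z \<omega>) y \<le> d (G n (X n \<omega>)) (Z \<omega>) + d (G n (X n \<omega>)) y"
        using triangle[of "Z \<omega>" "G n (X n \<omega>)" y] Z[OF \<omega>(1)] G commute by simp
      then have "d (Z \<omega>) y < r" using n0[OF n] k y by simp
      then show "y \<in> U" using r(2) y Z[OF \<omega>(1)] by auto
    qed
    then show "\<omega> \<in> {\<omega>\<in>space N. \<exists>k::nat. \<exists>n0. \<forall>n\<in>{n0..}. mball (G n (X n \<omega>)) (1 / real (Suc k)) \<subseteq> U}"
      using \<omega> by auto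
  next
    fix \<omega> assume "\<omega> \<in> {\<omega>\<in>space N. \<exists>k::nat. \<exists>n0. \<forall>n\<in>{n0..}. mball (G n (X n \<omega>)) (1 / real (Suc k)) \<subseteq> U}"
    then obtain k :: nat and n0 where \<omega>: "\<omega> \<in> space N"
      and sub: "\<And>n. n \<ge> n0 \<Longrightarrow> mball (G n (X n \<omega>)) (1 / real (Suc k)) \<subseteq> U" by auto
    have "\<forall>\<^sub>F n in sequentially. d (G n (X n \<omega>)) (Z \<omega>) < 1 / real (Suc k)"
      using lim[OF \<omega>] by (intro order_tendstoD(2)) auto
    with eventually_ge_at_top[of n0]
    have "\<forall>\<^sub>F n in sequentially. Z \<omega> \<in> U"
    proof eventually_elim
      case (elim n)
      then have "Z \<omega> \<in> mball (G n (X n \<omega>)) (1 / real (Suc k))"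
        using G Z[OF \<omega>] by simp
      then show ?case using sub elim by blast
    qed
    then show "\<omega> \<in> Z -` U \<inter> space N" using \<omega> by simp
  qed
  also have "\<dots> \<in> sets N"
  proof -
    have [measurable]: "{\<omega>\<in>space N. mball (G n (X n \<omega>)) (1 / real (Suc k)) \<subseteq> U} \<in> sets N" for n k
    proof -
      have "X n -` {c. mball (G n c) (1 / real (Suc k)) \<subseteq> U} \<inter> space N \<in> sets N"
        by (rule measurable_sets[OF X]) simp
      also have "X n -` {c. mball (G n c) (1 / real (Suc k)) \<subseteq> U} \<inter> space N
        = {\<omega>\<in>space N. mball (G n (X n \<omega>)) (1 / real (Suc k)) \<subseteq> U}" by auto
      finally show ?thesis .
    qed
    show ?thesis by measurable
  qed
  finally show "Z -` U \<inter> space N \<in> sets N" .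
qed (use Z in auto)

text \<open>
  A continuous path is the uniform limit of its step paths on grids, and these become countably
  valued when their increments are rounded.
\<close>

lemma measurable_sample_path_continuous:
  assumes B: "\<And>t. t \<in> {0..1} \<Longrightarrow> B t \<in> borel_measurable N"
    and cont: "\<And>\<omega>. \<omega> \<in> space N \<Longrightarrow> continuous_on {0..1} (\<lambda>t. B t \<omega>)"
    and B0: "\<And>\<omega>. \<omega> \<in> space N \<Longrightarrow> B 0 \<omega> = 0"
  shows "sample_path B \<in> N \<rightarrow>\<^sub>M borel_sigma skorokhod_topology"
proof -
  define I where "I n k \<omega> = B ((real k + 1) / real (Suc n)) \<omega> - B (real k / real (Suc n)) \<omega>" for n k :: nat and \<omega>
  \<comment> \<open>Rounding to multiples of 1 / (n + 1)^2 costs at most 1 / (n + 1) in total over the n + 1 cells.\<close>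
  define X where "X n \<omega> = map (\<lambda>k. \<lfloor>real (Suc n) ^ 2 * I n k \<omega>\<rfloor>) [0..<Suc n]" for n \<omega>
  define G where "G n l = step_path (Suc n) (\<lambda>k. real_of_int (l ! k) / real (Suc n) ^ 2)" for n and l :: "int list"
  interpret Metric_space cadlag_paths skorokhod_dist by (rule Metric_space_skorokhod)
  have path: "sample_path B \<omega> \<in> cadlag_paths" if "\<omega> \<in> space N" for \<omega>
    using cadlag_continuous[OF cont[OF that]] by (simp add: sample_path_def)
  show ?thesis
    unfolding skorokhod_topology_def
  proof (rule measurable_limit_of_countable_valued[where X = X and G = G])
    fix n
    show "X n \<in> N \<rightarrow>\<^sub>M count_space UNIV"
      unfolding X_def
    proof (rule measurable_map_countable)
      fix k assume "k \<in> set [0..<Suc n]"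
      then have k: "k < Suc n" by (simp del: upt_Suc)
      have [measurable]: "I n k \<in> borel_measurable N"
        unfolding I_def using k by (intro borel_measurable_diff B) (auto simp: field_simps)
      show "(\<lambda>\<omega>. \<lfloor>real (Suc n) ^ 2 * I n k \<omega>\<rfloor>) \<in> N \<rightarrow>\<^sub>M count_space UNIV" by measurable
    qed
    show "G n c \<in> cadlag_paths" for c unfolding G_def by (rule step_path_cadlag) simp
  next
    fix \<omega> assume \<omega>: "\<omega> \<in> space N"
    show "sample_path B \<omega> \<in> cadlag_paths" using path[OF \<omega>] .
    show "(\<lambda>n. skorokhod_dist (G n (X n \<omega>)) (sample_path B \<omega>)) \<longlonglongrightarrow> 0"
    proof (rule LIMSEQ_I)
      fix e :: real assume "e > 0"
      then have e3: "e / 3 > 0" by simp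
      obtain n1 where n1: "\<And>m. m \<ge> n1 \<Longrightarrow> \<forall>t\<in>{0..1}.
        \<bar>step_path m (\<lambda>k. B ((real k + 1) / real m) \<omega> - B (real k / real m) \<omega>) t - B t \<omega>\<bar> \<le> e / 3"
        using step_path_uniform_approx[where b = "\<lambda>t. B t \<omega>", OF cont[OF \<omega>] B0[OF \<omega>] e3]
        unfolding eventually_sequentially by blast
      obtain n2 :: nat where n2: "real n2 > 3 / e" using reals_Archimedean2 by blast
      have "norm (skorokhod_dist (G n (X n \<omega>)) (sample_path B \<omega>) - 0) < e" if n: "n \<ge> max n1 n2" for n
      proof -
        have "skorokhod_dist (step_path (Suc n) (\<lambda>k. I n k \<omega>)) (sample_path B \<omega>) \<le> e / 3"
        proof (rule skorokhod_dist_uniform[OF step_path_cadlag path[OF \<omega>]])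
          fix t :: real assume "t \<in> {0..1}"
          then show "\<bar>step_path (Suc n) (\<lambda>k. I n k \<omega>) t - sample_path B \<omega> t\<bar> \<le> e / 3"
            using n1[of "Suc n"] n by (simp add: I_def sample_path_def)
        qed (use e3 in auto)
        moreover have "skorokhod_dist (G n (X n \<omega>)) (step_path (Suc n) (\<lambda>k. I n k \<omega>)) \<le> e / 3"
        proof -
          have "skorokhod_dist (G n (X n \<omega>)) (step_path (Suc n) (\<lambda>k. I n k \<omega>))
            \<le> (\<Sum>k<Suc n. \<bar>real_of_int (X n \<omega> ! k) / real (Suc n) ^ 2 - I n k \<omega>\<bar>)"
            unfolding G_def by (rule step_path_dist_le) simp
          also have "\<dots> \<le> (\<Sum>k<Suc n. 1 / real (Suc n) ^ 2)"
          proof (rule sum_mono)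
            fix k assume k: "k \<in> {..<Suc n}"
            have X: "X n \<omega> ! k = \<lfloor>real (Suc n) ^ 2 * I n k \<omega>\<rfloor>" using k by (simp add: X_def del: upt_Suc)
            define c where "c = real (Suc n) ^ 2"
            have "c > 0" by (simp add: c_def)
            have "\<bar>real_of_int \<lfloor>c * I n k \<omega>\<rfloor> - c * I n k \<omega>\<bar> \<le> 1" by linarith
            then have "\<bar>real_of_int \<lfloor>c * I n k \<omega>\<rfloor> - c * I n k \<omega>\<bar> / c \<le> 1 / c"
              using \<open>c > 0\<close> by (simp add: divide_right_mono)
            also have "\<bar>real_of_int \<lfloor>c * I n k \<omega>\<rfloor> - c * I n k \<omega>\<bar> / c = \<bar>real_of_int \<lfloor>c * I n k \<omega>\<rfloor> / c - I n k \<omega>\<bar>"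
            proof -
              have "real_of_int \<lfloor>c * I n k \<omega>\<rfloor> / c - I n k \<omega> = (real_of_int \<lfloor>c * I n k \<omega>\<rfloor> - c * I n k \<omega>) / c"
                using \<open>c > 0\<close> by (simp add: diff_divide_distrib)
              then show ?thesis using \<open>c > 0\<close> by simp
            qed
            finally show "\<bar>real_of_int (X n \<omega> ! k) / real (Suc n) ^ 2 - I n k \<omega>\<bar> \<le> 1 / real (Suc n) ^ 2"
              by (simp add: X c_def)
          qed
          also have "\<dots> = 1 / real (Suc n)" by (simp add: power2_eq_square)
          also have "\<dots> \<le> e / 3"
          proof -
            have "3 / e \<le> real (Suc n)" using n n2 by simp
            then show ?thesis using \<open>e > 0\<close> by (simp add: field_simps)
          qed
          finally show ?thesis .
        qed
        moreover have "skorokhod_dist (G n (X n \<omega>)) (sample_path B \<omega>) \<le>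
          skorokhod_dist (G n (X n \<omega>)) (step_path (Suc n) (\<lambda>k. I n k \<omega>))
          + skorokhod_dist (step_path (Suc n) (\<lambda>k. I n k \<omega>)) (sample_path B \<omega>)"
          using path[OF \<omega>] unfolding G_def by (intro triangle step_path_cadlag) auto
        ultimately show ?thesis using \<open>e > 0\<close> by simp
      qed
      then show "\<exists>n0. \<forall>n\<ge>n0. norm (skorokhod_dist (G n (X n \<omega>)) (sample_path B \<omega>) - 0) < e" by blast
    qed
  qed
qed

section \<open>Joint convergence of independent coordinates\<close>

lemma distr_PiM_coordinatewise:
  fixes \<Omega> :: "'i \<Rightarrow> 'b measure"
  assumes "finite I" and \<Omega>: "\<And>i. prob_space (\<Omega> i)" and f: "\<And>i. f i \<in> \<Omega> i \<rightarrow>\<^sub>M N i"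
  shows "distr (PiM I \<Omega>) (PiM I N) (\<lambda>w. \<lambda>i\<in>I. f i (w i)) = PiM I (\<lambda>i. distr (\<Omega> i) (N i) (f i))"
proof -
  interpret \<Omega>: product_prob_space \<Omega> by (rule product_prob_spaceI) (rule \<Omega>)
  interpret D: product_prob_space "\<lambda>i. distr (\<Omega> i) (N i) (f i)"
    by (rule product_prob_spaceI) (intro prob_space.prob_space_distr \<Omega> f)
  have m: "(\<lambda>w. \<lambda>i\<in>I. f i (w i)) \<in> PiM I \<Omega> \<rightarrow>\<^sub>M PiM I N"
    by (intro measurable_restrict measurable_compose[OF _ f] measurable_component_singleton)
  show ?thesis
  proof (rule D.PiM_eqI[OF \<open>finite I\<close>])
    show "sets (distr (PiM I \<Omega>) (PiM I N) (\<lambda>w. \<lambda>i\<in>I. f i (w i))) = sets (PiM I (\<lambda>i. distr (\<Omega> i) (N i) (f i)))"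
      by (simp cong: sets_PiM_cong)
    fix A assume A: "\<And>i. i \<in> I \<Longrightarrow> A i \<in> sets (distr (\<Omega> i) (N i) (f i))"
    have "emeasure (distr (PiM I \<Omega>) (PiM I N) (\<lambda>w. \<lambda>i\<in>I. f i (w i))) (Pi\<^sub>E I A)
      = emeasure (PiM I \<Omega>) ((\<lambda>w. \<lambda>i\<in>I. f i (w i)) -` Pi\<^sub>E I A \<inter> space (PiM I \<Omega>))"
      using A \<open>finite I\<close> by (intro emeasure_distr m sets_PiM_I_finite) auto
    also have "(\<lambda>w. \<lambda>i\<in>I. f i (w i)) -` Pi\<^sub>E I A \<inter> space (PiM I \<Omega>) = Pi\<^sub>E I (\<lambda>i. f i -` A i \<inter> space (\<Omega> i))"
      by (auto simp: space_PiM PiE_iff)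
    also have "emeasure (PiM I \<Omega>) \<dots> = (\<Prod>i\<in>I. emeasure (\<Omega> i) (f i -` A i \<inter> space (\<Omega> i)))"
      using A measurable_sets[OF f] by (intro \<Omega>.emeasure_PiM \<open>finite I\<close>) auto
    also have "\<dots> = (\<Prod>i\<in>I. emeasure (distr (\<Omega> i) (N i) (f i)) (A i))"
      using A f by (intro prod.cong refl) (simp add: emeasure_distr)
    finally show "emeasure (distr (PiM I \<Omega>) (PiM I N) (\<lambda>w. \<lambda>i\<in>I. f i (w i))) (Pi\<^sub>E I A)
      = (\<Prod>i\<in>I. emeasure (distr (\<Omega> i) (N i) (f i)) (A i))" .
  qed
qed

text \<open>
  Skorohod's theorem realises the convergence of every coordinate pointwise on some probability space.
  On the product of these spaces all coordinates converge at once, and dominated convergence applies.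
\<close>

lemma weak_conv_PiM:
  fixes \<mu> :: "nat \<Rightarrow> 'i \<Rightarrow> real measure" and g :: "('i \<Rightarrow> real) \<Rightarrow> real"
  assumes I: "finite I"
    and \<mu>: "\<And>n i. real_distribution (\<mu> n i)" and \<mu>': "\<And>i. real_distribution (\<mu>' i)"
    and conv: "\<And>i. weak_conv_m (\<lambda>n. \<mu> n i) (\<mu>' i)"
    and g: "g \<in> borel_measurable (PiM I (\<lambda>_. borel))" and bnd: "\<And>z. \<bar>g z\<bar> \<le> K"
    and cont: "\<And>zs z. (\<And>i. i \<in> I \<Longrightarrow> (\<lambda>n. zs n i) \<longlonglongrightarrow> z i) \<Longrightarrow> (\<lambda>n. g (zs n)) \<longlonglongrightarrow> g z"
  shows "(\<lambda>n. \<integral>z. g z \<partial>PiM I (\<mu> n)) \<longlonglongrightarrow> (\<integral>z. g z \<partial>PiM I \<mu>')"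
proof -
  have "\<exists>(\<Omega> :: real measure) (Ys :: nat \<Rightarrow> real \<Rightarrow> real) (Y :: real \<Rightarrow> real). prob_space \<Omega> \<and> (\<forall>n. Ys n \<in> measurable \<Omega> borel) \<and> (\<forall>n. distr \<Omega> borel (Ys n) = \<mu> n i) \<and>
    Y \<in> measurable \<Omega> lborel \<and> distr \<Omega> borel Y = \<mu>' i \<and> (\<forall>x \<in> space \<Omega>. (\<lambda>n. Ys n x) \<longlonglongrightarrow> Y x)"
    for i by (rule Skorohod[of "\<lambda>n. \<mu> n i", OF \<mu> \<mu>' conv])
  then obtain \<Omega> :: "'i \<Rightarrow> real measure" and Ys :: "'i \<Rightarrow> nat \<Rightarrow> real \<Rightarrow> real" and Y :: "'i \<Rightarrow> real \<Rightarrow> real" where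
    \<Omega>: "\<And>i. prob_space (\<Omega> i)" and Ys: "\<And>i n. Ys i n \<in> measurable (\<Omega> i) borel"
    and dYs: "\<And>i n. distr (\<Omega> i) borel (Ys i n) = \<mu> n i" and Y': "\<And>i. Y i \<in> measurable (\<Omega> i) lborel"
    and dY: "\<And>i. distr (\<Omega> i) borel (Y i) = \<mu>' i"
    and lim: "\<And>i x. x \<in> space (\<Omega> i) \<Longrightarrow> (\<lambda>n. Ys i n x) \<longlonglongrightarrow> Y i x"
    by metis
  have Y: "Y i \<in> measurable (\<Omega> i) borel" for i using Y'[of i] by simp
  interpret P: prob_space "PiM I \<Omega>" by (rule prob_space_PiM) (rule \<Omega>)
  have mYs: "(\<lambda>w. \<lambda>i\<in>I. Ys i n (w i)) \<in> PiM I \<Omega> \<rightarrow>\<^sub>M PiM I (\<lambda>_. borel)" for n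
    by (intro measurable_restrict measurable_compose[OF _ Ys] measurable_component_singleton)
  have mY: "(\<lambda>w. \<lambda>i\<in>I. Y i (w i)) \<in> PiM I \<Omega> \<rightarrow>\<^sub>M PiM I (\<lambda>_. borel)"
    by (intro measurable_restrict measurable_compose[OF _ Y] measurable_component_singleton)
  have "(\<integral>z. g z \<partial>PiM I (\<mu> n)) = (\<integral>w. g (\<lambda>i\<in>I. Ys i n (w i)) \<partial>PiM I \<Omega>)" for n
    using distr_PiM_coordinatewise[where f = "\<lambda>i. Ys i n" and N = "\<lambda>_. borel", OF I \<Omega> Ys] integral_distr[OF mYs[of n] g]
    by (simp add: dYs)
  moreover have "(\<integral>z. g z \<partial>PiM I \<mu>') = (\<integral>w. g (\<lambda>i\<in>I. Y i (w i)) \<partial>PiM I \<Omega>)"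
    using distr_PiM_coordinatewise[where f = Y and N = "\<lambda>_. borel", OF I \<Omega> Y] integral_distr[OF mY g]
    by (simp add: dY)
  moreover have "(\<lambda>n. \<integral>w. g (\<lambda>i\<in>I. Ys i n (w i)) \<partial>PiM I \<Omega>) \<longlonglongrightarrow> (\<integral>w. g (\<lambda>i\<in>I. Y i (w i)) \<partial>PiM I \<Omega>)"
  proof (rule integral_dominated_convergence[where w = "\<lambda>_. K"])
    show "AE w in PiM I \<Omega>. (\<lambda>n. g (\<lambda>i\<in>I. Ys i n (w i))) \<longlonglongrightarrow> g (\<lambda>i\<in>I. Y i (w i))"
    proof (rule AE_I2)
      fix w assume "w \<in> space (PiM I \<Omega>)"
      then show "(\<lambda>n. g (\<lambda>i\<in>I. Ys i n (w i))) \<longlonglongrightarrow> g (\<lambda>i\<in>I. Y i (w i))"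
        by (intro cont) (auto simp: space_PiM intro!: lim)
    qed
  qed (use measurable_compose[OF mYs g] measurable_compose[OF mY g] bnd in auto)
  ultimately show ?thesis by simp
qed

lemma (in prob_space) expectation_indep_vars_PiM:
  fixes Z :: "'i \<Rightarrow> 'a \<Rightarrow> real" and g :: "('i \<Rightarrow> real) \<Rightarrow> real"
  assumes "I \<noteq> {}" and Z: "indep_vars (\<lambda>_. borel) Z I"
    and g: "g \<in> borel_measurable (PiM I (\<lambda>_. borel))"
    and cong: "\<And>z z'. (\<And>i. i \<in> I \<Longrightarrow> z i = z' i) \<Longrightarrow> g z = g z'"
  shows "expectation (\<lambda>\<omega>. g (\<lambda>i. Z i \<omega>)) = (\<integral>z. g z \<partial>PiM I (\<lambda>i. distr M borel (Z i)))"
proof -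
  have rv: "\<And>i. i \<in> I \<Longrightarrow> random_variable borel (Z i)" using Z by (simp add: indep_vars_def)
  have "(\<integral>z. g z \<partial>PiM I (\<lambda>i. distr M borel (Z i))) = (\<integral>z. g z \<partial>distr M (PiM I (\<lambda>_. borel)) (\<lambda>\<omega>. \<lambda>i\<in>I. Z i \<omega>))"
    using Z indep_vars_iff_distr_eq_PiM'[OF \<open>I \<noteq> {}\<close> rv] by simp
  also have "\<dots> = expectation (\<lambda>\<omega>. g (\<lambda>i\<in>I. Z i \<omega>))"
    by (intro integral_distr g measurable_restrict rv)
  also have "\<dots> = expectation (\<lambda>\<omega>. g (\<lambda>i. Z i \<omega>))"
    by (intro Bochner_Integration.integral_cong refl cong) simp
  finally show ?thesis by simp
qed

section \<open>A criterion for convergence to Brownian motion\<close>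

lemma real_distribution_normal: "0 < s \<Longrightarrow> real_distribution (density lborel (normal_density m s))"
  using prob_space_normal_density by (auto simp: real_distribution_def real_distribution_axioms_def)

lemma Brownian_grid_increments:
  assumes B: "standard_brownian_motion N B" and m: "0 < m"
  shows "prob_space.indep_vars N (\<lambda>_. borel) (\<lambda>k \<omega>. B ((real k + 1) / real m) \<omega> - B (real k / real m) \<omega>) {..<m}"
    and "k < m \<Longrightarrow> distr N borel (\<lambda>\<omega>. B ((real k + 1) / real m) \<omega> - B (real k / real m) \<omega>)
      = density lborel (normal_density 0 (sqrt (1 / real m)))"
proof -
  have "mono_on {..m} (\<lambda>k. real k / real m)" "(\<lambda>k. real k / real m) ` {..m} \<subseteq> {0..1}"
    using m by (auto simp: mono_on_def divide_right_mono)
  then have "prob_space.indep_vars N (\<lambda>_. borel) (\<lambda>k \<omega>. B (real (Suc k) / real m) \<omega> - B (real k / real m) \<omega>) {..<m}"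
    using B unfolding standard_brownian_motion_def by blast
  then show "prob_space.indep_vars N (\<lambda>_. borel) (\<lambda>k \<omega>. B ((real k + 1) / real m) \<omega> - B (real k / real m) \<omega>) {..<m}"
    by (simp add: add.commute)
  assume k: "k < m"
  have "distributed N lborel (\<lambda>\<omega>. B ((real k + 1) / real m) \<omega> - B (real k / real m) \<omega>)
    (normal_density 0 (sqrt ((real k + 1) / real m - real k / real m)))"
  proof -
    have "0 \<le> real k / real m" "real k / real m < (real k + 1) / real m" "(real k + 1) / real m \<le> 1"
      using k by (auto simp: divide_strict_right_mono)
    then show ?thesis using B unfolding standard_brownian_motion_def by blast
  qed
  moreover have "(real k + 1) / real m - real k / real m = 1 / real m" by (simp add: diff_divide_distrib[symmetric])
  ultimately have "distr N lborel (\<lambda>\<omega>. B ((real k + 1) / real m) \<omega> - B (real k / real m) \<omega>)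
      = density lborel (normal_density 0 (sqrt (1 / real m)))"
    by (simp add: distributed_def)
  then show "distr N borel (\<lambda>\<omega>. B ((real k + 1) / real m) \<omega> - B (real k / real m) \<omega>)
      = density lborel (normal_density 0 (sqrt (1 / real m)))"
    by (simp cong: distr_cong)
qed

lemma step_path_functional_Lipschitz:
  fixes \<phi> :: "(real \<Rightarrow> real) \<Rightarrow> real"
  assumes "0 < m" "0 \<le> L"
    and Lip: "\<And>x y. x \<in> cadlag_paths \<Longrightarrow> y \<in> cadlag_paths \<Longrightarrow> \<bar>\<phi> x - \<phi> y\<bar> \<le> L * skorokhod_dist x y"
  shows "\<bar>\<phi> (step_path m w) - \<phi> (step_path m z)\<bar> \<le> L * (\<Sum>k<m. \<bar>w k - z k\<bar>)"
proof -
  have "\<bar>\<phi> (step_path m w) - \<phi> (step_path m z)\<bar> \<le> L * skorokhod_dist (step_path m w) (step_path m z)"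
    using step_path_cadlag[OF assms(1)] by (intro Lip) auto
  also have "\<dots> \<le> L * (\<Sum>k<m. \<bar>w k - z k\<bar>)"
    using assms by (intro mult_left_mono step_path_dist_le)
  finally show ?thesis .
qed

text \<open>
  A Lipschitz functional of a step path is continuous in the increments, which makes it an admissible
  test function on the product of the laws of the increments.
\<close>

lemma step_path_functional_tendsto:
  fixes \<phi> :: "(real \<Rightarrow> real) \<Rightarrow> real"
  assumes "0 < m" "0 \<le> L"
    and Lip: "\<And>x y. x \<in> cadlag_paths \<Longrightarrow> y \<in> cadlag_paths \<Longrightarrow> \<bar>\<phi> x - \<phi> y\<bar> \<le> L * skorokhod_dist x y"
    and lim: "\<And>k. k < m \<Longrightarrow> ((\<lambda>n. zs n k) \<longlongrightarrow> z k) F"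
  shows "((\<lambda>n. \<phi> (step_path m (zs n))) \<longlongrightarrow> \<phi> (step_path m z)) F"
proof -
  have "((\<lambda>n. L * (\<Sum>k<m. \<bar>zs n k - z k\<bar>)) \<longlongrightarrow> L * (\<Sum>k<m. \<bar>z k - z k\<bar>)) F"
    using lim by (intro tendsto_intros) auto
  then have "((\<lambda>n. L * (\<Sum>k<m. \<bar>zs n k - z k\<bar>)) \<longlongrightarrow> 0) F" by simp
  then have "((\<lambda>n. \<phi> (step_path m (zs n)) - \<phi> (step_path m z)) \<longlongrightarrow> 0) F"
    by (rule Lim_null_comparison[rotated])
      (use step_path_functional_Lipschitz[OF assms(1-3)] in auto)
  then show ?thesis by (simp add: LIM_zero_iff)
qed

lemma measurable_step_path_functional:
  fixes \<phi> :: "(real \<Rightarrow> real) \<Rightarrow> real"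
  assumes "0 < m" "0 \<le> L"
    and Lip: "\<And>x y. x \<in> cadlag_paths \<Longrightarrow> y \<in> cadlag_paths \<Longrightarrow> \<bar>\<phi> x - \<phi> y\<bar> \<le> L * skorokhod_dist x y"
    and Z: "\<And>k. k < m \<Longrightarrow> Z k \<in> borel_measurable N"
  shows "(\<lambda>\<omega>. \<phi> (step_path m (\<lambda>k. Z k \<omega>))) \<in> borel_measurable N"
proof -
  have "continuous_on UNIV (\<lambda>z::nat \<Rightarrow> real. \<phi> (step_path m z))"
    unfolding continuous_on_def
  proof
    fix z :: "nat \<Rightarrow> real"
    have "((\<lambda>w. w k) \<longlongrightarrow> z k) (at z within UNIV)" for k
      using continuous_on_product_coordinates[of k] unfolding continuous_on_def by blast
    then show "((\<lambda>z. \<phi> (step_path m z)) \<longlongrightarrow> \<phi> (step_path m z)) (at z within UNIV)"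
      by (intro step_path_functional_tendsto[OF assms(1-3)]) auto
  qed
  then have g: "(\<lambda>z::nat \<Rightarrow> real. \<phi> (step_path m z)) \<in> borel_measurable borel"
    by (rule borel_measurable_continuous_onI)
  have "(\<lambda>\<omega> k. if k < m then Z k \<omega> else 0) \<in> borel_measurable N"
  proof (rule measurable_coordinatewise_then_product)
    show "(\<lambda>\<omega>. if k < m then Z k \<omega> else 0) \<in> borel_measurable N" for k
      using Z by (cases "k < m") auto
  qed
  then have "(\<lambda>\<omega>. \<phi> (step_path m (\<lambda>k. if k < m then Z k \<omega> else 0))) \<in> borel_measurable N"
    using g by (rule measurable_compose)
  also have "(\<lambda>\<omega>. \<phi> (step_path m (\<lambda>k. if k < m then Z k \<omega> else 0))) = (\<lambda>\<omega>. \<phi> (step_path m (\<lambda>k. Z k \<omega>)))"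
    by (intro ext arg_cong[where f = \<phi>] step_path_cong) simp
  finally show ?thesis .
qed

text \<open>
  It suffices to approximate \<open>Y n\<close>, uniformly and up to small probability, by step paths with independent
  increments that are asymptotically normal with variance \<open>1/m\<close>. For a Lipschitz functional \<open>\<phi>\<close> three
  errors are compared: \<open>Y n\<close> against its step path, that step path against the one of \<open>B\<close>, and the latter
  against \<open>B\<close>. The outer two are small for large \<open>m\<close>; for fixed \<open>m\<close> the middle one tends to 0 with \<open>n\<close>.
  Closeness is stated through an exceptional set \<open>A\<close> because the supremum over \<open>t\<close> need not be measurable.
\<close>

lemma donsker_criterion:
  fixes Y :: "nat \<Rightarrow> 'a \<Rightarrow> real \<Rightarrow> real" and Z :: "nat \<Rightarrow> nat \<Rightarrow> nat \<Rightarrow> 'a \<Rightarrow> real"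
  assumes P: "prob_space P" and B: "standard_brownian_motion N B"
    and Y: "\<forall>\<^sub>F n in sequentially. Y n \<in> P \<rightarrow>\<^sub>M borel_sigma skorokhod_topology"
    and Z: "\<And>m n k. Z m n k \<in> borel_measurable P"
    and indep: "\<And>m n. 0 < m \<Longrightarrow> prob_space.indep_vars P (\<lambda>_. borel) (Z m n) {..<m}"
    and conv: "\<And>m k. 0 < m \<Longrightarrow> weak_conv_m (\<lambda>n. distr P borel (Z m n k))
        (density lborel (normal_density 0 (sqrt (1 / real m))))"
    and close: "\<And>\<epsilon> \<eta>. 0 < \<epsilon> \<Longrightarrow> 0 < \<eta> \<Longrightarrow> \<forall>\<^sub>F m in sequentially. \<forall>\<^sub>F n in sequentially.
        \<exists>A\<in>sets P. measure P A \<le> \<eta> \<and>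
          (\<forall>\<omega>\<in>space P - A. \<forall>t\<in>{0..1}. \<bar>Y n \<omega> t - step_path m (\<lambda>k. Z m n k \<omega>) t\<bar> \<le> \<epsilon>)"
  shows "converges_in_distribution skorokhod_topology P Y sequentially N (sample_path B)"
proof -
  interpret P: prob_space P by fact
  interpret N: prob_space N using B by (simp add: standard_brownian_motion_def)
  interpret Metric_space cadlag_paths skorokhod_dist by (rule Metric_space_skorokhod)
  have Bm: "\<And>t. t \<in> {0..1} \<Longrightarrow> B t \<in> borel_measurable N"
    and Bc: "\<And>\<omega>. \<omega> \<in> space N \<Longrightarrow> continuous_on {0..1} (\<lambda>t. B t \<omega>)"
    and B0: "\<And>\<omega>. \<omega> \<in> space N \<Longrightarrow> B 0 \<omega> = 0"
    using B unfolding standard_brownian_motion_def by blast+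
  have mB: "sample_path B \<in> N \<rightarrow>\<^sub>M borel_sigma skorokhod_topology"
    by (rule measurable_sample_path_continuous[OF Bm Bc B0])
  have pB: "sample_path B \<omega> \<in> cadlag_paths" if "\<omega> \<in> space N" for \<omega>
    using measurable_space[OF mB that] by simp
  define V where "V m k \<omega> = B ((real k + 1) / real m) \<omega> - B (real k / real m) \<omega>" for m k :: nat and \<omega>
  have V: "V m k \<in> borel_measurable N" if "k < m" for m k
    unfolding V_def using that by (intro borel_measurable_diff Bm) (auto simp: field_simps)
  have Lip: "(\<lambda>n. LINT \<omega>|P. \<phi> (Y n \<omega>)) \<longlonglongrightarrow> (LINT \<omega>|N. \<phi> (sample_path B \<omega>))"
    if K: "\<And>x. x \<in> cadlag_paths \<Longrightarrow> \<bar>\<phi> x\<bar> \<le> K" and L: "0 \<le> L"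
      and lip: "\<And>x y. x \<in> cadlag_paths \<Longrightarrow> y \<in> cadlag_paths \<Longrightarrow> \<bar>\<phi> x - \<phi> y\<bar> \<le> L * skorokhod_dist x y"
    for \<phi> :: "(real \<Rightarrow> real) \<Rightarrow> real" and K L
  proof -
    have "continuous_map mtopology euclideanreal \<phi>" by (rule continuous_map_Lipschitz) (rule lip)
    then have cont: "continuous_map skorokhod_topology euclideanreal \<phi>"
      by (simp add: skorokhod_topology_def)
    have K0: "0 \<le> K" using K[OF step_path_cadlag[of 1 "\<lambda>_. 0"]] by simp
    have tB: "(\<lambda>m. LINT \<omega>|N. \<phi> (step_path m (\<lambda>k. V m k \<omega>))) \<longlonglongrightarrow> (LINT \<omega>|N. \<phi> (sample_path B \<omega>))"
    \<comment> \<open>A grid needs at least one cell, hence the shift to Suc m.\<close>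
    proof (rule LIMSEQ_imp_Suc, rule integral_dominated_convergence[where w = "\<lambda>_. K"])
      show "(\<lambda>\<omega>. \<phi> (sample_path B \<omega>)) \<in> borel_measurable N"
        by (rule measurable_continuous_functional[OF mB cont])
      show "(\<lambda>\<omega>. \<phi> (step_path (Suc m) (\<lambda>k. V (Suc m) k \<omega>))) \<in> borel_measurable N" for m
        by (rule measurable_step_path_functional[OF _ L lip V]) auto
      show "AE \<omega> in N. (\<lambda>m. \<phi> (step_path (Suc m) (\<lambda>k. V (Suc m) k \<omega>))) \<longlonglongrightarrow> \<phi> (sample_path B \<omega>)"
      proof (intro AE_I2 LIMSEQ_I)
        fix \<omega> and e :: real assume \<omega>: "\<omega> \<in> space N" and "e > 0"
        define d where "d = e / (L + 1)"
        have d: "d > 0" using \<open>e > 0\<close> L by (simp add: d_def)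
        obtain n0 where n0: "\<And>m. m \<ge> n0 \<Longrightarrow> \<forall>t\<in>{0..1}. \<bar>step_path m (\<lambda>k. V m k \<omega>) t - B t \<omega>\<bar> \<le> d"
          using step_path_uniform_approx[where b = "\<lambda>t. B t \<omega>", OF Bc[OF \<omega>] B0[OF \<omega>] d]
          unfolding eventually_sequentially V_def by blast
        have "norm (\<phi> (step_path (Suc m) (\<lambda>k. V (Suc m) k \<omega>)) - \<phi> (sample_path B \<omega>)) < e" if "m \<ge> n0" for m
        proof -
          have "\<bar>\<phi> (step_path (Suc m) (\<lambda>k. V (Suc m) k \<omega>)) - \<phi> (sample_path B \<omega>)\<bar>
            \<le> L * skorokhod_dist (step_path (Suc m) (\<lambda>k. V (Suc m) k \<omega>)) (sample_path B \<omega>)"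
            by (rule lip) (auto intro: step_path_cadlag pB[OF \<omega>])
          also have "\<dots> \<le> L * d"
            using n0[of "Suc m"] that d
            by (intro mult_left_mono L skorokhod_dist_uniform step_path_cadlag pB[OF \<omega>])
              (auto simp: sample_path_def)
          also have "\<dots> < e" using \<open>e > 0\<close> L by (simp add: d_def field_simps)
          finally show ?thesis by simp
        qed
        then show "\<exists>n0. \<forall>m\<ge>n0. norm (\<phi> (step_path (Suc m) (\<lambda>k. V (Suc m) k \<omega>)) - \<phi> (sample_path B \<omega>)) < e" by blast
      qed
    qed (auto intro: K step_path_cadlag)
    have tZ: "(\<lambda>n. LINT \<omega>|P. \<phi> (step_path m (\<lambda>k. Z m n k \<omega>))) \<longlonglongrightarrow> (LINT \<omega>|N. \<phi> (step_path m (\<lambda>k. V m k \<omega>)))"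
      if m: "0 < m" for m
    proof -
      let ?g = "\<lambda>z. \<phi> (step_path m z)"
      have g: "?g \<in> borel_measurable (PiM {..<m} (\<lambda>_. borel))"
        by (rule measurable_step_path_functional[OF m L lip]) auto
      have cong: "?g z = ?g z'" if "\<And>k. k \<in> {..<m} \<Longrightarrow> z k = z' k" for z z'
        using that by (intro arg_cong[where f = \<phi>] step_path_cong) simp
      have ne: "{..<m} \<noteq> {}" using m by auto
      have "(\<lambda>n. \<integral>z. ?g z \<partial>PiM {..<m} (\<lambda>k. distr P borel (Z m n k)))
        \<longlonglongrightarrow> (\<integral>z. ?g z \<partial>PiM {..<m} (\<lambda>k. density lborel (normal_density 0 (sqrt (1 / real m)))))"
      proof (rule weak_conv_PiM[where K = K])
        show "real_distribution (distr P borel (Z m n k))" for n k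
          by (rule P.real_distribution_distr) (rule Z)
        show "real_distribution (density lborel (normal_density 0 (sqrt (1 / real m))))"
          using m by (intro real_distribution_normal) simp
        show "\<bar>?g z\<bar> \<le> K" for z by (intro K step_path_cadlag m)
        show "(\<lambda>n. ?g (zs n)) \<longlonglongrightarrow> ?g z" if "\<And>i. i \<in> {..<m} \<Longrightarrow> (\<lambda>n. zs n i) \<longlonglongrightarrow> z i" for zs z
          using that by (intro step_path_functional_tendsto[OF m L lip]) auto
      qed (use g conv m in auto)
      moreover have "(LINT \<omega>|P. ?g (\<lambda>k. Z m n k \<omega>)) = (\<integral>z. ?g z \<partial>PiM {..<m} (\<lambda>k. distr P borel (Z m n k)))" for n
        by (rule P.expectation_indep_vars_PiM[OF ne indep[OF m] g cong])
      moreover have "(LINT \<omega>|N. ?g (\<lambda>k. V m k \<omega>)) = (\<integral>z. ?g z \<partial>PiM {..<m} (\<lambda>k. distr N borel (V m k)))"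
        using Brownian_grid_increments(1)[OF B m]
        by (intro N.expectation_indep_vars_PiM[OF ne _ g cong]) (auto simp: V_def[abs_def])
      moreover have "PiM {..<m} (\<lambda>k. distr N borel (V m k))
        = PiM {..<m} (\<lambda>k. density lborel (normal_density 0 (sqrt (1 / real m))))"
        using Brownian_grid_increments(2)[OF B m] by (intro PiM_cong refl) (simp add: V_def[abs_def])
      ultimately show ?thesis by simp
    qed
    show ?thesis
    proof (rule tendstoI)
      fix e :: real assume "e > 0"
      \<comment> \<open>Then the Lipschitz bound off the exceptional set and the trivial bound 2 * K on it contribute at most e / 8 each.\<close>
      define \<epsilon> where "\<epsilon> = e / (8 * (L + 1))"
      define \<eta> where "\<eta> = e / (16 * (K + 1))"
      have \<epsilon>: "\<epsilon> > 0" "L * \<epsilon> \<le> e / 8" using \<open>e > 0\<close> L by (auto simp: \<epsilon>_def field_simps)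
      have \<eta>: "\<eta> > 0" "2 * K * \<eta> \<le> e / 8" using \<open>e > 0\<close> K0 by (auto simp: \<eta>_def field_simps)
      have "\<forall>\<^sub>F m in sequentially. dist (LINT \<omega>|N. \<phi> (step_path m (\<lambda>k. V m k \<omega>))) (LINT \<omega>|N. \<phi> (sample_path B \<omega>)) < e / 4"
        using \<open>e > 0\<close> by (intro tendstoD[OF tB]) simp
      with close[OF \<epsilon>(1) \<eta>(1)] eventually_gt_at_top[of "0::nat"]
      have "\<forall>\<^sub>F m in sequentially. 0 < m \<and>
        dist (LINT \<omega>|N. \<phi> (step_path m (\<lambda>k. V m k \<omega>))) (LINT \<omega>|N. \<phi> (sample_path B \<omega>)) < e / 4 \<and>
        (\<forall>\<^sub>F n in sequentially. \<exists>A\<in>sets P. measure P A \<le> \<eta> \<and>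
          (\<forall>\<omega>\<in>space P - A. \<forall>t\<in>{0..1}. \<bar>Y n \<omega> t - step_path m (\<lambda>k. Z m n k \<omega>) t\<bar> \<le> \<epsilon>))"
        by eventually_elim blast
      then obtain m where m: "0 < m"
        and mB: "dist (LINT \<omega>|N. \<phi> (step_path m (\<lambda>k. V m k \<omega>))) (LINT \<omega>|N. \<phi> (sample_path B \<omega>)) < e / 4"
        and mY: "\<forall>\<^sub>F n in sequentially. \<exists>A\<in>sets P. measure P A \<le> \<eta> \<and>
          (\<forall>\<omega>\<in>space P - A. \<forall>t\<in>{0..1}. \<bar>Y n \<omega> t - step_path m (\<lambda>k. Z m n k \<omega>) t\<bar> \<le> \<epsilon>)"
        using eventually_happens'[OF sequentially_bot] by blast
      have "\<forall>\<^sub>F n in sequentially. dist (LINT \<omega>|P. \<phi> (step_path m (\<lambda>k. Z m n k \<omega>))) (LINT \<omega>|N. \<phi> (step_path m (\<lambda>k. V m k \<omega>))) < e / 4"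
        using \<open>e > 0\<close> by (intro tendstoD[OF tZ[OF m]]) simp
      with mY Y show "\<forall>\<^sub>F n in sequentially. dist (LINT \<omega>|P. \<phi> (Y n \<omega>)) (LINT \<omega>|N. \<phi> (sample_path B \<omega>)) < e"
      proof eventually_elim
        case (elim n)
        then obtain A where A: "A \<in> sets P" "measure P A \<le> \<eta>"
          and cl: "\<And>\<omega> t. \<omega> \<in> space P - A \<Longrightarrow> t \<in> {0..1} \<Longrightarrow> \<bar>Y n \<omega> t - step_path m (\<lambda>k. Z m n k \<omega>) t\<bar> \<le> \<epsilon>" by blast
        have pY: "Y n \<omega> \<in> cadlag_paths" if "\<omega> \<in> space P" for \<omega>
          using measurable_space[OF elim(2) that] by simp
        have sZ: "step_path m z \<in> cadlag_paths" for z by (rule step_path_cadlag[OF m])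
        have i1: "integrable P (\<lambda>\<omega>. \<phi> (Y n \<omega>))"
          by (rule P.integrable_const_bound[where B = K])
            (use K pY measurable_continuous_functional[OF elim(2) cont] in auto)
        have i2: "integrable P (\<lambda>\<omega>. \<phi> (step_path m (\<lambda>k. Z m n k \<omega>)))"
          by (rule P.integrable_const_bound[where B = K])
            (use K sZ measurable_step_path_functional[OF m L lip Z] in auto)
        have "\<bar>(LINT \<omega>|P. \<phi> (Y n \<omega>)) - (LINT \<omega>|P. \<phi> (step_path m (\<lambda>k. Z m n k \<omega>)))\<bar>
          = \<bar>LINT \<omega>|P. \<phi> (Y n \<omega>) - \<phi> (step_path m (\<lambda>k. Z m n k \<omega>))\<bar>"
          using i1 i2 by simp
        also have "\<dots> \<le> (LINT \<omega>|P. \<bar>\<phi> (Y n \<omega>) - \<phi> (step_path m (\<lambda>k. Z m n k \<omega>))\<bar>)"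
          by (rule integral_abs_bound)
        also have "\<dots> \<le> (LINT \<omega>|P. L * \<epsilon> + 2 * K * indicator A \<omega>)"
        proof (rule integral_mono)
          show "integrable P (\<lambda>\<omega>. L * \<epsilon> + 2 * K * indicator A \<omega>)" using A(1) by (simp add: less_top[symmetric])
          fix \<omega> assume \<omega>: "\<omega> \<in> space P"
          show "\<bar>\<phi> (Y n \<omega>) - \<phi> (step_path m (\<lambda>k. Z m n k \<omega>))\<bar> \<le> L * \<epsilon> + 2 * K * indicator A \<omega>"
          proof (cases "\<omega> \<in> A")
            case True
            have "0 \<le> L * \<epsilon>" using L \<epsilon> by simp
            then show ?thesis using True K[OF pY[OF \<omega>]] K[OF sZ[of "\<lambda>k. Z m n k \<omega>"]] by simp
          next
            case False
            have "\<bar>\<phi> (Y n \<omega>) - \<phi> (step_path m (\<lambda>k. Z m n k \<omega>))\<bar> \<le> L * skorokhod_dist (Y n \<omega>) (step_path m (\<lambda>k. Z m n k \<omega>))"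
              by (rule lip[OF pY[OF \<omega>] sZ])
            also have "\<dots> \<le> L * \<epsilon>"
              using cl[of \<omega>] False \<omega> \<epsilon>(1) by (intro mult_left_mono L skorokhod_dist_uniform pY sZ) auto
            finally show ?thesis using False by simp
          qed
        qed (use i1 i2 in auto)
        also have "\<dots> = L * \<epsilon> + 2 * K * measure P A"
          using A(1) by (simp add: less_top[symmetric] P.prob_space)
        also have "\<dots> \<le> e / 8 + e / 8"
          using \<epsilon> \<eta> A(2) K0 mult_left_mono[OF A(2), of "2 * K"] by linarith
        finally show ?case using elim(3) mB unfolding dist_real_def by linarith
      qed
    qed
  qed
  show ?thesis
    unfolding converges_in_distribution_def
  proof (intro conjI allI impI)
    fix \<phi> :: "(real \<Rightarrow> real) \<Rightarrow> real"
    assume \<phi>: "continuous_map skorokhod_topology euclideanreal \<phi>" "bounded (\<phi> ` topspace skorokhod_topology)"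
    then obtain K where K: "\<And>x. x \<in> cadlag_paths \<Longrightarrow> \<bar>\<phi> x\<bar> \<le> K"
      by (auto simp: bounded_iff)
    show "(\<lambda>n. LINT \<omega>|P. \<phi> (Y n \<omega>)) \<longlonglongrightarrow> (LINT \<omega>|N. \<phi> (sample_path B \<omega>))"
    proof (rule portmanteau_Lipschitz[where K = K and \<phi> = \<phi> and Y = Y and Z = "sample_path B"])
      show "prob_space P" "prob_space N" by unfold_locales
      show "\<forall>\<^sub>F n in sequentially. \<forall>\<omega>\<in>space P. Y n \<omega> \<in> cadlag_paths"
        using Y by eventually_elim (auto dest: measurable_space)
      show "\<forall>\<^sub>F n in sequentially. (\<lambda>\<omega>. \<psi> (Y n \<omega>)) \<in> borel_measurable P"
        if "continuous_map mtopology euclideanreal \<psi>" for \<psi> :: "(real \<Rightarrow> real) \<Rightarrow> real"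
        using Y by eventually_elim (rule measurable_continuous_functional[OF _ that[folded skorokhod_topology_def]])
      show "(\<lambda>\<omega>. \<psi> (sample_path B \<omega>)) \<in> borel_measurable N"
        if "continuous_map mtopology euclideanreal \<psi>" for \<psi> :: "(real \<Rightarrow> real) \<Rightarrow> real"
        by (rule measurable_continuous_functional[OF mB that[folded skorokhod_topology_def]])
      show "continuous_map mtopology euclideanreal \<phi>" using \<phi>(1) by (simp add: skorokhod_topology_def)
      show "(\<lambda>n. LINT \<omega>|P. \<psi> (Y n \<omega>)) \<longlonglongrightarrow> (LINT \<omega>|N. \<psi> (sample_path B \<omega>))"
        if "\<And>x. x \<in> cadlag_paths \<Longrightarrow> \<bar>\<psi> x\<bar> \<le> K'" "0 \<le> L"
          "\<And>x y. x \<in> cadlag_paths \<Longrightarrow> y \<in> cadlag_paths \<Longrightarrow> \<bar>\<psi> x - \<psi> y\<bar> \<le> L * skorokhod_dist x y"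
        for \<psi> :: "(real \<Rightarrow> real) \<Rightarrow> real" and K' L
        by (rule Lip) (fact that)+
    qed (use pB K in auto)
  qed (use Y mB in auto)
qed

lemma converges_in_distribution_at_topI:
  fixes Y :: "real \<Rightarrow> 'a \<Rightarrow> 'b"
  assumes "\<forall>\<^sub>F \<nu> in at_top. Y \<nu> \<in> P \<rightarrow>\<^sub>M borel_sigma T"
    and seq: "\<And>\<nu>. filterlim \<nu> at_top sequentially \<Longrightarrow> (\<And>n. 0 < \<nu> n) \<Longrightarrow>
      converges_in_distribution T P (\<lambda>n. Y (\<nu> n)) sequentially N Z"
  shows "converges_in_distribution T P Y at_top N Z"
  unfolding converges_in_distribution_def
proof (intro conjI allI impI)
  have "filterlim (\<lambda>n. real (Suc n)) at_top sequentially"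
    by (rule filterlim_compose[OF filterlim_real_sequentially filterlim_Suc])
  then show "Z \<in> N \<rightarrow>\<^sub>M borel_sigma T"
    using seq[of "\<lambda>n. real (Suc n)"] by (simp add: converges_in_distribution_def)
  fix \<phi> assume \<phi>: "continuous_map T euclideanreal \<phi>" "bounded (\<phi> ` topspace T)"
  show "((\<lambda>\<nu>. LINT \<omega>|P. \<phi> (Y \<nu> \<omega>)) \<longlongrightarrow> (LINT \<omega>|N. \<phi> (Z \<omega>))) at_top"
  proof (rule tendsto_at_topI_sequentially)
    fix X :: "nat \<Rightarrow> real" assume X: "filterlim X at_top sequentially"
    \<comment> \<open>Truncation at 1 makes every member positive and changes only finitely many of them.\<close>
    then have ev: "\<forall>\<^sub>F n in sequentially. max 1 (X n) = X n"
      unfolding filterlim_at_top by (auto simp: max_def elim: eventually_mono[of "\<lambda>n. 1 \<le> X n"])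
    have "filterlim (\<lambda>n. max 1 (X n)) at_top sequentially"
      using X by (rule filterlim_cong[OF refl refl ev, THEN iffD2])
    then have "converges_in_distribution T P (\<lambda>n. Y (max 1 (X n))) sequentially N Z"
      by (rule seq) (simp add: less_max_iff_disj)
    then have "(\<lambda>n. LINT \<omega>|P. \<phi> (Y (max 1 (X n)) \<omega>)) \<longlonglongrightarrow> (LINT \<omega>|N. \<phi> (Z \<omega>))"
      using \<phi> unfolding converges_in_distribution_def by blast
    then show "(\<lambda>n. LINT \<omega>|P. \<phi> (Y (X n) \<omega>)) \<longlonglongrightarrow> (LINT \<omega>|N. \<phi> (Z \<omega>))"
      by (rule Lim_transform_eventually) (use ev in \<open>auto elim: eventually_mono\<close>)
  qed
qed (rule assms(1))

section \<open>Functionals of an independent sequence\<close>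

text \<open>
  \<open>X\<close> depends on the outcome only through the coordinates in \<open>J\<close>. For countably valued coordinates and
  finite \<open>J\<close> this amounts to measurability with respect to the sigma-algebra that they generate, but it
  is preserved by arbitrary operations without measurability conditions.
\<close>

definition determined :: "('i \<Rightarrow> 'a \<Rightarrow> 'b) \<Rightarrow> 'i set \<Rightarrow> ('a \<Rightarrow> 'c) \<Rightarrow> bool" where
  "determined p J X \<longleftrightarrow> (\<forall>\<omega> \<omega>'. (\<forall>i\<in>J. p i \<omega> = p i \<omega>') \<longrightarrow> X \<omega> = X \<omega>')"

lemma determinedI: "(\<And>\<omega> \<omega>'. (\<And>i. i \<in> J \<Longrightarrow> p i \<omega> = p i \<omega>') \<Longrightarrow> X \<omega> = X \<omega>') \<Longrightarrow> determined p J X"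
  unfolding determined_def by blast

lemma determinedD: "determined p J X \<Longrightarrow> (\<And>i. i \<in> J \<Longrightarrow> p i \<omega> = p i \<omega>') \<Longrightarrow> X \<omega> = X \<omega>'"
  unfolding determined_def by blast

lemma determined_mono: "determined p J X \<Longrightarrow> J \<subseteq> K \<Longrightarrow> determined p K X"
  unfolding determined_def by blast

lemma determined_const: "determined p J (\<lambda>_. c)"
  unfolding determined_def by blast

lemma determined_coord: "i \<in> J \<Longrightarrow> determined p J (\<lambda>\<omega>. F (p i \<omega>))"
  by (simp add: determined_def)

lemma determined_compose: "determined p J X \<Longrightarrow> determined p J (\<lambda>\<omega>. F (X \<omega>))"
  by (rule determinedI, rule arg_cong[where f = F], rule determinedD)

lemma determined_compose2: "determined p J X \<Longrightarrow> determined p J Y \<Longrightarrow> determined p J (\<lambda>\<omega>. F (X \<omega>) (Y \<omega>))"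
  by (rule determinedI, rule arg_cong2[where f = F]) (unfold determined_def, simp_all)

lemma determined_sum: "(\<And>i. i \<in> I \<Longrightarrow> determined p J (X i)) \<Longrightarrow> determined p J (\<lambda>\<omega>. \<Sum>i\<in>I. X i \<omega>)"
  by (rule determinedI, rule sum.cong) (auto intro: determinedD)

text \<open>
  Any two outcomes with the same coordinates have the same value of \<open>X\<close>, so a representative outcome may
  be chosen for every finite list of coordinates.
\<close>

lemma determined_factor:
  fixes p :: "'i \<Rightarrow> 'a \<Rightarrow> 'b::countable"
  assumes X: "determined p J X" and J: "finite J" and sp: "\<And>\<omega>. X \<omega> \<in> space S"
  obtains g where "g \<in> PiM J (\<lambda>_. count_space UNIV) \<rightarrow>\<^sub>M S" "\<And>\<omega>. X \<omega> = g (\<lambda>i\<in>J. p i \<omega>)"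
proof -
  obtain js where js: "set js = J" using finite_list[OF J] by blast
  define G where "G l = X (SOME \<omega>. map (\<lambda>i. p i \<omega>) js = l)" for l
  have "(\<lambda>z. map (\<lambda>i. z i) js) \<in> PiM J (\<lambda>_. count_space UNIV) \<rightarrow>\<^sub>M count_space (UNIV :: 'b list set)"
    by (rule measurable_map_countable) (auto simp: js intro: measurable_component_singleton)
  moreover have "G \<in> count_space UNIV \<rightarrow>\<^sub>M S" by (simp add: G_def sp)
  ultimately have m: "(\<lambda>z. G (map (\<lambda>i. z i) js)) \<in> PiM J (\<lambda>_. count_space UNIV) \<rightarrow>\<^sub>M S"
    by (rule measurable_compose)
  have "X \<omega> = G (map (\<lambda>i. (\<lambda>i\<in>J. p i \<omega>) i) js)" for \<omega>
  proof -
    have eq: "map (\<lambda>i. (\<lambda>i\<in>J. p i \<omega>) i) js = map (\<lambda>i. p i \<omega>) js" using js by (intro map_cong) auto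
    have "map (\<lambda>i. p i (SOME \<omega>'. map (\<lambda>i. p i \<omega>') js = map (\<lambda>i. p i \<omega>) js)) js = map (\<lambda>i. p i \<omega>) js"
      by (rule someI[of "\<lambda>\<omega>'. map (\<lambda>i. p i \<omega>') js = map (\<lambda>i. p i \<omega>) js" \<omega>]) simp
    then have "p i (SOME \<omega>'. map (\<lambda>i. p i \<omega>') js = map (\<lambda>i. p i \<omega>) js) = p i \<omega>" if "i \<in> J" for i
      using that js unfolding map_eq_conv by blast
    then show ?thesis unfolding eq G_def by (intro determinedD[OF X]) simp
  qed
  with m that show ?thesis by blast
qed

locale independent_sequence = prob_space M
  for M :: "'a measure" and p :: "nat \<Rightarrow> 'a \<Rightarrow> 'b::countable" +
  assumes indep_p: "indep_vars (\<lambda>_. count_space UNIV) p UNIV"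
begin

lemma p_measurable [measurable]: "p i \<in> M \<rightarrow>\<^sub>M count_space UNIV"
  using indep_p by (simp add: indep_vars_def)

lemma determined_measurable:
  assumes X: "determined p J X" and J: "finite J" and sp: "\<And>\<omega>. X \<omega> \<in> space S"
  shows "X \<in> M \<rightarrow>\<^sub>M S"
proof -
  obtain g where g: "g \<in> PiM J (\<lambda>_. count_space UNIV) \<rightarrow>\<^sub>M S" "\<And>\<omega>. X \<omega> = g (\<lambda>i\<in>J. p i \<omega>)"
    using determined_factor[OF X J sp] by blast
  have "(\<lambda>\<omega>. \<lambda>i\<in>J. p i \<omega>) \<in> M \<rightarrow>\<^sub>M PiM J (\<lambda>_. count_space UNIV)"
    by (intro measurable_restrict p_measurable)
  from measurable_compose[OF this g(1)] show ?thesis by (simp add: g(2)[abs_def])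
qed

lemma determined_indep_vars:
  assumes X: "\<And>k. k \<in> K \<Longrightarrow> determined p (J k) (X k)" and J: "\<And>k. k \<in> K \<Longrightarrow> finite (J k)"
    and sp: "\<And>k \<omega>. k \<in> K \<Longrightarrow> X k \<omega> \<in> space (S k)" and disj: "disjoint_family_on J K"
  shows "indep_vars S X K"
proof -
  have "\<exists>g. g \<in> PiM (J k) (\<lambda>_. count_space UNIV) \<rightarrow>\<^sub>M S k \<and> (\<forall>\<omega>. X k \<omega> = g (\<lambda>i\<in>J k. p i \<omega>))" if "k \<in> K" for k
    using determined_factor[OF X[OF that] J[OF that] sp[OF that]] by metis
  then obtain g where g: "\<And>k. k \<in> K \<Longrightarrow> g k \<in> PiM (J k) (\<lambda>_. count_space UNIV) \<rightarrow>\<^sub>M S k"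
      "\<And>k \<omega>. k \<in> K \<Longrightarrow> X k \<omega> = g k (\<lambda>i\<in>J k. p i \<omega>)"
    by metis
  have "indep_vars (\<lambda>k. PiM (J k) (\<lambda>_. count_space UNIV)) (\<lambda>k \<omega>. \<lambda>i\<in>J k. p i \<omega>) K"
    by (rule indep_vars_restrict[OF indep_p _ disj]) simp
  then have "indep_vars S (\<lambda>k \<omega>. g k (\<lambda>i\<in>J k. p i \<omega>)) K"
    by (rule indep_vars_compose2) (rule g(1))
  then show ?thesis
    by (rule indep_vars_cong[THEN iffD1, rotated 3]) (auto simp: g(2))
qed

lemma determined_indep_var:
  assumes X: "determined p J X" "finite J" "\<And>\<omega>. X \<omega> \<in> space S"
    and Y: "determined p K Y" "finite K" "\<And>\<omega>. Y \<omega> \<in> space T" and "J \<inter> K = {}"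
  shows "indep_var S X T Y"
proof -
  obtain g where g: "g \<in> PiM J (\<lambda>_. count_space UNIV) \<rightarrow>\<^sub>M S" "\<And>\<omega>. X \<omega> = g (\<lambda>i\<in>J. p i \<omega>)"
    using determined_factor[OF X] by blast
  obtain h where h: "h \<in> PiM K (\<lambda>_. count_space UNIV) \<rightarrow>\<^sub>M T" "\<And>\<omega>. Y \<omega> = h (\<lambda>i\<in>K. p i \<omega>)"
    using determined_factor[OF Y] by blast
  have "indep_var (PiM J (\<lambda>_. count_space UNIV)) (\<lambda>\<omega>. \<lambda>i\<in>J. p i \<omega>) (PiM K (\<lambda>_. count_space UNIV)) (\<lambda>\<omega>. \<lambda>i\<in>K. p i \<omega>)"
    by (rule indep_var_restrict[OF indep_p \<open>J \<inter> K = {}\<close>]) auto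
  from indep_var_compose[OF this g(1) h(1)] show ?thesis
    by (simp add: comp_def g(2)[abs_def, symmetric] h(2)[abs_def, symmetric])
qed

text \<open>
  Fubini's theorem: a fresh coordinate \<open>p e\<close> may be integrated out first, with the other coordinates held
  fixed. All conditional expectations below take this form.
\<close>

lemma expectation_freeze:
  fixes F :: "'a \<Rightarrow> 'b \<Rightarrow> 'e::{banach, second_countable_topology}"
  assumes J: "finite J" "e \<notin> J" and F: "\<And>b. determined p J (\<lambda>\<omega>. F \<omega> b)"
    and int: "integrable M (\<lambda>\<omega>. F \<omega> (p e \<omega>))"
  shows "expectation (\<lambda>\<omega>. F \<omega> (p e \<omega>)) = expectation (\<lambda>\<omega>. expectation (\<lambda>\<omega>'. F \<omega> (p e \<omega>')))"
proof -
  obtain js where js: "set js = J" using finite_list[OF J(1)] by blast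
  define H where "H \<omega> = map (\<lambda>i. p i \<omega>) js" for \<omega>
  \<comment> \<open>The two members of an independent pair share one type, hence the singleton list.\<close>
  define R where "R \<omega> = [p e \<omega>]" for \<omega>
  have mH: "H \<in> M \<rightarrow>\<^sub>M count_space UNIV"
    unfolding H_def by (rule measurable_map_countable) auto
  have mR: "R \<in> M \<rightarrow>\<^sub>M count_space UNIV"
  proof -
    have "R = (\<lambda>\<omega>. map (\<lambda>i. p i \<omega>) [e])" by (simp add: R_def fun_eq_iff)
    then show ?thesis by (simp only:) (rule measurable_map_countable, simp)
  qed
  define G where "G l b = F (SOME \<omega>. H \<omega> = l) b" for l b
  have FG: "F \<omega> b = G (H \<omega>) b" for \<omega> b
  proof -
    have "H (SOME \<omega>'. H \<omega>' = H \<omega>) = H \<omega>" by (rule someI[of "\<lambda>\<omega>'. H \<omega>' = H \<omega>" \<omega>]) simp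
    then have "p i (SOME \<omega>'. H \<omega>' = H \<omega>) = p i \<omega>" if "i \<in> J" for i
      using that js unfolding H_def map_eq_conv by blast
    then show ?thesis unfolding G_def by (intro determinedD[OF F]) simp
  qed
  define K where "K = (\<lambda>(l, r). G l (hd r))"
  have "indep_var (count_space UNIV) H (count_space UNIV) R"
  proof (rule determined_indep_var)
    show "determined p J H" by (rule determinedI) (auto simp: H_def js)
    show "determined p {e} R" by (rule determinedI) (auto simp: R_def)
  qed (use J in auto)
  then have D: "distr M (count_space UNIV) H \<Otimes>\<^sub>M distr M (count_space UNIV) R
      = distr M (count_space UNIV \<Otimes>\<^sub>M count_space UNIV) (\<lambda>\<omega>. (H \<omega>, R \<omega>))"
    unfolding indep_var_distribution_eq by blast
  interpret DH: prob_space "distr M (count_space UNIV) H" by (rule prob_space_distr) (rule mH)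
  interpret Dp: prob_space "distr M (count_space UNIV) R" by (rule prob_space_distr) (rule mR)
  interpret DD: pair_sigma_finite "distr M (count_space UNIV) H" "distr M (count_space UNIV) R" ..
  have mK: "K \<in> borel_measurable (count_space UNIV \<Otimes>\<^sub>M count_space UNIV)"
    by (simp add: pair_measure_countable)
  have m: "(\<lambda>\<omega>. (H \<omega>, R \<omega>)) \<in> M \<rightarrow>\<^sub>M count_space UNIV \<Otimes>\<^sub>M count_space UNIV"
    using mH mR by simp
  have KF: "K (H \<omega>, R \<omega>) = F \<omega> (p e \<omega>)" for \<omega>
    by (simp add: K_def FG R_def)
  have intK: "integrable (distr M (count_space UNIV) H \<Otimes>\<^sub>M distr M (count_space UNIV) R) K"
    unfolding D integrable_distr_eq[OF m mK] KF by (rule int)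
  have "expectation (\<lambda>\<omega>. F \<omega> (p e \<omega>))
    = integral\<^sup>L (distr M (count_space UNIV) H \<Otimes>\<^sub>M distr M (count_space UNIV) R) K"
    unfolding D integral_distr[OF m mK] KF ..
  also have "\<dots> = (\<integral>l. (\<integral>r. K (l, r) \<partial>distr M (count_space UNIV) R) \<partial>distr M (count_space UNIV) H)"
    by (rule DD.integral_fst'[OF intK, symmetric])
  also have "\<dots> = (\<integral>l. expectation (\<lambda>\<omega>'. G l (p e \<omega>')) \<partial>distr M (count_space UNIV) H)"
    by (simp add: K_def integral_distr[OF mR] R_def)
  also have "\<dots> = expectation (\<lambda>\<omega>. expectation (\<lambda>\<omega>'. F \<omega> (p e \<omega>')))"
    by (subst integral_distr[OF mH]) (simp_all add: FG)
  finally show ?thesis .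
qed

lemma expectation_innovation_zero:
  fixes X :: "'a \<Rightarrow> 'e::{banach, second_countable_topology}" and f :: "'b \<Rightarrow> 'b \<Rightarrow> real"
  assumes X: "determined p {..d} X"
    and f: "\<And>q. integrable M (\<lambda>\<omega>. f q (p (Suc d) \<omega>))" "\<And>q. expectation (\<lambda>\<omega>. f q (p (Suc d) \<omega>)) = 0"
    and int: "integrable M (\<lambda>\<omega>. f (p d \<omega>) (p (Suc d) \<omega>) *\<^sub>R X \<omega>)"
  shows "expectation (\<lambda>\<omega>. f (p d \<omega>) (p (Suc d) \<omega>) *\<^sub>R X \<omega>) = 0"
proof -
  have "expectation (\<lambda>\<omega>. f (p d \<omega>) (p (Suc d) \<omega>) *\<^sub>R X \<omega>)
    = expectation (\<lambda>\<omega>. expectation (\<lambda>\<omega>'. f (p d \<omega>) (p (Suc d) \<omega>') *\<^sub>R X \<omega>))"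
  proof (rule expectation_freeze[where J = "{..d}"])
    show "determined p {..d} (\<lambda>\<omega>. f (p d \<omega>) b *\<^sub>R X \<omega>)" for b
      by (rule determined_compose2[where F = "\<lambda>q x. f q b *\<^sub>R x", OF determined_coord[where F = "\<lambda>q. q"] X]) simp
  qed (use int in auto)
  also have "\<dots> = 0" using f by simp
  finally show ?thesis .
qed

lemma expectation_determined_mult:
  fixes X Y :: "'a \<Rightarrow> 'e::{real_normed_field, banach, second_countable_topology}"
  assumes "determined p J X" "determined p K Y" "finite J" "finite K" "J \<inter> K = {}"
    and "integrable M X" "integrable M Y"
  shows "expectation (\<lambda>\<omega>. X \<omega> * Y \<omega>) = expectation X * expectation Y"
  using assms by (intro indep_var_lebesgue_integral determined_indep_var) auto

end

section \<open>Martingales with one-dependent increments\<close>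

lemma abs_power_mult_le_fourth_powers:
  fixes x y :: real
  assumes "i + j \<le> 4" shows "\<bar>x\<bar> ^ i * \<bar>y\<bar> ^ j \<le> 1 + x ^ 4 + y ^ 4"
proof -
  define m where "m = max 1 (max \<bar>x\<bar> \<bar>y\<bar>)"
  have m: "1 \<le> m" "\<bar>x\<bar> \<le> m" "\<bar>y\<bar> \<le> m" by (auto simp: m_def)
  have "\<bar>x\<bar> ^ i * \<bar>y\<bar> ^ j \<le> m ^ i * m ^ j"
    using m by (intro mult_mono power_mono) auto
  also have "\<dots> \<le> m ^ 4" using m assms by (simp flip: power_add add: power_increasing)
  also have "\<dots> \<le> 1 + x ^ 4 + y ^ 4"
    unfolding m_def by (simp add: max_def power_even_abs)
  finally show ?thesis .
qed

lemma (in prob_space) integrable_power_mult: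
  fixes X Y :: "'a \<Rightarrow> real"
  assumes [measurable]: "X \<in> borel_measurable M" "Y \<in> borel_measurable M"
    and "integrable M (\<lambda>\<omega>. X \<omega> ^ 4)" "integrable M (\<lambda>\<omega>. Y \<omega> ^ 4)" and "i + j \<le> 4"
  shows "integrable M (\<lambda>\<omega>. X \<omega> ^ i * Y \<omega> ^ j)" "integrable M (\<lambda>\<omega>. \<bar>X \<omega>\<bar> ^ i * \<bar>Y \<omega>\<bar> ^ j)"
    and "expectation (\<lambda>\<omega>. \<bar>X \<omega>\<bar> ^ i * \<bar>Y \<omega>\<bar> ^ j) \<le> 1 + expectation (\<lambda>\<omega>. X \<omega> ^ 4) + expectation (\<lambda>\<omega>. Y \<omega> ^ 4)"
proof -
  have int: "integrable M (\<lambda>\<omega>. 1 + X \<omega> ^ 4 + Y \<omega> ^ 4)" using assms by simp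
  show "integrable M (\<lambda>\<omega>. X \<omega> ^ i * Y \<omega> ^ j)"
    by (rule Bochner_Integration.integrable_bound[OF int])
      (use abs_power_mult_le_fourth_powers[OF assms(5)] in
        \<open>auto simp: abs_mult power_abs intro!: AE_I2 order_trans[OF _ abs_ge_self]\<close>)
  show *: "integrable M (\<lambda>\<omega>. \<bar>X \<omega>\<bar> ^ i * \<bar>Y \<omega>\<bar> ^ j)"
    by (rule Bochner_Integration.integrable_bound[OF int])
      (use abs_power_mult_le_fourth_powers[OF assms(5)] in
        \<open>auto simp: abs_mult power_abs intro!: AE_I2 order_trans[OF _ abs_ge_self]\<close>)
  have "expectation (\<lambda>\<omega>. \<bar>X \<omega>\<bar> ^ i * \<bar>Y \<omega>\<bar> ^ j) \<le> expectation (\<lambda>\<omega>. 1 + X \<omega> ^ 4 + Y \<omega> ^ 4)"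
    by (rule integral_mono[OF * int]) (rule abs_power_mult_le_fourth_powers[OF assms(5)])
  then show "expectation (\<lambda>\<omega>. \<bar>X \<omega>\<bar> ^ i * \<bar>Y \<omega>\<bar> ^ j) \<le> 1 + expectation (\<lambda>\<omega>. X \<omega> ^ 4) + expectation (\<lambda>\<omega>. Y \<omega> ^ 4)"
    using assms(3,4) by (simp add: prob_space)
qed

lemma fourth_power_sum_le: "(x + y) ^ 4 \<le> 8 * (x ^ 4 + y ^ 4)" for x y :: real
proof -
  have "(x + y)\<^sup>2 \<le> 2 * (x\<^sup>2 + y\<^sup>2)" using sum_squares_ge_zero[of "x - y" 0] by (simp add: power2_eq_square algebra_simps)
  then have "((x + y)\<^sup>2)\<^sup>2 \<le> (2 * (x\<^sup>2 + y\<^sup>2))\<^sup>2" by (intro power_mono) auto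
  also have "\<dots> \<le> 8 * ((x\<^sup>2)\<^sup>2 + (y\<^sup>2)\<^sup>2)"
    using zero_le_power2[of "x\<^sup>2 - y\<^sup>2"] by (simp add: power2_eq_square algebra_simps)
  finally show ?thesis by (simp flip: power_mult)
qed

text \<open>
  Convexity of the fourth power: the graph lies above its tangent at \<open>y\<close>.
\<close>

lemma fourth_power_tangent: "y ^ 4 + 4 * y ^ 3 * d \<le> (y + d) ^ 4" for y d :: real
proof -
  have "(y + d) ^ 4 - (y ^ 4 + 4 * y ^ 3 * d) = d\<^sup>2 * ((2 * y + d)\<^sup>2 + 2 * y\<^sup>2)"
    by (simp add: power2_eq_square power3_eq_cube power4_eq_xxxx algebra_simps)
  also have "\<dots> \<ge> 0" by simp
  finally show ?thesis by simp
qed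

text \<open>
  The cubic and quadratic mixed terms are absorbed by the inequality of arithmetic and geometric means
  with weight \<open>n\<close>. The weight is chosen so that a bound \<open>16 * \<kappa> * n\<^sup>2\<close> for the fourth moment of a sum of \<open>n\<close>
  increments reproduces itself for \<open>n + 1\<close>; the term \<open>d * s ^ 3\<close> is kept because its expectation vanishes.
\<close>

lemma fourth_power_increment:
  fixes s d :: real
  assumes "0 < n"
  shows "(s + d) ^ 4 \<le> (1 + 1 / n) * s ^ 4 + 4 * (d * s ^ 3) + (16 * n + 3) * d ^ 4"
proof -
  have "0 \<le> (s\<^sup>2 - 4 * n * d\<^sup>2)\<^sup>2 / n" using assms by simp
  also have "\<dots> = s ^ 4 / n - 8 * (s\<^sup>2 * d\<^sup>2) + 16 * n * d ^ 4"
    using assms by (simp add: power2_eq_square power4_eq_xxxx field_simps)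
  finally have 1: "8 * (s\<^sup>2 * d\<^sup>2) \<le> s ^ 4 / n + 16 * n * d ^ 4" by simp
  have "0 \<le> 2 * d\<^sup>2 * (s - d)\<^sup>2" by simp
  then have 2: "4 * (s * d ^ 3) \<le> 2 * (s\<^sup>2 * d\<^sup>2) + 2 * d ^ 4"
    by (simp add: power2_eq_square power3_eq_cube power4_eq_xxxx algebra_simps)
  have "(s + d) ^ 4 = s ^ 4 + 4 * (d * s ^ 3) + 6 * (s\<^sup>2 * d\<^sup>2) + 4 * (s * d ^ 3) + d ^ 4"
    by (simp add: power2_eq_square power3_eq_cube power4_eq_xxxx algebra_simps)
  also have "\<dots> \<le> s ^ 4 + 4 * (d * s ^ 3) + 8 * (s\<^sup>2 * d\<^sup>2) + 3 * d ^ 4" using 2 by linarith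
  also have "\<dots> \<le> s ^ 4 + 4 * (d * s ^ 3) + (s ^ 4 / n + 16 * n * d ^ 4) + 3 * d ^ 4" using 1 by linarith
  also have "\<dots> = (1 + 1 / n) * s ^ 4 + 4 * (d * s ^ 3) + (16 * n + 3) * d ^ 4" by (simp add: algebra_simps)
  finally show ?thesis .
qed

text \<open>
  The increments \<open>f (p d) (p (Suc d))\<close> have conditional mean zero given \<open>p 0, ..., p d\<close>, but their
  conditional variance may depend on \<open>p d\<close>; only the unconditional variance is prescribed. The centring
  is required for every value \<open>q\<close> of the previous coordinate, including values of probability zero.
\<close>

locale one_dependent_martingale = independent_sequence M p
  for M :: "'a measure" and p :: "nat \<Rightarrow> 'a \<Rightarrow> 'b::countable" +
  fixes f :: "'b \<Rightarrow> 'b \<Rightarrow> real" and \<kappa> \<sigma> :: real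
  assumes f_integrable: "\<And>d q. integrable M (\<lambda>\<omega>. f q (p (Suc d) \<omega>))"
    and f_centered: "\<And>d q. expectation (\<lambda>\<omega>. f q (p (Suc d) \<omega>)) = 0"
    and f_fourth_integrable: "\<And>d. integrable M (\<lambda>\<omega>. f (p d \<omega>) (p (Suc d) \<omega>) ^ 4)"
    and f_fourth_moment: "\<And>d. expectation (\<lambda>\<omega>. f (p d \<omega>) (p (Suc d) \<omega>) ^ 4) \<le> \<kappa>"
    and f_variance: "\<And>d. expectation (\<lambda>\<omega>. (f (p d \<omega>) (p (Suc d) \<omega>))\<^sup>2) = \<sigma>\<^sup>2"
    and \<sigma>_pos: "0 < \<sigma>"
begin

text \<open>
  At index 0 the truncated predecessor makes \<open>D 0\<close> meaningless; the sums \<open>S\<close> use positive indices only.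
\<close>

definition D :: "nat \<Rightarrow> 'a \<Rightarrow> real" where
  "D d \<omega> = f (p (d - 1) \<omega>) (p d \<omega>)"

definition S :: "nat \<Rightarrow> nat \<Rightarrow> 'a \<Rightarrow> real" where
  "S a b \<omega> = (\<Sum>d\<in>{a<..b}. D d \<omega>)"

lemma S_empty [simp]: "b \<le> a \<Longrightarrow> S a b \<omega> = 0"
  by (simp add: S_def)

lemma S_Suc: "a \<le> b \<Longrightarrow> S a (Suc b) \<omega> = S a b \<omega> + D (Suc b) \<omega>"
proof -
  assume "a \<le> b"
  then have "{a<..Suc b} = insert (Suc b) {a<..b}" by auto
  then show ?thesis by (simp add: S_def)
qed

lemma S_append: "a \<le> b \<Longrightarrow> b \<le> c \<Longrightarrow> S a b \<omega> + S b c \<omega> = S a c \<omega>"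
proof -
  assume "a \<le> b" "b \<le> c"
  then have "{a<..c} = {a<..b} \<union> {b<..c}" "{a<..b} \<inter> {b<..c} = {}" by auto
  then show ?thesis by (simp add: S_def sum.union_disjoint)
qed

lemma D_determined: "determined p {d - 1..d} (D d)"
  by (rule determinedI) (simp add: D_def)

lemma S_determined: "determined p {a..b} (S a b)"
  unfolding S_def[abs_def]
  by (intro determined_sum determined_mono[OF D_determined]) auto

lemma D_measurable [measurable]: "D d \<in> borel_measurable M"
  by (rule determined_measurable[OF D_determined]) auto

lemma S_measurable [measurable]: "S a b \<in> borel_measurable M"
  by (rule determined_measurable[OF S_determined]) auto

lemma D_fourth: "0 < d \<Longrightarrow> integrable M (\<lambda>\<omega>. D d \<omega> ^ 4)" "0 < d \<Longrightarrow> expectation (\<lambda>\<omega>. D d \<omega> ^ 4) \<le> \<kappa>"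
  using f_fourth_integrable[of "d - 1"] f_fourth_moment[of "d - 1"] by (simp_all add: D_def)

lemma \<kappa>_nonneg: "0 \<le> \<kappa>"
  by (rule order_trans[OF _ D_fourth(2)[of 1]]) simp_all

lemma S_fourth_integrable: "integrable M (\<lambda>\<omega>. S a b \<omega> ^ 4)"
proof (induction b)
  case (Suc b)
  show ?case
  proof (cases "a \<le> b")
    case True
    have int: "integrable M (\<lambda>\<omega>. 8 * (S a b \<omega> ^ 4 + D (Suc b) \<omega> ^ 4))" using Suc D_fourth(1) by simp
    show ?thesis
      unfolding S_Suc[OF True]
      by (rule Bochner_Integration.integrable_bound[OF int])
        (use fourth_power_sum_le in \<open>auto intro!: AE_I2 order_trans[OF _ abs_ge_self]\<close>)
  qed simp
qed simp

lemma expectation_D_zero: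
  fixes X :: "'a \<Rightarrow> 'e::{banach, second_countable_topology}"
  assumes "determined p {..b} X" "integrable M (\<lambda>\<omega>. D (Suc b) \<omega> *\<^sub>R X \<omega>)"
  shows "expectation (\<lambda>\<omega>. D (Suc b) \<omega> *\<^sub>R X \<omega>) = 0"
  using expectation_innovation_zero[OF assms(1), of f] f_integrable f_centered assms(2) by (simp add: D_def)

text \<open>
  In the expansion of \<open>(S + D) ^ 4\<close> the term \<open>D * S ^ 3\<close> has mean zero, which is what keeps the growth
  quadratic instead of quartic.
\<close>

lemma S_fourth_moment: "expectation (\<lambda>\<omega>. S a (a + n) \<omega> ^ 4) \<le> 16 * \<kappa> * (real n)\<^sup>2"
proof (induction n)
  case (Suc n)
  let ?S = "S a (a + n)" and ?D = "D (Suc (a + n))"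
  show ?case
  proof (cases "n = 0")
    case True
    then show ?thesis using D_fourth(2)[of "Suc a"] \<kappa>_nonneg by (simp add: S_Suc)
  next
    case False
    have i3: "integrable M (\<lambda>\<omega>. ?D \<omega> * ?S \<omega> ^ 3)"
      using integrable_power_mult(1)[of ?D ?S 1 3] S_fourth_integrable D_fourth(1) by simp
    have "expectation (\<lambda>\<omega>. ?D \<omega> *\<^sub>R ?S \<omega> ^ 3) = 0"
      by (rule expectation_D_zero[OF determined_mono[OF determined_compose[OF S_determined]]]) (use i3 in auto)
    then have z: "expectation (\<lambda>\<omega>. ?D \<omega> * ?S \<omega> ^ 3) = 0" by simp
    have "expectation (\<lambda>\<omega>. S a (a + Suc n) \<omega> ^ 4)
      \<le> expectation (\<lambda>\<omega>. (1 + 1 / real n) * ?S \<omega> ^ 4 + 4 * (?D \<omega> * ?S \<omega> ^ 3) + (16 * real n + 3) * ?D \<omega> ^ 4)"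
    proof (rule integral_mono)
      show "S a (a + Suc n) \<omega> ^ 4 \<le> (1 + 1 / real n) * ?S \<omega> ^ 4 + 4 * (?D \<omega> * ?S \<omega> ^ 3) + (16 * real n + 3) * ?D \<omega> ^ 4" for \<omega>
        using fourth_power_increment[of "real n" "?S \<omega>" "?D \<omega>"] False by (simp add: S_Suc)
    qed (use S_fourth_integrable D_fourth(1) i3 in auto)
    also have "\<dots> = (1 + 1 / real n) * expectation (\<lambda>\<omega>. ?S \<omega> ^ 4) + (16 * real n + 3) * expectation (\<lambda>\<omega>. ?D \<omega> ^ 4)"
      using S_fourth_integrable D_fourth(1) i3 z by simp
    also have "\<dots> \<le> (1 + 1 / real n) * (16 * \<kappa> * (real n)\<^sup>2) + (16 * real n + 3) * \<kappa>"
      using Suc D_fourth(2)[of "Suc (a + n)"] by (intro add_mono mult_left_mono) auto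
    also have "\<dots> = \<kappa> * (16 * (real n)\<^sup>2 + 32 * real n + 3)"
      using False by (simp add: power2_eq_square field_simps)
    also have "\<dots> \<le> \<kappa> * (16 * (real (Suc n))\<^sup>2)"
      using \<kappa>_nonneg by (intro mult_left_mono) (auto simp: power2_eq_square algebra_simps)
    finally show ?thesis by (simp add: mult.commute mult.left_commute)
  qed
qed simp

text \<open>
  Doob's inequality for the submartingale \<open>S ^ 4\<close>, proved by letting the sum run on: once the level \<open>c\<close> has
  been exceeded, the expectation of \<open>S ^ 4\<close> on that event cannot decrease, because the fourth power lies
  above its tangents and the increments are centred.
\<close>

lemma maximal_inequality:
  assumes "0 < c"
  shows "prob {\<omega>\<in>space M. \<exists>j\<in>{a..a + n}. c \<le> \<bar>S a j \<omega>\<bar>} \<le> 16 * \<kappa> * (real n)\<^sup>2 / c ^ 4"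
proof -
  \<comment> \<open>The indicator of the event that the level c has been reached by time b.\<close>
  define u :: "nat \<Rightarrow> 'a \<Rightarrow> real" where "u b \<omega> = (if \<exists>j\<in>{a..b}. c \<le> \<bar>S a j \<omega>\<bar> then 1 else 0)" for b \<omega>
  have udet: "determined p {..b} (u b)" for b
  proof (rule determinedI)
    fix \<omega> \<omega>' assume eq: "\<And>i. i \<in> {..b} \<Longrightarrow> p i \<omega> = p i \<omega>'"
    have "S a j \<omega> = S a j \<omega>'" if "j \<in> {a..b}" for j
      by (rule determinedD[OF S_determined]) (use that eq in auto)
    then show "u b \<omega> = u b \<omega>'" unfolding u_def by auto
  qed
  have [measurable]: "u b \<in> borel_measurable M" for b
    by (rule determined_measurable[OF udet]) auto
  have u01: "u b \<omega> \<in> {0, 1}" for b \<omega> by (auto simp: u_def)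
  have iu: "integrable M (u b)" for b
    by (rule integrable_const_bound[where B = 1]) (use u01 in \<open>auto simp: u_def\<close>)
  have bnd: "integrable M (\<lambda>\<omega>. X \<omega> * u b \<omega>)" if "integrable M X" for X b
    by (rule Bochner_Integration.integrable_bound[OF that])
      (use that in \<open>auto intro!: AE_I2 simp: u_def abs_mult\<close>)
  have *: "expectation (\<lambda>\<omega>. c ^ 4 * u (a + n) \<omega> - S a (a + n) \<omega> ^ 4 * u (a + n) \<omega>) \<le> 0" for n
  proof (induction n)
    case 0
    have "u a \<omega> = 0" for \<omega> using assms by (simp add: u_def)
    then show ?case by simp
  next
    case (Suc n)
    let ?S = "S a (a + n)" and ?D = "D (Suc (a + n))" and ?u = "u (a + n)" and ?u' = "u (Suc (a + n))"
    have i3: "integrable M (\<lambda>\<omega>. ?D \<omega> * ?S \<omega> ^ 3)"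
      using integrable_power_mult(1)[of ?D ?S 1 3] S_fourth_integrable D_fourth(1) by simp
    have i3u: "integrable M (\<lambda>\<omega>. ?D \<omega> * (?S \<omega> ^ 3 * ?u \<omega>))"
      using bnd[OF i3] by (simp add: mult.assoc)
    have "expectation (\<lambda>\<omega>. ?D \<omega> *\<^sub>R (?S \<omega> ^ 3 * ?u \<omega>)) = 0"
    proof (rule expectation_D_zero)
      show "determined p {..a + n} (\<lambda>\<omega>. ?S \<omega> ^ 3 * ?u \<omega>)"
        by (rule determined_compose2[where F = "\<lambda>x y. x ^ 3 * y", OF determined_mono[OF S_determined] udet]) auto
    qed (use i3u in simp)
    then have z: "expectation (\<lambda>\<omega>. ?D \<omega> * (?S \<omega> ^ 3 * ?u \<omega>)) = 0" by simp
    have "expectation (\<lambda>\<omega>. c ^ 4 * ?u' \<omega> - S a (Suc (a + n)) \<omega> ^ 4 * ?u' \<omega>)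
      \<le> expectation (\<lambda>\<omega>. (c ^ 4 * ?u \<omega> - ?S \<omega> ^ 4 * ?u \<omega>) - 4 * (?D \<omega> * (?S \<omega> ^ 3 * ?u \<omega>)))"
    proof (rule integral_mono)
      show "integrable M (\<lambda>\<omega>. c ^ 4 * ?u' \<omega> - S a (Suc (a + n)) \<omega> ^ 4 * ?u' \<omega>)"
        using iu bnd[OF S_fourth_integrable] by simp
      show "integrable M (\<lambda>\<omega>. (c ^ 4 * ?u \<omega> - ?S \<omega> ^ 4 * ?u \<omega>) - 4 * (?D \<omega> * (?S \<omega> ^ 3 * ?u \<omega>)))"
        using iu bnd[OF S_fourth_integrable] i3u by simp
      fix \<omega>
      have set: "{a..Suc (a + n)} = insert (Suc (a + n)) {a..a + n}" by auto
      consider "?u \<omega> = 1" "?u' \<omega> = 1" | "?u \<omega> = 0" "?u' \<omega> = 1" "c \<le> \<bar>S a (Suc (a + n)) \<omega>\<bar>"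
        | "?u \<omega> = 0" "?u' \<omega> = 0"
        unfolding u_def set
        by (cases "\<exists>j\<in>{a..a + n}. c \<le> \<bar>S a j \<omega>\<bar>"; cases "c \<le> \<bar>S a (Suc (a + n)) \<omega>\<bar>") simp_all
      then show "c ^ 4 * ?u' \<omega> - S a (Suc (a + n)) \<omega> ^ 4 * ?u' \<omega>
        \<le> (c ^ 4 * ?u \<omega> - ?S \<omega> ^ 4 * ?u \<omega>) - 4 * (?D \<omega> * (?S \<omega> ^ 3 * ?u \<omega>))"
      proof cases
        case 1
        then show ?thesis
          using fourth_power_tangent[of "?S \<omega>" "?D \<omega>"] by (simp add: S_Suc mult_ac)
      next
        case 2
        have "c ^ 4 \<le> \<bar>S a (Suc (a + n)) \<omega>\<bar> ^ 4" using assms 2(3) by (intro power_mono) auto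
        then show ?thesis using 2 by (simp add: power_even_abs)
      qed simp
    qed
    also have "\<dots> = expectation (\<lambda>\<omega>. c ^ 4 * ?u \<omega> - ?S \<omega> ^ 4 * ?u \<omega>)"
      using iu bnd[OF S_fourth_integrable] i3u z by simp
    also have "\<dots> \<le> 0" by (rule Suc)
    finally show ?case by simp
  qed
  have "expectation (u (a + n)) = prob {\<omega>\<in>space M. \<exists>j\<in>{a..a + n}. c \<le> \<bar>S a j \<omega>\<bar>}"
  proof -
    have "expectation (u (a + n)) = expectation (indicator {\<omega>\<in>space M. \<exists>j\<in>{a..a + n}. c \<le> \<bar>S a j \<omega>\<bar>})"
      by (intro Bochner_Integration.integral_cong refl) (simp add: u_def indicator_def)
    also have "\<dots> = prob {\<omega>\<in>space M. \<exists>j\<in>{a..a + n}. c \<le> \<bar>S a j \<omega>\<bar>}" by simp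
    finally show ?thesis .
  qed
  moreover have "c ^ 4 * expectation (u (a + n)) \<le> expectation (\<lambda>\<omega>. S a (a + n) \<omega> ^ 4 * u (a + n) \<omega>)"
    using *[of n] iu bnd[OF S_fourth_integrable] by simp
  moreover have "expectation (\<lambda>\<omega>. S a (a + n) \<omega> ^ 4 * u (a + n) \<omega>) \<le> expectation (\<lambda>\<omega>. S a (a + n) \<omega> ^ 4)"
    by (intro integral_mono bnd S_fourth_integrable) (auto simp: u_def)
  moreover have "0 < c ^ 4" using assms by simp
  ultimately show ?thesis
    using S_fourth_moment[of a n] by (simp add: pos_le_divide_eq mult.commute)
qed

end

section \<open>Characteristic functions of partial sums\<close>

lemma exp_minus_quadratic_bound:
  assumes "0 \<le> (y::real)" shows "\<bar>1 - y - exp (- y)\<bar> \<le> y\<^sup>2"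
proof -
  have "1 + y \<le> exp y" by (rule exp_ge_add_one_self)
  then have "exp (- y) \<le> 1 / (1 + y)" using assms by (simp add: exp_minus field_simps)
  also have "\<dots> \<le> 1 - y + y\<^sup>2"
  proof -
    have "0 \<le> y ^ 3" using assms by simp
    then have "1 \<le> (1 - y + y\<^sup>2) * (1 + y)" by (simp add: power2_eq_square power3_eq_cube algebra_simps)
    then show ?thesis using assms by (simp add: pos_divide_le_eq)
  qed
  finally have "exp (- y) \<le> 1 - y + y\<^sup>2" .
  moreover have "1 - y \<le> exp (- y)" using exp_ge_add_one_self[of "- y"] by simp
  ultimately show ?thesis by (simp add: abs_le_iff)
qed

context one_dependent_martingale
begin

definition cf :: "real \<Rightarrow> nat \<Rightarrow> nat \<Rightarrow> complex" where
  "cf \<theta> a b = expectation (\<lambda>\<omega>. iexp (\<theta> * S a b \<omega>))"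

text \<open>
  A constant for the third-order error in the recursion of the characteristic functions; it is generous,
  only its independence of \<open>\<theta>\<close>, \<open>a\<close> and \<open>b\<close> matters.
\<close>

definition cf_error :: real where
  "cf_error = 5 * (1 + 2 * \<kappa>) + \<sigma>\<^sup>2 * (1 + 2 * \<kappa>) + \<sigma> ^ 4"

lemma integrable_iexp_S: "integrable M (\<lambda>\<omega>. iexp (\<theta> * S a b \<omega>))"
  by (rule integrable_const_bound[where B = 1]) auto

lemma norm_cf_le_1: "norm (cf \<theta> a b) \<le> 1"
proof -
  have "norm (cf \<theta> a b) \<le> expectation (\<lambda>\<omega>. norm (iexp (\<theta> * S a b \<omega>)))"
    unfolding cf_def by (rule integral_norm_bound)
  then show ?thesis by (simp add: prob_space)
qed

lemma integrable_scaleR_unimodular: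
  fixes E :: "'a \<Rightarrow> complex"
  assumes "integrable M g" and [measurable]: "E \<in> borel_measurable M" and "\<And>\<omega>. norm (E \<omega>) \<le> B"
  shows "integrable M (\<lambda>\<omega>. g \<omega> *\<^sub>R E \<omega>)"
proof (rule Bochner_Integration.integrable_bound[of M "\<lambda>\<omega>. B * g \<omega>"])
  have [measurable]: "g \<in> borel_measurable M" using assms(1) by simp
  show "(\<lambda>\<omega>. g \<omega> *\<^sub>R E \<omega>) \<in> borel_measurable M" by measurable
  have "norm (g \<omega> *\<^sub>R E \<omega>) \<le> norm (B * g \<omega>)" for \<omega>
  proof -
    have "norm (E \<omega>) \<le> \<bar>B\<bar>" using assms(3)[of \<omega>] by linarith
    then show ?thesis using mult_left_mono[of "norm (E \<omega>)" "\<bar>B\<bar>" "\<bar>g \<omega>\<bar>"] by (simp add: abs_mult mult.commute)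
  qed
  then show "AE \<omega> in M. norm (g \<omega> *\<^sub>R E \<omega>) \<le> norm (B * g \<omega>)" by simp
qed (use assms(1) in simp)

lemma norm_iexp_diff: "norm (iexp x - iexp y) \<le> \<bar>x - y\<bar>"
proof -
  have "iexp x - iexp y = iexp y * (iexp (x - y) - 1)"
    by (simp add: algebra_simps flip: exp_add)
  moreover have "norm (iexp (x - y) - 1) \<le> \<bar>x - y\<bar>"
    using iexp_approx1[of "x - y" 0] by simp
  ultimately show ?thesis by (simp add: norm_mult)
qed

text \<open>
  The increment \<open>D (Suc b)\<close> and the sum \<open>S a b\<close> share only the coordinate \<open>p b\<close>. Removing the last summand
  \<open>D b\<close> from the sum makes them independent at the price of an error of order \<open>\<theta>\<close>, both in the expectation
  and in the characteristic function that factors out.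
\<close>

lemma expectation_square_iexp:
  assumes "1 \<le> a" "a \<le> b"
  shows "norm (expectation (\<lambda>\<omega>. (D (Suc b) \<omega>)\<^sup>2 *\<^sub>R iexp (\<theta> * S a b \<omega>)) - \<sigma>\<^sup>2 *\<^sub>R cf \<theta> a b)
    \<le> \<bar>\<theta>\<bar> * (1 + \<sigma>\<^sup>2) * (1 + 2 * \<kappa>)"
proof -
  let ?D = "D (Suc b)" and ?D' = "D b"
  let ?E1 = "\<lambda>\<omega>. iexp (\<theta> * S a b \<omega>)" and ?E0 = "\<lambda>\<omega>. iexp (\<theta> * S a (b - 1) \<omega>)"
  have b: "0 < b" using assms by simp
  have i2: "integrable M (\<lambda>\<omega>. (?D \<omega>)\<^sup>2)"
    using integrable_power_mult(1)[of ?D ?D 2 0] D_fourth(1) by simp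
  have i1: "integrable M (\<lambda>\<omega>. \<bar>?D' \<omega>\<bar>)"
    using integrable_power_mult(2)[of ?D' ?D' 1 0] D_fourth(1)[OF b] by simp
  have i21: "integrable M (\<lambda>\<omega>. (?D \<omega>)\<^sup>2 * \<bar>?D' \<omega>\<bar>)"
    using integrable_power_mult(2)[of ?D ?D' 2 1] D_fourth(1) b by simp
  have e21: "expectation (\<lambda>\<omega>. (?D \<omega>)\<^sup>2 * \<bar>?D' \<omega>\<bar>) \<le> 1 + 2 * \<kappa>"
    using integrable_power_mult(3)[of ?D ?D' 2 1] D_fourth[of "Suc b"] D_fourth[OF b] by simp
  have e1: "expectation (\<lambda>\<omega>. \<bar>?D' \<omega>\<bar>) \<le> 1 + 2 * \<kappa>"
    using integrable_power_mult(3)[of ?D' ?D' 1 0] D_fourth[OF b] by simp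
  have diff: "norm (?E1 \<omega> - ?E0 \<omega>) \<le> \<bar>\<theta>\<bar> * \<bar>?D' \<omega>\<bar>" for \<omega>
  proof -
    have "\<bar>S a b \<omega> - S a (b - 1) \<omega>\<bar> \<le> \<bar>?D' \<omega>\<bar>"
    proof (cases "a = b")
      case False
      then show ?thesis using S_Suc[of a "b - 1" \<omega>] assms by simp
    qed simp
    then have "\<bar>\<theta>\<bar> * \<bar>S a b \<omega> - S a (b - 1) \<omega>\<bar> \<le> \<bar>\<theta>\<bar> * \<bar>?D' \<omega>\<bar>" by (rule mult_left_mono) simp
    then show ?thesis
      using norm_iexp_diff[of "\<theta> * S a b \<omega>" "\<theta> * S a (b - 1) \<omega>"]
      by (simp add: abs_mult flip: right_diff_distrib)
  qed
  have I1: "integrable M (\<lambda>\<omega>. (?D \<omega>)\<^sup>2 *\<^sub>R ?E1 \<omega>)" and I0: "integrable M (\<lambda>\<omega>. (?D \<omega>)\<^sup>2 *\<^sub>R ?E0 \<omega>)"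
    by (rule integrable_scaleR_unimodular[OF i2, where B = 1]; simp)+
  have "expectation (\<lambda>\<omega>. (?D \<omega>)\<^sup>2 *\<^sub>R ?E0 \<omega>) = expectation (\<lambda>\<omega>. complex_of_real ((?D \<omega>)\<^sup>2) * ?E0 \<omega>)"
    by (simp add: scaleR_conv_of_real)
  also have "\<dots> = expectation (\<lambda>\<omega>. complex_of_real ((?D \<omega>)\<^sup>2)) * expectation ?E0"
  proof (rule expectation_determined_mult)
    show "determined p {b..Suc b} (\<lambda>\<omega>. complex_of_real ((?D \<omega>)\<^sup>2))"
      by (rule determined_compose[where F = "\<lambda>x. complex_of_real (x\<^sup>2)", OF determined_mono[OF D_determined]]) auto
    show "determined p {a..b - 1} ?E0"
      by (rule determined_compose[where F = "\<lambda>x. iexp (\<theta> * x)", OF S_determined])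
    show "{b..Suc b} \<inter> {a..b - 1} = {}" using b by auto
  qed (use i2 integrable_iexp_S[of \<theta> a "b - 1"] in \<open>auto simp del: of_real_power\<close>)
  also have "\<dots> = \<sigma>\<^sup>2 *\<^sub>R cf \<theta> a (b - 1)"
    using f_variance[of b] by (simp add: cf_def scaleR_conv_of_real D_def del: of_real_power)
  finally have E0: "expectation (\<lambda>\<omega>. (?D \<omega>)\<^sup>2 *\<^sub>R ?E0 \<omega>) = \<sigma>\<^sup>2 *\<^sub>R cf \<theta> a (b - 1)" .
  have "norm (expectation (\<lambda>\<omega>. (?D \<omega>)\<^sup>2 *\<^sub>R ?E1 \<omega>) - expectation (\<lambda>\<omega>. (?D \<omega>)\<^sup>2 *\<^sub>R ?E0 \<omega>))
    = norm (expectation (\<lambda>\<omega>. (?D \<omega>)\<^sup>2 *\<^sub>R ?E1 \<omega> - (?D \<omega>)\<^sup>2 *\<^sub>R ?E0 \<omega>))"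
    using I1 I0 by simp
  also have "\<dots> \<le> expectation (\<lambda>\<omega>. norm ((?D \<omega>)\<^sup>2 *\<^sub>R ?E1 \<omega> - (?D \<omega>)\<^sup>2 *\<^sub>R ?E0 \<omega>))"
    by (rule integral_norm_bound)
  also have "\<dots> \<le> expectation (\<lambda>\<omega>. \<bar>\<theta>\<bar> * ((?D \<omega>)\<^sup>2 * \<bar>?D' \<omega>\<bar>))"
  proof (rule integral_mono)
    show "norm ((?D \<omega>)\<^sup>2 *\<^sub>R ?E1 \<omega> - (?D \<omega>)\<^sup>2 *\<^sub>R ?E0 \<omega>) \<le> \<bar>\<theta>\<bar> * ((?D \<omega>)\<^sup>2 * \<bar>?D' \<omega>\<bar>)" for \<omega>
      using mult_left_mono[OF diff[of \<omega>], of "(?D \<omega>)\<^sup>2"]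
      by (simp add: mult_ac flip: scaleR_diff_right)
  qed (use I1 I0 i21 in auto)
  also have "\<dots> \<le> \<bar>\<theta>\<bar> * (1 + 2 * \<kappa>)" using e21 by (simp add: mult_left_mono)
  finally have A: "norm (expectation (\<lambda>\<omega>. (?D \<omega>)\<^sup>2 *\<^sub>R ?E1 \<omega>) - \<sigma>\<^sup>2 *\<^sub>R cf \<theta> a (b - 1)) \<le> \<bar>\<theta>\<bar> * (1 + 2 * \<kappa>)"
    unfolding E0 .
  have "norm (cf \<theta> a (b - 1) - cf \<theta> a b) = norm (expectation (\<lambda>\<omega>. ?E1 \<omega> - ?E0 \<omega>))"
    unfolding cf_def using integrable_iexp_S by (subst norm_minus_commute) simp
  also have "\<dots> \<le> expectation (\<lambda>\<omega>. norm (?E1 \<omega> - ?E0 \<omega>))" by (rule integral_norm_bound)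
  also have "\<dots> \<le> expectation (\<lambda>\<omega>. \<bar>\<theta>\<bar> * \<bar>?D' \<omega>\<bar>)"
    by (rule integral_mono) (use i1 diff integrable_iexp_S in auto)
  also have "\<dots> \<le> \<bar>\<theta>\<bar> * (1 + 2 * \<kappa>)" using e1 by (simp add: mult_left_mono)
  finally have "norm (\<sigma>\<^sup>2 *\<^sub>R cf \<theta> a (b - 1) - \<sigma>\<^sup>2 *\<^sub>R cf \<theta> a b) \<le> \<sigma>\<^sup>2 * (\<bar>\<theta>\<bar> * (1 + 2 * \<kappa>))"
    by (simp add: mult_left_mono flip: scaleR_diff_right)
  from norm_triangle_mono[OF A this] show ?thesis by (simp add: algebra_simps)
qed

text \<open>
  In the second-order expansion of the last factor the linear term vanishes by the martingale property,
  and the quadratic one is nearly \<open>- \<theta>\<^sup>2 * \<sigma>\<^sup>2 / 2\<close> times the previous characteristic function.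
\<close>

lemma cf_step:
  assumes "1 \<le> a" "a \<le> b"
  shows "norm (cf \<theta> a (Suc b) - exp (- (\<theta>\<^sup>2 * \<sigma>\<^sup>2 / 2)) *\<^sub>R cf \<theta> a b) \<le> cf_error * (\<bar>\<theta>\<bar> ^ 3 + \<theta> ^ 4)"
proof -
  let ?D = "D (Suc b)" and ?E = "\<lambda>\<omega>. iexp (\<theta> * S a b \<omega>)"
  have i1: "integrable M (\<lambda>\<omega>. ?D \<omega>)" and i2: "integrable M (\<lambda>\<omega>. (?D \<omega>)\<^sup>2)" and i3: "integrable M (\<lambda>\<omega>. \<bar>?D \<omega>\<bar> ^ 3)"
    using integrable_power_mult(1)[of ?D ?D 1 0] integrable_power_mult(1)[of ?D ?D 2 0]
      integrable_power_mult(2)[of ?D ?D 3 0] D_fourth(1) by simp_all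
  have e3: "expectation (\<lambda>\<omega>. \<bar>?D \<omega>\<bar> ^ 3) \<le> 1 + 2 * \<kappa>"
    using integrable_power_mult(3)[of ?D ?D 3 0] D_fourth[of "Suc b"] by simp
  have I1: "integrable M (\<lambda>\<omega>. ?D \<omega> *\<^sub>R ?E \<omega>)" and I2: "integrable M (\<lambda>\<omega>. (?D \<omega>)\<^sup>2 *\<^sub>R ?E \<omega>)"
    by (rule integrable_scaleR_unimodular[OF i1, where B = 1] integrable_scaleR_unimodular[OF i2, where B = 1]; simp)+
  have z: "expectation (\<lambda>\<omega>. ?D \<omega> *\<^sub>R ?E \<omega>) = 0"
    by (rule expectation_D_zero[OF _ I1])
      (rule determined_compose[where F = "\<lambda>x. iexp (\<theta> * x)", OF determined_mono[OF S_determined]], auto)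
  define T where "T \<omega> = ?E \<omega> + (\<i> * \<theta>) * (?D \<omega> *\<^sub>R ?E \<omega>) - (\<theta>\<^sup>2 / 2) *\<^sub>R ((?D \<omega>)\<^sup>2 *\<^sub>R ?E \<omega>)" for \<omega>
  have iT: "integrable M T" unfolding T_def
    by (intro Bochner_Integration.integrable_add Bochner_Integration.integrable_diff integrable_scaleR_right
        integrable_mult_right I1 I2 integrable_iexp_S)
  have eT: "expectation T = cf \<theta> a b - (\<theta>\<^sup>2 / 2) *\<^sub>R expectation (\<lambda>\<omega>. (?D \<omega>)\<^sup>2 *\<^sub>R ?E \<omega>)"
  proof -
    have "expectation (\<lambda>\<omega>. A \<omega> + c * B \<omega> - r *\<^sub>R C \<omega>) = expectation A + c * expectation B - r *\<^sub>R expectation C"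
      if "integrable M A" "integrable M B" "integrable M C" for A B C :: "'a \<Rightarrow> complex" and c r
      using that by simp
    from this[OF integrable_iexp_S[of \<theta> a b] I1 I2, of "\<i> * \<theta>" "\<theta>\<^sup>2 / 2"]
    show ?thesis unfolding T_def cf_def z by (simp only: mult_zero_right add_0_right)
  qed
  have taylor: "norm (iexp (\<theta> * S a (Suc b) \<omega>) - T \<omega>) \<le> \<bar>\<theta>\<bar> ^ 3 * \<bar>?D \<omega>\<bar> ^ 3" for \<omega>
  proof -
    have "iexp (\<theta> * S a (Suc b) \<omega>) = ?E \<omega> * iexp (\<theta> * ?D \<omega>)"
      using assms by (simp add: S_Suc algebra_simps flip: exp_add)
    moreover have "T \<omega> = ?E \<omega> * (\<Sum>k\<le>2. (\<i> * complex_of_real (\<theta> * ?D \<omega>)) ^ k / fact k)"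
      by (simp add: T_def numeral_2_eq_2 scaleR_conv_of_real field_simps power2_eq_square)
    ultimately have "norm (iexp (\<theta> * S a (Suc b) \<omega>) - T \<omega>)
      = norm (iexp (\<theta> * ?D \<omega>) - (\<Sum>k\<le>2. (\<i> * complex_of_real (\<theta> * ?D \<omega>)) ^ k / fact k))"
      by (simp add: norm_mult flip: right_diff_distrib)
    also have "\<dots> \<le> \<bar>\<theta> * ?D \<omega>\<bar> ^ Suc 2 / fact (Suc 2)" by (rule iexp_approx1)
    also have "\<dots> = \<bar>\<theta> * ?D \<omega>\<bar> ^ 3 / 6" by (simp add: fact_numeral)
    also have "\<dots> \<le> \<bar>\<theta> * ?D \<omega>\<bar> ^ 3 / 1" by (rule divide_left_mono) auto
    also have "\<dots> = \<bar>\<theta>\<bar> ^ 3 * \<bar>?D \<omega>\<bar> ^ 3" by (simp add: abs_mult power_mult_distrib)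
    finally show ?thesis .
  qed
  have "norm (cf \<theta> a (Suc b) - expectation T) = norm (expectation (\<lambda>\<omega>. iexp (\<theta> * S a (Suc b) \<omega>) - T \<omega>))"
    unfolding cf_def using integrable_iexp_S iT by simp
  also have "\<dots> \<le> expectation (\<lambda>\<omega>. norm (iexp (\<theta> * S a (Suc b) \<omega>) - T \<omega>))" by (rule integral_norm_bound)
  also have "\<dots> \<le> expectation (\<lambda>\<omega>. \<bar>\<theta>\<bar> ^ 3 * \<bar>?D \<omega>\<bar> ^ 3)"
    by (rule integral_mono) (use i3 iT integrable_iexp_S taylor in auto)
  also have "\<dots> \<le> \<bar>\<theta>\<bar> ^ 3 * (1 + 2 * \<kappa>)" using e3 by (simp add: mult_left_mono)
  finally have A: "norm (cf \<theta> a (Suc b) - expectation T) \<le> \<bar>\<theta>\<bar> ^ 3 * (1 + 2 * \<kappa>)" .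
  have "norm (expectation T - (1 - \<theta>\<^sup>2 * \<sigma>\<^sup>2 / 2) *\<^sub>R cf \<theta> a b)
    = norm ((\<theta>\<^sup>2 / 2) *\<^sub>R (expectation (\<lambda>\<omega>. (?D \<omega>)\<^sup>2 *\<^sub>R ?E \<omega>) - \<sigma>\<^sup>2 *\<^sub>R cf \<theta> a b))"
    unfolding eT by (subst norm_minus_cancel[symmetric]) (simp add: algebra_simps)
  also have "\<dots> \<le> \<theta>\<^sup>2 / 2 * (\<bar>\<theta>\<bar> * (1 + \<sigma>\<^sup>2) * (1 + 2 * \<kappa>))"
    using mult_left_mono[OF expectation_square_iexp[OF assms, of \<theta>], of "\<theta>\<^sup>2 / 2"] by simp
  also have "\<dots> = \<bar>\<theta>\<bar> ^ 3 * ((1 + \<sigma>\<^sup>2) * (1 + 2 * \<kappa>) / 2)"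
    by (simp add: power2_eq_square power3_eq_cube flip: abs_mult)
  finally have B: "norm (expectation T - (1 - \<theta>\<^sup>2 * \<sigma>\<^sup>2 / 2) *\<^sub>R cf \<theta> a b) \<le> \<bar>\<theta>\<bar> ^ 3 * ((1 + \<sigma>\<^sup>2) * (1 + 2 * \<kappa>) / 2)" .
  have "norm ((1 - \<theta>\<^sup>2 * \<sigma>\<^sup>2 / 2) *\<^sub>R cf \<theta> a b - exp (- (\<theta>\<^sup>2 * \<sigma>\<^sup>2 / 2)) *\<^sub>R cf \<theta> a b)
    = \<bar>1 - \<theta>\<^sup>2 * \<sigma>\<^sup>2 / 2 - exp (- (\<theta>\<^sup>2 * \<sigma>\<^sup>2 / 2))\<bar> * norm (cf \<theta> a b)"
    by (simp flip: scaleR_diff_left)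
  also have "\<dots> \<le> (\<theta>\<^sup>2 * \<sigma>\<^sup>2 / 2)\<^sup>2 * 1"
    by (intro mult_mono exp_minus_quadratic_bound norm_cf_le_1) auto
  also have "\<dots> = \<theta> ^ 4 * (\<sigma> ^ 4 / 4)" by (simp add: power_mult_distrib power_divide flip: power_mult)
  finally have C: "norm ((1 - \<theta>\<^sup>2 * \<sigma>\<^sup>2 / 2) *\<^sub>R cf \<theta> a b - exp (- (\<theta>\<^sup>2 * \<sigma>\<^sup>2 / 2)) *\<^sub>R cf \<theta> a b) \<le> \<theta> ^ 4 * (\<sigma> ^ 4 / 4)" .
  have "norm (cf \<theta> a (Suc b) - exp (- (\<theta>\<^sup>2 * \<sigma>\<^sup>2 / 2)) *\<^sub>R cf \<theta> a b)
    \<le> \<bar>\<theta>\<bar> ^ 3 * (1 + 2 * \<kappa>) + \<bar>\<theta>\<bar> ^ 3 * ((1 + \<sigma>\<^sup>2) * (1 + 2 * \<kappa>) / 2) + \<theta> ^ 4 * (\<sigma> ^ 4 / 4)"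
    using norm_triangle_mono[OF norm_triangle_mono[OF A B] C] by simp
  also have "\<dots> \<le> \<bar>\<theta>\<bar> ^ 3 * cf_error + \<theta> ^ 4 * cf_error"
  proof -
    define y where "y = 1 + 2 * \<kappa>"
    define z where "z = \<sigma>\<^sup>2 * y"
    define w where "w = \<sigma> ^ 4"
    have "0 \<le> y" "0 \<le> z" "0 \<le> w" using \<kappa>_nonneg by (simp_all add: y_def z_def w_def)
    then have "y + (y + z) / 2 \<le> 5 * y + z + w" "w / 4 \<le> 5 * y + z + w" by simp_all
    then have "(1 + 2 * \<kappa>) + (1 + \<sigma>\<^sup>2) * (1 + 2 * \<kappa>) / 2 \<le> cf_error" "\<sigma> ^ 4 / 4 \<le> cf_error"
      unfolding cf_error_def distrib_right[of 1 "\<sigma>\<^sup>2" "1 + 2 * \<kappa>"] y_def z_def w_def by simp_all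
    then have "\<bar>\<theta>\<bar> ^ 3 * ((1 + 2 * \<kappa>) + (1 + \<sigma>\<^sup>2) * (1 + 2 * \<kappa>) / 2) \<le> \<bar>\<theta>\<bar> ^ 3 * cf_error"
      "\<theta> ^ 4 * (\<sigma> ^ 4 / 4) \<le> \<theta> ^ 4 * cf_error"
      by - (rule mult_left_mono, assumption, simp)+
    then show ?thesis by (simp add: distrib_left)
  qed
  finally show ?thesis by (simp add: algebra_simps)
qed

lemma cf_bound:
  assumes "1 \<le> a"
  shows "norm (cf \<theta> a (a + n) - complex_of_real (exp (- (real n * (\<theta>\<^sup>2 * \<sigma>\<^sup>2 / 2))))) \<le> real n * (cf_error * (\<bar>\<theta>\<bar> ^ 3 + \<theta> ^ 4))"
proof (induction n)
  case 0
  then show ?case by (simp add: cf_def prob_space)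
next
  case (Suc n)
  let ?r = "exp (- (\<theta>\<^sup>2 * \<sigma>\<^sup>2 / 2))" and ?c = "cf \<theta> a (a + n)"
  have "norm (?r *\<^sub>R ?c - ?r *\<^sub>R complex_of_real (exp (- (real n * (\<theta>\<^sup>2 * \<sigma>\<^sup>2 / 2)))))
    \<le> 1 * (real n * (cf_error * (\<bar>\<theta>\<bar> ^ 3 + \<theta> ^ 4)))"
    unfolding scaleR_diff_right[symmetric] norm_scaleR by (rule mult_mono) (use Suc in auto)
  from norm_triangle_mono[OF cf_step[OF assms, of "a + n" \<theta>] this]
  have "norm (cf \<theta> a (a + Suc n) - ?r *\<^sub>R complex_of_real (exp (- (real n * (\<theta>\<^sup>2 * \<sigma>\<^sup>2 / 2)))))
    \<le> real (Suc n) * (cf_error * (\<bar>\<theta>\<bar> ^ 3 + \<theta> ^ 4))"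
    by (simp add: algebra_simps)
  also have "?r *\<^sub>R complex_of_real (exp (- (real n * (\<theta>\<^sup>2 * \<sigma>\<^sup>2 / 2)))) = complex_of_real (exp (- (real (Suc n) * (\<theta>\<^sup>2 * \<sigma>\<^sup>2 / 2))))"
  proof -
    have "exp (- (real (Suc n) * (\<theta>\<^sup>2 * \<sigma>\<^sup>2 / 2))) = ?r * exp (- (real n * (\<theta>\<^sup>2 * \<sigma>\<^sup>2 / 2)))"
      unfolding exp_add[symmetric] by (simp add: algebra_simps)
    then show ?thesis by (simp only: scaleR_conv_of_real of_real_mult)
  qed
  finally show ?case .
qed

end

section \<open>The invariance principle\<close>

lemma char_normal_distribution:
  assumes "0 < s"
  shows "char (density lborel (normal_density 0 s)) t = complex_of_real (exp (- (t\<^sup>2 * s\<^sup>2 / 2)))"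
proof -
  interpret prob_space std_normal_distribution
    using real_dist_normal_dist by (simp add: real_distribution_def)
  have "distributed std_normal_distribution lborel (\<lambda>x. x) (normal_density 0 1)"
    unfolding distributed_def by (simp add: distr_id2)
  from normal_density_affine[OF this, of s 0] assms
  have "distr std_normal_distribution lborel (\<lambda>x. s * x) = density lborel (normal_density 0 s)"
    by (simp add: distributed_def)
  then have "char (density lborel (normal_density 0 s)) t = (\<integral>x. iexp (t * x) \<partial>distr std_normal_distribution lborel (\<lambda>x. s * x))"
    by (simp add: char_def)
  also have "\<dots> = (\<integral>x. iexp (t * (s * x)) \<partial>std_normal_distribution)"
    by (rule integral_distr) auto
  also have "\<dots> = char std_normal_distribution (t * s)"
    by (simp add: char_def mult.assoc)
  finally show ?thesis by (simp add: char_std_normal_distribution power_mult_distrib)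
qed

text \<open>
  The index of the last column completed at time \<open>k/m\<close>.
\<close>

definition grid_index :: "real \<Rightarrow> nat \<Rightarrow> nat \<Rightarrow> nat" where
  "grid_index \<nu> m k = nat \<lfloor>\<nu> * real k / real m\<rfloor>"

lemma grid_index_bounds:
  assumes "0 \<le> \<nu>"
  shows "real (grid_index \<nu> m k) \<le> \<nu> * real k / real m" "\<nu> * real k / real m < real (grid_index \<nu> m k) + 1"
proof -
  have "0 \<le> \<nu> * real k / real m" using assms by simp
  then show "real (grid_index \<nu> m k) \<le> \<nu> * real k / real m" "\<nu> * real k / real m < real (grid_index \<nu> m k) + 1"
    unfolding grid_index_def by linarith+
qed

lemma grid_index_mono:
  assumes "0 \<le> \<nu>" "k \<le> l" shows "grid_index \<nu> m k \<le> grid_index \<nu> m l"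
  unfolding grid_index_def using assms by (intro nat_mono floor_mono divide_right_mono mult_left_mono) auto

lemma grid_index_diff:
  assumes "0 \<le> \<nu>" "0 < m"
  shows "real (grid_index \<nu> m (Suc k) - grid_index \<nu> m k) \<le> \<nu> / real m + 1"
    and "\<bar>real (grid_index \<nu> m (Suc k) - Suc (grid_index \<nu> m k)) - \<nu> / real m\<bar> \<le> 2"
proof -
  have e: "\<nu> * real (Suc k) / real m = \<nu> * real k / real m + \<nu> / real m"
    by (simp add: distrib_left add_divide_distrib)
  have le: "grid_index \<nu> m k \<le> grid_index \<nu> m (Suc k)" by (rule grid_index_mono) (use assms in auto)
  note b = grid_index_bounds[OF assms(1), where m = m and k = k]
    grid_index_bounds[OF assms(1), where m = m and k = "Suc k", unfolded e]
  show "real (grid_index \<nu> m (Suc k) - grid_index \<nu> m k) \<le> \<nu> / real m + 1"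
    using b le by (simp add: of_nat_diff)
  have "0 \<le> \<nu> / real m" using assms by simp
  then show "\<bar>real (grid_index \<nu> m (Suc k) - Suc (grid_index \<nu> m k)) - \<nu> / real m\<bar> \<le> 2"
    using b by (cases "Suc (grid_index \<nu> m k) \<le> grid_index \<nu> m (Suc k)") (auto simp: of_nat_diff)
qed

context one_dependent_martingale
begin

text \<open>
  The first increment after \<open>grid_index \<nu> m k\<close> is left out, since it is the one that depends on the last
  coordinate of the previous cell. Different blocks then involve disjoint sets of coordinates.
\<close>

definition block :: "real \<Rightarrow> nat \<Rightarrow> nat \<Rightarrow> 'a \<Rightarrow> real" where
  "block \<nu> m k \<omega> = S (Suc (grid_index \<nu> m k)) (grid_index \<nu> m (Suc k)) \<omega> / (\<sigma> * sqrt \<nu>)"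

lemma block_measurable [measurable]: "block \<nu> m k \<in> borel_measurable M"
  unfolding block_def[abs_def] by measurable

lemma indep_vars_block:
  assumes "0 \<le> \<nu>" shows "indep_vars (\<lambda>_. borel) (block \<nu> m) {..<m}"
proof (rule determined_indep_vars)
  show "determined p {Suc (grid_index \<nu> m k)..grid_index \<nu> m (Suc k)} (block \<nu> m k)" for k
    unfolding block_def[abs_def]
    by (rule determined_compose[where F = "\<lambda>x. x / (\<sigma> * sqrt \<nu>)", OF S_determined])
  show "disjoint_family_on (\<lambda>k. {Suc (grid_index \<nu> m k)..grid_index \<nu> m (Suc k)}) {..<m}"
  proof -
    have "{Suc (grid_index \<nu> m k)..grid_index \<nu> m (Suc k)} \<inter> {Suc (grid_index \<nu> m l)..grid_index \<nu> m (Suc l)} = {}"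
      if "k < l" for k l
      using grid_index_mono[OF assms, of "Suc k" l m] that by auto
    then show ?thesis unfolding disjoint_family_on_def by (metis Int_commute linorder_neqE_nat)
  qed
qed auto

text \<open>
  A block has \<open>\<nu>/m + O(1)\<close> increments, and \<open>\<theta>\<close> is of order \<open>1 / sqrt \<nu>\<close>: the exponent tends to \<open>- t\<^sup>2 / (2 * m)\<close>,
  and the error \<open>L * (\<bar>\<theta>\<bar> ^ 3 + \<theta> ^ 4)\<close> of \<open>cf_bound\<close> tends to 0.
\<close>

lemma block_weak_conv:
  assumes \<nu>: "filterlim \<nu> at_top sequentially" and pos: "\<And>n. 0 < \<nu> n" and m: "0 < m"
  shows "weak_conv_m (\<lambda>n. distr M borel (block (\<nu> n) m k)) (density lborel (normal_density 0 (sqrt (1 / real m))))"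
proof (rule levy_continuity)
  show "real_distribution (distr M borel (block (\<nu> n) m k))" for n
    by (rule real_distribution_distr) simp
  show "real_distribution (density lborel (normal_density 0 (sqrt (1 / real m))))"
    by (rule real_distribution_normal) (use m in simp)
  fix t
  define L where "L n = grid_index (\<nu> n) m (Suc k) - Suc (grid_index (\<nu> n) m k)" for n
  define \<theta> where "\<theta> n = t / (\<sigma> * sqrt (\<nu> n))" for n
  have inv: "(\<lambda>n. 1 / \<nu> n) \<longlonglongrightarrow> 0"
    using \<nu> by (intro tendsto_divide_0[OF tendsto_const] filterlim_at_top_imp_at_infinity)
  have L: "(\<lambda>n. real (L n) / \<nu> n) \<longlonglongrightarrow> 1 / real m"
  proof (rule LIM_zero_cancel, rule Lim_null_comparison[where g = "\<lambda>n. 2 * (1 / \<nu> n)"])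
    show "\<forall>\<^sub>F n in sequentially. norm (real (L n) / \<nu> n - 1 / real m) \<le> 2 * (1 / \<nu> n)"
    proof (intro always_eventually allI)
      fix n
      have "real (L n) / \<nu> n - 1 / real m = (real (L n) - \<nu> n / real m) / \<nu> n"
        using pos[of n] m by (simp add: field_simps)
      then have "norm (real (L n) / \<nu> n - 1 / real m) = \<bar>real (L n) - \<nu> n / real m\<bar> / \<nu> n"
        using pos[of n] by (simp add: abs_divide)
      also have "\<dots> \<le> 2 / \<nu> n"
        using grid_index_diff(2)[of "\<nu> n" m k] pos[of n] m by (intro divide_right_mono) (auto simp: L_def)
      finally show "norm (real (L n) / \<nu> n - 1 / real m) \<le> 2 * (1 / \<nu> n)" by simp
    qed
    show "(\<lambda>n. 2 * (1 / \<nu> n)) \<longlonglongrightarrow> 0" using tendsto_mult_left[OF inv, of 2] by simp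
  qed
  have sq: "(sqrt (\<nu> n))\<^sup>2 = \<nu> n" for n using pos[of n] by simp
  have "char (distr M borel (block (\<nu> n) m k)) t = cf (\<theta> n) (Suc (grid_index (\<nu> n) m k)) (Suc (grid_index (\<nu> n) m k) + L n)" for n
  proof -
    have "S (Suc (grid_index (\<nu> n) m k)) (grid_index (\<nu> n) m (Suc k)) \<omega>
      = S (Suc (grid_index (\<nu> n) m k)) (Suc (grid_index (\<nu> n) m k) + L n) \<omega>" for \<omega>
      by (cases "Suc (grid_index (\<nu> n) m k) \<le> grid_index (\<nu> n) m (Suc k)") (auto simp: L_def)
    then show ?thesis
      unfolding char_def cf_def by (subst integral_distr) (auto simp: block_def \<theta>_def)
  qed
  moreover have "(\<lambda>n. cf (\<theta> n) (Suc (grid_index (\<nu> n) m k)) (Suc (grid_index (\<nu> n) m k) + L n)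
      - complex_of_real (exp (- (real (L n) * ((\<theta> n)\<^sup>2 * \<sigma>\<^sup>2 / 2))))) \<longlonglongrightarrow> 0"
  proof (rule Lim_null_comparison[OF always_eventually, OF allI, OF cf_bound])
    have eq: "real (L n) * (cf_error * (\<bar>\<theta> n\<bar> ^ 3 + \<theta> n ^ 4)) =
      cf_error * (real (L n) / \<nu> n) * ((\<bar>t\<bar> / \<sigma>) ^ 3 * sqrt (1 / \<nu> n) + (t / \<sigma>) ^ 4 * (1 / \<nu> n))" for n
    proof -
      have s: "sqrt (\<nu> n) > 0" using pos by simp
      have t: "\<bar>\<theta> n\<bar> = \<bar>t\<bar> / \<sigma> / sqrt (\<nu> n)" "\<theta> n = t / \<sigma> / sqrt (\<nu> n)"
        using \<sigma>_pos s by (simp_all add: \<theta>_def abs_mult)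
      have "\<bar>\<theta> n\<bar> ^ 3 = (\<bar>t\<bar> / \<sigma>) ^ 3 * sqrt (1 / \<nu> n) / \<nu> n"
        unfolding t(1) power_divide[of "\<bar>t\<bar> / \<sigma>"] using sq[of n]
        by (simp add: power3_eq_cube power2_eq_square real_sqrt_divide field_simps)
      moreover have "\<theta> n ^ 4 = (t / \<sigma>) ^ 4 * (1 / \<nu> n) / \<nu> n"
      proof -
        have "sqrt (\<nu> n) ^ 4 = ((sqrt (\<nu> n))\<^sup>2)\<^sup>2" by (simp flip: power_mult)
        then show ?thesis unfolding t(2) power_divide[of "t / \<sigma>"] by (simp add: sq power2_eq_square)
      qed
      ultimately show ?thesis by (simp add: algebra_simps add_divide_distrib)
    qed
    have "(\<lambda>n. cf_error * (real (L n) / \<nu> n) * ((\<bar>t\<bar> / \<sigma>) ^ 3 * sqrt (1 / \<nu> n) + (t / \<sigma>) ^ 4 * (1 / \<nu> n)))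
      \<longlonglongrightarrow> cf_error * (1 / real m) * ((\<bar>t\<bar> / \<sigma>) ^ 3 * sqrt 0 + (t / \<sigma>) ^ 4 * 0)"
      by (intro tendsto_intros L inv)
    then show "(\<lambda>n. real (L n) * (cf_error * (\<bar>\<theta> n\<bar> ^ 3 + \<theta> n ^ 4))) \<longlonglongrightarrow> 0" unfolding eq by simp
  qed simp
  moreover have "(\<lambda>n. complex_of_real (exp (- (real (L n) * ((\<theta> n)\<^sup>2 * \<sigma>\<^sup>2 / 2)))))
    \<longlonglongrightarrow> complex_of_real (exp (- (1 / real m * (t\<^sup>2 / 2))))"
  proof -
    have eq: "real (L n) * ((\<theta> n)\<^sup>2 * \<sigma>\<^sup>2 / 2) = real (L n) / \<nu> n * (t\<^sup>2 / 2)" for n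
      using \<sigma>_pos pos[of n] by (simp add: \<theta>_def power_mult_distrib power_divide)
    show ?thesis unfolding eq by (intro tendsto_intros L)
  qed
  ultimately have "(\<lambda>n. char (distr M borel (block (\<nu> n) m k)) t) \<longlonglongrightarrow> complex_of_real (exp (- (1 / real m * (t\<^sup>2 / 2))))"
    using Lim_transform by force
  then show "(\<lambda>n. char (distr M borel (block (\<nu> n) m k)) t) \<longlonglongrightarrow> char (density lborel (normal_density 0 (sqrt (1 / real m)))) t"
    using m by (subst char_normal_distribution) (simp_all add: mult.commute)
qed

end

lemma (in prob_space) fourth_moment_Markov:
  assumes "integrable M (\<lambda>\<omega>. X \<omega> ^ 4)" and "expectation (\<lambda>\<omega>. X \<omega> ^ 4) \<le> K" "0 < (c::real)"
    and [measurable]: "X \<in> borel_measurable M"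
  shows "prob {\<omega>\<in>space M. c \<le> \<bar>X \<omega>\<bar>} \<le> K / c ^ 4"
proof -
  have "prob {\<omega>\<in>space M. c \<le> \<bar>X \<omega>\<bar>} \<le> prob {\<omega>\<in>space M. X \<omega> ^ 4 \<ge> c ^ 4}"
  proof (rule finite_measure_mono)
    show "{\<omega>\<in>space M. c \<le> \<bar>X \<omega>\<bar>} \<subseteq> {\<omega>\<in>space M. X \<omega> ^ 4 \<ge> c ^ 4}"
    proof safe
      fix \<omega> assume "c \<le> \<bar>X \<omega>\<bar>"
      then have "c ^ 4 \<le> \<bar>X \<omega>\<bar> ^ 4" using assms(3) by (intro power_mono) auto
      then show "c ^ 4 \<le> X \<omega> ^ 4" by (simp add: power_even_abs)
    qed
  qed measurable
  also have "\<dots> \<le> expectation (\<lambda>\<omega>. X \<omega> ^ 4) / c ^ 4"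
    using assms by (intro integral_Markov_inequality_measure[where A = "space M"]) auto
  also have "\<dots> \<le> K / c ^ 4" using assms by (intro divide_right_mono) auto
  finally show ?thesis .
qed

lemma (in prob_space) prob_UN_le_card:
  assumes "finite I" "\<And>i. i \<in> I \<Longrightarrow> A i \<in> events" "\<And>i. i \<in> I \<Longrightarrow> prob (A i) \<le> c"
  shows "prob (\<Union>i\<in>I. A i) \<le> real (card I) * c"
proof -
  have "prob (\<Union>i\<in>I. A i) \<le> (\<Sum>i\<in>I. prob (A i))"
    using assms by (intro finite_measure_subadditive_finite) auto
  also have "\<dots> \<le> real (card I) * c" using assms(3) by (rule sum_bounded_above)
  finally show ?thesis .
qed

context one_dependent_martingale
begin

text \<open>
  Two perturbations of the martingale are admitted: a remainder \<open>R\<close> with bounded fourth moments, and a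
  multiple \<open>c\<close> of the difference between \<open>\<nu> * t\<close> and its integer part, which arises when the centring is
  continuous in \<open>t\<close>.
\<close>

definition rescaled :: "(nat \<Rightarrow> 'a \<Rightarrow> real) \<Rightarrow> real \<Rightarrow> real \<Rightarrow> real \<Rightarrow> 'a \<Rightarrow> real" where
  "rescaled R c \<nu> t \<omega> = (S 0 (nat \<lfloor>\<nu> * t\<rfloor>) \<omega> + R (nat \<lfloor>\<nu> * t\<rfloor>) \<omega> + c * (real (nat \<lfloor>\<nu> * t\<rfloor>) - \<nu> * t)) / (\<sigma> * sqrt \<nu>)"

text \<open>
  Off this event a rescaled path is uniformly close to the step path of its blocks. Within a cell the sum
  must not move by \<open>h\<close>; at most \<open>m\<close> increments are left out, so each of them is compared with \<open>h / m\<close>;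
  and the remainder must stay below \<open>h\<close>. The cell number \<open>m\<close> is included for the time \<open>t = 1\<close>. The
  upper end of the range of \<open>j\<close> is the next grid index, in the form used by \<open>maximal_inequality\<close>.
\<close>

definition exceptional :: "(nat \<Rightarrow> 'a \<Rightarrow> real) \<Rightarrow> real \<Rightarrow> nat \<Rightarrow> real \<Rightarrow> 'a set" where
  "exceptional R \<nu> m h =
    (\<Union>k\<in>{..m}. {\<omega>\<in>space M. \<exists>j\<in>{grid_index \<nu> m k..grid_index \<nu> m k + (grid_index \<nu> m (Suc k) - grid_index \<nu> m k)}. h \<le> \<bar>S (grid_index \<nu> m k) j \<omega>\<bar>}) \<union>
    ((\<Union>d\<in>{1..nat \<lfloor>\<nu>\<rfloor>}. {\<omega>\<in>space M. h / real m \<le> \<bar>D d \<omega>\<bar>}) \<union>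
    (\<Union>j\<in>{..nat \<lfloor>\<nu>\<rfloor>}. {\<omega>\<in>space M. h \<le> \<bar>R j \<omega>\<bar>}))"

context
  fixes R :: "nat \<Rightarrow> 'a \<Rightarrow> real" and \<kappa>R c :: real
  assumes R_determined: "\<And>j. determined p {..j} (R j)"
    and R_fourth_integrable: "\<And>j. integrable M (\<lambda>\<omega>. R j \<omega> ^ 4)"
    and R_fourth_moment: "\<And>j. expectation (\<lambda>\<omega>. R j \<omega> ^ 4) \<le> \<kappa>R"
begin

lemma R_measurable [measurable]: "R j \<in> borel_measurable M"
  by (rule determined_measurable[OF R_determined]) auto

lemma rescaled_measurable:
  assumes "0 < \<nu>"
  shows "sample_path (rescaled R c \<nu>) \<in> M \<rightarrow>\<^sub>M borel_sigma skorokhod_topology"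
proof (rule determined_measurable)
  show "determined p {..nat \<lfloor>\<nu>\<rfloor>} (sample_path (rescaled R c \<nu>))"
  proof (rule determinedI)
    fix \<omega> \<omega>' assume eq: "\<And>i. i \<in> {..nat \<lfloor>\<nu>\<rfloor>} \<Longrightarrow> p i \<omega> = p i \<omega>'"
    have "rescaled R c \<nu> t \<omega> = rescaled R c \<nu> t \<omega>'" if "t \<in> {0..1}" for t
    proof -
      have "\<nu> * t \<le> \<nu>" using that assms by (simp add: mult_left_le)
      then have j: "nat \<lfloor>\<nu> * t\<rfloor> \<le> nat \<lfloor>\<nu>\<rfloor>" by (intro nat_mono floor_mono)
      have "S 0 (nat \<lfloor>\<nu> * t\<rfloor>) \<omega> = S 0 (nat \<lfloor>\<nu> * t\<rfloor>) \<omega>'"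
        by (rule determinedD[OF S_determined]) (use eq j in auto)
      moreover have "R (nat \<lfloor>\<nu> * t\<rfloor>) \<omega> = R (nat \<lfloor>\<nu> * t\<rfloor>) \<omega>'"
        by (rule determinedD[OF R_determined]) (use eq j in auto)
      ultimately show ?thesis by (simp add: rescaled_def)
    qed
    then show "sample_path (rescaled R c \<nu>) \<omega> = sample_path (rescaled R c \<nu>) \<omega>'"
      unfolding sample_path_def by (intro restrict_ext) auto
  qed
  fix \<omega>
  let ?s = "\<sigma> * sqrt \<nu>"
  have "sample_path (rescaled R c \<nu>) \<omega> = (\<lambda>t\<in>{0..1}. (S 0 (nat \<lfloor>\<nu> * t\<rfloor>) \<omega> + R (nat \<lfloor>\<nu> * t\<rfloor>) \<omega> + c * real (nat \<lfloor>\<nu> * t\<rfloor>)) / ?s + (- (c * \<nu> / ?s)) * t)"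
    unfolding sample_path_def rescaled_def
    by (intro restrict_ext) (simp add: right_diff_distrib add_divide_distrib diff_divide_distrib)
  then show "sample_path (rescaled R c \<nu>) \<omega> \<in> space (borel_sigma skorokhod_topology)"
    using cadlag_step[OF assms, of "\<lambda>j. (S 0 j \<omega> + R j \<omega> + c * real j) / ?s" "- (c * \<nu> / ?s)"] by simp
qed simp

lemma exceptional_sets: "exceptional R \<nu> m h \<in> events"
  unfolding exceptional_def by (intro sets.Un sets.finite_UN) measurable

lemma prob_exceptional:
  assumes \<nu>: "0 < \<nu>" and m: "0 < m" and h: "0 < h"
  shows "prob (exceptional R \<nu> m h) \<le>
    (real (m + 1) * (16 * \<kappa> * (\<nu> / real m + 1)\<^sup>2) + \<nu> * (\<kappa> * real m ^ 4) + (\<nu> + 1) * \<kappa>R) / h ^ 4"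
proof -
  let ?A1 = "\<lambda>k. {\<omega>\<in>space M. \<exists>j\<in>{grid_index \<nu> m k..grid_index \<nu> m k + (grid_index \<nu> m (Suc k) - grid_index \<nu> m k)}. h \<le> \<bar>S (grid_index \<nu> m k) j \<omega>\<bar>}"
  let ?A2 = "\<lambda>d. {\<omega>\<in>space M. h / real m \<le> \<bar>D d \<omega>\<bar>}"
  let ?A3 = "\<lambda>j. {\<omega>\<in>space M. h \<le> \<bar>R j \<omega>\<bar>}"
  have kR: "0 \<le> \<kappa>R" by (rule order_trans[OF _ R_fourth_moment[of 0]]) simp
  have J: "real (nat \<lfloor>\<nu>\<rfloor>) \<le> \<nu>" using \<nu> by simp
  have "prob (\<Union>k\<in>{..m}. ?A1 k) \<le> real (card {..m}) * (16 * \<kappa> * (\<nu> / real m + 1)\<^sup>2 / h ^ 4)"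
  proof (rule prob_UN_le_card)
    fix k
    have "prob (?A1 k) \<le> 16 * \<kappa> * (real (grid_index \<nu> m (Suc k) - grid_index \<nu> m k))\<^sup>2 / h ^ 4"
      by (rule maximal_inequality[OF h])
    also have "\<dots> \<le> 16 * \<kappa> * (\<nu> / real m + 1)\<^sup>2 / h ^ 4"
      using grid_index_diff(1)[of \<nu> m k] \<nu> m h \<kappa>_nonneg
      by (intro divide_right_mono mult_left_mono power_mono) auto
    finally show "prob (?A1 k) \<le> 16 * \<kappa> * (\<nu> / real m + 1)\<^sup>2 / h ^ 4" .
    show "?A1 k \<in> events" by measurable
  qed simp
  moreover have "prob (\<Union>d\<in>{1..nat \<lfloor>\<nu>\<rfloor>}. ?A2 d) \<le> real (card {1..nat \<lfloor>\<nu>\<rfloor>}) * (\<kappa> / (h / real m) ^ 4)"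
  proof (rule prob_UN_le_card)
    show "prob (?A2 d) \<le> \<kappa> / (h / real m) ^ 4" if "d \<in> {1..nat \<lfloor>\<nu>\<rfloor>}" for d
      using that h m by (intro fourth_moment_Markov D_fourth) auto
    show "?A2 d \<in> events" for d by measurable
  qed simp
  moreover have "real (card {1..nat \<lfloor>\<nu>\<rfloor>}) * (\<kappa> / (h / real m) ^ 4) \<le> \<nu> * (\<kappa> * real m ^ 4 / h ^ 4)"
    using J m h \<kappa>_nonneg by (intro mult_mono) (auto simp: power_divide)
  moreover have "prob (\<Union>j\<in>{..nat \<lfloor>\<nu>\<rfloor>}. ?A3 j) \<le> real (card {..nat \<lfloor>\<nu>\<rfloor>}) * (\<kappa>R / h ^ 4)"
  proof (rule prob_UN_le_card)
    show "prob (?A3 j) \<le> \<kappa>R / h ^ 4" for j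
      using h by (intro fourth_moment_Markov R_fourth_moment R_fourth_integrable) auto
    show "?A3 j \<in> events" for j by measurable
  qed simp
  moreover have "real (card {..nat \<lfloor>\<nu>\<rfloor>}) * (\<kappa>R / h ^ 4) \<le> (\<nu> + 1) * (\<kappa>R / h ^ 4)"
    using J h kR by (intro mult_right_mono) auto
  moreover have "prob (exceptional R \<nu> m h) \<le> prob (\<Union>k\<in>{..m}. ?A1 k) + (prob (\<Union>d\<in>{1..nat \<lfloor>\<nu>\<rfloor>}. ?A2 d) + prob (\<Union>j\<in>{..nat \<lfloor>\<nu>\<rfloor>}. ?A3 j))"
  proof -
    have e: "(\<Union>k\<in>{..m}. ?A1 k) \<in> events" "(\<Union>d\<in>{1..nat \<lfloor>\<nu>\<rfloor>}. ?A2 d) \<in> events" "(\<Union>j\<in>{..nat \<lfloor>\<nu>\<rfloor>}. ?A3 j) \<in> events"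
      by (intro sets.finite_UN; measurable)+
    show ?thesis unfolding exceptional_def
      by (rule order_trans[OF measure_Un_le add_left_mono[OF measure_Un_le]]) (use e in \<open>auto intro: sets.Un\<close>)
  qed
  ultimately have "prob (exceptional R \<nu> m h) \<le> real (card {..m}) * (16 * \<kappa> * (\<nu> / real m + 1)\<^sup>2 / h ^ 4)
    + (\<nu> * (\<kappa> * real m ^ 4 / h ^ 4) + (\<nu> + 1) * (\<kappa>R / h ^ 4))" by linarith
  also have "\<dots> = (real (m + 1) * (16 * \<kappa> * (\<nu> / real m + 1)\<^sup>2) + \<nu> * (\<kappa> * real m ^ 4) + (\<nu> + 1) * \<kappa>R) / h ^ 4"
    by (simp add: add_divide_distrib)
  finally show ?thesis .
qed

lemma S_grid_telescope: "0 \<le> \<nu> \<Longrightarrow> S 0 (grid_index \<nu> m k) \<omega> = (\<Sum>i<k. S (grid_index \<nu> m i) (grid_index \<nu> m (Suc i)) \<omega>)"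
proof (induction k)
  case 0
  then show ?case by (simp add: grid_index_def)
next
  case (Suc k)
  then show ?case using S_append[of 0 "grid_index \<nu> m k" "grid_index \<nu> m (Suc k)" \<omega>] grid_index_mono[of \<nu> k "Suc k" m] by simp
qed

text \<open>
  Four errors of size \<open>\<epsilon>\<close>: the movement of the sum since the last grid point, the increments left out
  before it, the remainder, and the rounding of \<open>\<nu> * t\<close>.
\<close>

lemma rescaled_near_step_path:
  assumes \<nu>: "0 < \<nu>" and m: "0 < m" and \<epsilon>: "0 < \<epsilon>" and \<omega>: "\<omega> \<in> space M - exceptional R \<nu> m (\<epsilon> * (\<sigma> * sqrt \<nu>))"
    and c: "\<bar>c\<bar> \<le> \<epsilon> * (\<sigma> * sqrt \<nu>)" and t: "t \<in> {0..1}"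
  shows "\<bar>rescaled R c \<nu> t \<omega> - step_path m (\<lambda>k. block \<nu> m k \<omega>) t\<bar> \<le> 4 * \<epsilon>"
proof -
  define s where "s = \<sigma> * sqrt \<nu>"
  define h where "h = \<epsilon> * s"
  have s: "0 < s" using \<sigma>_pos \<nu> by (simp add: s_def)
  have h: "0 < h" using s \<epsilon> by (simp add: h_def)
  define k where "k = nat \<lfloor>real m * t\<rfloor>"
  define j where "j = nat \<lfloor>\<nu> * t\<rfloor>"
  let ?g = "grid_index \<nu> m"
  have mt: "0 \<le> real m * t" "real m * t \<le> real m" using t by (auto simp: mult_left_le)
  have k: "real k \<le> real m * t" "real m * t < real k + 1" using mt unfolding k_def by linarith+
  have km: "k \<le> m" using k(1) mt(2) by linarith
  have \<nu>t: "0 \<le> \<nu> * t" "\<nu> * t \<le> \<nu>" using t \<nu> by (auto simp: mult_left_le)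
  have j: "real j \<le> \<nu> * t" "\<nu> * t < real j + 1" using \<nu>t unfolding j_def by linarith+
  have jJ: "j \<le> nat \<lfloor>\<nu>\<rfloor>" unfolding j_def using \<nu>t by (intro nat_mono floor_mono)
  have gm: "?g m = nat \<lfloor>\<nu>\<rfloor>" using m by (simp add: grid_index_def)
  have gj: "?g k \<le> j"
  proof -
    have "\<nu> * real k / real m \<le> \<nu> * t" using k(1) \<nu> m by (simp add: field_simps)
    then show ?thesis unfolding grid_index_def j_def by (intro nat_mono floor_mono)
  qed
  have jg: "j \<le> ?g (Suc k)"
  proof -
    have "t \<le> real (Suc k) / real m" using k(2) m by (simp add: field_simps)
    then have "\<nu> * t \<le> \<nu> * (real (Suc k) / real m)" using \<nu> by (intro mult_left_mono) auto
    then have "\<nu> * t \<le> \<nu> * real (Suc k) / real m" by simp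
    then show ?thesis unfolding grid_index_def j_def by (intro nat_mono floor_mono)
  qed
  have nb: "\<omega> \<in> space M" "\<omega> \<notin> exceptional R \<nu> m h" using \<omega> by (auto simp: h_def s_def)
  have b1: "\<bar>S (?g k) j \<omega>\<bar> < h"
  proof -
    have "j \<in> {?g k..?g k + (?g (Suc k) - ?g k)}" using gj jg by auto
    then show ?thesis using nb km unfolding exceptional_def by (force simp: not_le)
  qed
  have b2: "\<bar>D d \<omega>\<bar> < h / real m" if "d \<in> {1..nat \<lfloor>\<nu>\<rfloor>}" for d
    using nb that unfolding exceptional_def by (force simp: not_le)
  have b3: "\<bar>R j \<omega>\<bar> < h" using nb jJ unfolding exceptional_def by (force simp: not_le)
  have b4: "\<bar>c * (real j - \<nu> * t)\<bar> \<le> h"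
  proof -
    have "\<bar>c\<bar> * \<bar>real j - \<nu> * t\<bar> \<le> h * 1" using j c by (intro mult_mono) (auto simp: h_def s_def)
    then show ?thesis by (simp add: abs_mult)
  qed
  have b5: "\<bar>(\<Sum>i<k. S (?g i) (?g (Suc i)) \<omega>) - (\<Sum>i<k. S (Suc (?g i)) (?g (Suc i)) \<omega>)\<bar> \<le> h"
  proof -
    have "\<bar>S (?g i) (?g (Suc i)) \<omega> - S (Suc (?g i)) (?g (Suc i)) \<omega>\<bar> \<le> h / real m" if "i \<in> {..<k}" for i
    proof (cases "?g i < ?g (Suc i)")
      case True
      have "?g (Suc i) \<le> ?g m" by (rule grid_index_mono) (use \<nu> that km in auto)
      then have "Suc (?g i) \<in> {1..nat \<lfloor>\<nu>\<rfloor>}" using True gm by auto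
      moreover have "S (?g i) (?g (Suc i)) \<omega> - S (Suc (?g i)) (?g (Suc i)) \<omega> = D (Suc (?g i)) \<omega>"
        using S_append[of "?g i" "Suc (?g i)" "?g (Suc i)" \<omega>] True by (simp add: S_Suc)
      ultimately show ?thesis using b2 by (simp add: less_imp_le)
    next
      case False
      then show ?thesis using h by simp
    qed
    then have "(\<Sum>i<k. \<bar>S (?g i) (?g (Suc i)) \<omega> - S (Suc (?g i)) (?g (Suc i)) \<omega>\<bar>) \<le> real (card {..<k}) * (h / real m)"
      by (rule sum_bounded_above)
    also have "\<dots> \<le> real m * (h / real m)" using km h by (intro mult_right_mono) auto
    also have "\<dots> = h" using m by simp
    finally show ?thesis
      using sum_abs[of "\<lambda>i. S (?g i) (?g (Suc i)) \<omega> - S (Suc (?g i)) (?g (Suc i)) \<omega>" "{..<k}"]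
      by (simp add: sum_subtractf)
  qed
  have "S 0 j \<omega> = (\<Sum>i<k. S (?g i) (?g (Suc i)) \<omega>) + S (?g k) j \<omega>"
    using S_grid_telescope[of \<nu> m k \<omega>] S_append[of 0 "?g k" j \<omega>] gj \<nu> by simp
  moreover have "step_path m (\<lambda>k. block \<nu> m k \<omega>) t = (\<Sum>i<k. S (Suc (?g i)) (?g (Suc i)) \<omega>) / s"
    using t by (simp add: step_path_def block_def k_def s_def sum_divide_distrib)
  ultimately have "rescaled R c \<nu> t \<omega> - step_path m (\<lambda>k. block \<nu> m k \<omega>) t =
    (((\<Sum>i<k. S (?g i) (?g (Suc i)) \<omega>) - (\<Sum>i<k. S (Suc (?g i)) (?g (Suc i)) \<omega>)) + S (?g k) j \<omega> + R j \<omega> + c * (real j - \<nu> * t)) / s"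
    by (simp add: rescaled_def j_def s_def add_divide_distrib diff_divide_distrib)
  also have "\<bar>\<dots>\<bar> \<le> (4 * h) / s"
    unfolding abs_divide using s b1 b3 b4 b5 by (simp add: divide_right_mono)
  also have "\<dots> = 4 * \<epsilon>" using s by (simp add: h_def)
  finally show ?thesis .
qed

text \<open>
  With \<open>h\<close> proportional to \<open>sqrt \<nu>\<close>, the bound \<open>prob_exceptional\<close> converges for fixed \<open>m\<close> to a multiple of
  \<open>(m + 1) / m\<^sup>2\<close> as \<open>\<nu>\<close> tends to infinity, since the maximal inequality contributes \<open>(\<nu>/m)\<^sup>2\<close> for each of
  \<open>m + 1\<close> cells and the other two families only order \<open>\<nu>\<close>. So it is small for large \<open>m\<close>.
\<close>

theorem invariance_principle:
  assumes B: "standard_brownian_motion N B"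
  shows "converges_in_distribution skorokhod_topology M (\<lambda>\<nu>. sample_path (rescaled R c \<nu>)) at_top N (sample_path B)"
proof (rule converges_in_distribution_at_topI)
  show "\<forall>\<^sub>F \<nu> in at_top. sample_path (rescaled R c \<nu>) \<in> M \<rightarrow>\<^sub>M borel_sigma skorokhod_topology"
    using eventually_gt_at_top[of 0] by eventually_elim (rule rescaled_measurable)
  fix \<nu> :: "nat \<Rightarrow> real" assume \<nu>: "filterlim \<nu> at_top sequentially" and pos: "\<And>n. 0 < \<nu> n"
  show "converges_in_distribution skorokhod_topology M (\<lambda>n. sample_path (rescaled R c (\<nu> n))) sequentially N (sample_path B)"
  proof (rule donsker_criterion[where Z = "\<lambda>m n. block (\<nu> n) m"])
    show "prob_space M" by unfold_locales
    show "\<forall>\<^sub>F n in sequentially. sample_path (rescaled R c (\<nu> n)) \<in> M \<rightarrow>\<^sub>M borel_sigma skorokhod_topology"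
      using pos rescaled_measurable by simp
    show "indep_vars (\<lambda>_. borel) (block (\<nu> n) m) {..<m}" for m n
      by (rule indep_vars_block) (use pos[of n] in simp)
    show "weak_conv_m (\<lambda>n. distr M borel (block (\<nu> n) m k)) (density lborel (normal_density 0 (sqrt (1 / real m))))"
      if "0 < m" for m k by (rule block_weak_conv[OF \<nu> pos that])
    fix \<epsilon> \<eta> :: real assume \<epsilon>: "0 < \<epsilon>" and \<eta>: "0 < \<eta>"
    have inv: "(\<lambda>n. 1 / \<nu> n) \<longlonglongrightarrow> 0"
      using \<nu> by (intro tendsto_divide_0[OF tendsto_const] filterlim_at_top_imp_at_infinity)
    define e where "e = \<epsilon> / 4"
    have e: "0 < e" using \<epsilon> by (simp add: e_def)
    \<comment> \<open>The bound for the probability of the exceptional event, as a function of x = 1 / \<nu>.\<close>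
    define G where "G m x = (real (m + 1) * (16 * \<kappa> * (1 / real m + x)\<^sup>2) + x * (\<kappa> * real m ^ 4) + (x + x\<^sup>2) * \<kappa>R) / (e * \<sigma>) ^ 4" for m x
    have "(\<lambda>m. 1 / real m) \<longlonglongrightarrow> 0" by (rule lim_const_over_n)
    then have "(\<lambda>m. (1 / real m + (1 / real m)\<^sup>2) * (16 * \<kappa> / (e * \<sigma>) ^ 4)) \<longlonglongrightarrow> (0 + 0\<^sup>2) * (16 * \<kappa> / (e * \<sigma>) ^ 4)"
      by (intro tendsto_intros)
    then have "\<forall>\<^sub>F m in sequentially. (1 / real m + (1 / real m)\<^sup>2) * (16 * \<kappa> / (e * \<sigma>) ^ 4) < \<eta>"
      using \<eta> by (intro order_tendstoD(2)) auto
    with eventually_gt_at_top[of "0::nat"]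
    show "\<forall>\<^sub>F m in sequentially. \<forall>\<^sub>F n in sequentially. \<exists>A\<in>sets M. prob A \<le> \<eta> \<and>
      (\<forall>\<omega>\<in>space M - A. \<forall>t\<in>{0..1}. \<bar>sample_path (rescaled R c (\<nu> n)) \<omega> t - step_path m (\<lambda>k. block (\<nu> n) m k \<omega>) t\<bar> \<le> \<epsilon>)"
    proof eventually_elim
      case (elim m)
      have "(\<lambda>n. G m (1 / \<nu> n)) \<longlonglongrightarrow> G m 0"
        unfolding G_def using e \<sigma>_pos by (intro tendsto_intros inv) auto
      moreover have "G m 0 = (1 / real m + (1 / real m)\<^sup>2) * (16 * \<kappa> / (e * \<sigma>) ^ 4)"
      proof -
        have "1 / real m + (1 / real m)\<^sup>2 = real (m + 1) * (1 / real m)\<^sup>2"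
          using elim(1) by (simp add: power2_eq_square field_simps)
        then show ?thesis by (simp only: G_def) simp
      qed
      ultimately have "\<forall>\<^sub>F n in sequentially. G m (1 / \<nu> n) < \<eta>"
        using elim(2) by (intro order_tendstoD(2)) auto
      moreover have "\<forall>\<^sub>F n in sequentially. (\<bar>c\<bar> / (e * \<sigma>))\<^sup>2 \<le> \<nu> n"
        using \<nu> unfolding filterlim_at_top by blast
      ultimately show ?case
      proof eventually_elim
        case (elim n)
        have s: "(sqrt (\<nu> n)) ^ 4 = (\<nu> n)\<^sup>2"
        proof -
          have "(sqrt (\<nu> n)) ^ 4 = ((sqrt (\<nu> n))\<^sup>2)\<^sup>2" by (simp flip: power_mult)
          then show ?thesis using pos[of n] by simp
        qed
        have "\<bar>c\<bar> / (e * \<sigma>) \<le> sqrt (\<nu> n)" using elim(2) by (rule real_le_rsqrt)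
        then have c: "\<bar>c\<bar> \<le> e * (\<sigma> * sqrt (\<nu> n))" using e \<sigma>_pos by (simp add: field_simps)
        have h: "0 < e * (\<sigma> * sqrt (\<nu> n))" using e \<sigma>_pos pos[of n] by simp
        have "prob (exceptional R (\<nu> n) m (e * (\<sigma> * sqrt (\<nu> n)))) \<le>
          (real (m + 1) * (16 * \<kappa> * (\<nu> n / real m + 1)\<^sup>2) + \<nu> n * (\<kappa> * real m ^ 4) + (\<nu> n + 1) * \<kappa>R) / (e * (\<sigma> * sqrt (\<nu> n))) ^ 4"
          by (rule prob_exceptional[OF pos \<open>0 < m\<close> h])
        also have "\<dots> = (real (m + 1) * (16 * \<kappa> * (\<nu> n / real m + 1)\<^sup>2) + \<nu> n * (\<kappa> * real m ^ 4) + (\<nu> n + 1) * \<kappa>R) / (\<nu> n)\<^sup>2 / (e * \<sigma>) ^ 4"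
          by (simp add: power_mult_distrib s mult_ac)
        also have "(real (m + 1) * (16 * \<kappa> * (\<nu> n / real m + 1)\<^sup>2) + \<nu> n * (\<kappa> * real m ^ 4) + (\<nu> n + 1) * \<kappa>R) / (\<nu> n)\<^sup>2 =
          real (m + 1) * (16 * \<kappa> * (1 / real m + 1 / \<nu> n)\<^sup>2) + 1 / \<nu> n * (\<kappa> * real m ^ 4) + (1 / \<nu> n + (1 / \<nu> n)\<^sup>2) * \<kappa>R"
        proof -
          have d: "(a * (b * x) + \<nu> n * y + w * z) / (\<nu> n)\<^sup>2
              = a * (b * (x / (\<nu> n)\<^sup>2)) + \<nu> n / (\<nu> n)\<^sup>2 * y + w / (\<nu> n)\<^sup>2 * z" for a b x y w z
            by (simp add: add_divide_distrib)
          have "(\<nu> n / real m + 1)\<^sup>2 / (\<nu> n)\<^sup>2 = (1 / real m + 1 / \<nu> n)\<^sup>2"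
            using pos[of n] by (simp add: add_divide_distrib flip: power_divide)
          moreover have "\<nu> n / (\<nu> n)\<^sup>2 = 1 / \<nu> n" "(\<nu> n + 1) / (\<nu> n)\<^sup>2 = 1 / \<nu> n + (1 / \<nu> n)\<^sup>2"
            using pos[of n] by (simp_all add: power2_eq_square field_simps)
          ultimately show ?thesis unfolding d by simp
        qed
        also have "\<dots> / (e * \<sigma>) ^ 4 = G m (1 / \<nu> n)" by (simp add: G_def)
        finally have "prob (exceptional R (\<nu> n) m (e * (\<sigma> * sqrt (\<nu> n)))) \<le> \<eta>" using elim(1) by simp
        moreover have "\<bar>sample_path (rescaled R c (\<nu> n)) \<omega> t - step_path m (\<lambda>k. block (\<nu> n) m k \<omega>) t\<bar> \<le> \<epsilon>"
          if "\<omega> \<in> space M - exceptional R (\<nu> n) m (e * (\<sigma> * sqrt (\<nu> n)))" "t \<in> {0..1}" for \<omega> t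
          using rescaled_near_step_path[OF pos \<open>0 < m\<close> e that(1) c that(2)] that(2)
          by (simp add: sample_path_def e_def)
        ultimately show ?case using exceptional_sets by blast
      qed
    qed
  qed (use B in auto)
qed

end

end

section \<open>Independence and integration for mass functions\<close>

text \<open>
  The product formula for points extends to arbitrary sets in one coordinate after the other, by
  summation over the countably many values of that coordinate.
\<close>

lemma (in prob_space) iid_from_joint_mass_function:
  fixes p :: "nat \<Rightarrow> 'a \<Rightarrow> 'b::countable"
  assumes p [measurable]: "\<And>i. p i \<in> M \<rightarrow>\<^sub>M count_space UNIV"
    and joint: "\<And>n a. prob {\<omega>\<in>space M. \<forall>i\<le>n. p i \<omega> = a i} = (\<Prod>i\<le>n. pmf L (a i))"
  shows "distr M (count_space UNIV) (p i) = measure_pmf L" and "indep_vars (\<lambda>_. count_space UNIV) p UNIV"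
proof -
  \<comment> \<open>J is the set of coordinates in which the point has already been replaced by a set.\<close>
  have step: "emeasure M {\<omega>\<in>space M. \<forall>i\<le>n. p i \<omega> \<in> (if i \<in> J then A i else {a i})}
      = (\<Prod>i\<le>n. emeasure (measure_pmf L) (if i \<in> J then A i else {a i}))"
    if "finite J" "J \<subseteq> {..n}" for n J A a
    using that
  proof (induction J arbitrary: a rule: finite_induct)
    case empty
    have "emeasure M {\<omega>\<in>space M. \<forall>i\<le>n. p i \<omega> = a i} = ennreal (\<Prod>i\<le>n. pmf L (a i))"
      by (simp add: emeasure_eq_measure joint)
    also have "\<dots> = (\<Prod>i\<le>n. emeasure (measure_pmf L) {a i})"
      by (simp add: emeasure_pmf_single prod_ennreal)
    finally show ?case by simp
  next
    case (insert k J)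
    let ?C = "\<lambda>a. {\<omega>\<in>space M. \<forall>i\<le>n. p i \<omega> \<in> (if i \<in> J then A i else {a i})}"
    let ?P = "\<Prod>i\<in>{..n} - {k}. emeasure (measure_pmf L) (if i \<in> J then A i else {a i})"
    have k: "k \<le> n" "k \<notin> J" using insert by auto
    have "{\<omega>\<in>space M. \<forall>i\<le>n. p i \<omega> \<in> (if i \<in> insert k J then A i else {a i})} = (\<Union>b\<in>A k. ?C (a(k := b)))"
      (is "?lhs = ?rhs")
    proof (intro set_eqI iffI)
      fix \<omega> assume *: "\<omega> \<in> ?lhs"
      then have "p k \<omega> \<in> A k" using k by auto
      moreover have "\<omega> \<in> ?C (a(k := p k \<omega>))"
        using * k by (auto split: if_splits)
      ultimately show "\<omega> \<in> ?rhs" by blast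
    next
      fix \<omega> assume "\<omega> \<in> ?rhs"
      then obtain b where b: "b \<in> A k" "\<omega> \<in> ?C (a(k := b))" by blast
      then have "p k \<omega> = b" using k by force
      then show "\<omega> \<in> ?lhs" using b k by (auto split: if_splits)
    qed
    also have "emeasure M \<dots> = (\<integral>\<^sup>+b. emeasure M (?C (a(k := b))) \<partial>count_space (A k))"
    proof (rule emeasure_UN_countable)
      show "?C (a(k := b)) \<in> sets M" for b
      proof -
        have "{\<omega>\<in>space M. \<forall>i\<in>{..n}. p i \<omega> \<in> (if i \<in> J then A i else {(a(k := b)) i})} \<in> sets M"
          by measurable
        then show ?thesis by simp
      qed
      show "disjoint_family_on (\<lambda>b. ?C (a(k := b))) (A k)"
      proof (unfold disjoint_family_on_def, intro ballI impI)
        fix b c :: 'b assume "b \<noteq> c"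
        have "p k \<omega> = b" if "\<omega> \<in> ?C (a(k := b))" for \<omega> and b :: 'b using that k by force
        then show "?C (a(k := b)) \<inter> ?C (a(k := c)) = {}" using \<open>b \<noteq> c\<close> by blast
      qed
    qed simp
    also have "\<dots> = (\<integral>\<^sup>+b. ?P * ennreal (pmf L b) \<partial>count_space (A k))"
    proof (rule nn_integral_cong)
      fix b
      have "emeasure M (?C (a(k := b))) = (\<Prod>i\<le>n. emeasure (measure_pmf L) (if i \<in> J then A i else {(a(k := b)) i}))"
        using insert by (intro insert.IH) auto
      also have "\<dots> = emeasure (measure_pmf L) {b} * ?P"
      proof -
        have "(\<Prod>i\<in>{..n} - {k}. emeasure (measure_pmf L) (if i \<in> J then A i else {(a(k := b)) i})) = ?P"
          by (intro prod.cong) auto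
        then show ?thesis using k by (subst prod.remove[of _ k]) auto
      qed
      finally show "emeasure M (?C (a(k := b))) = ?P * ennreal (pmf L b)"
        by (simp add: emeasure_pmf_single mult.commute)
    qed
    also have "\<dots> = ?P * emeasure (measure_pmf L) (A k)"
      by (simp add: nn_integral_cmult nn_integral_pmf)
    also have "\<dots> = (\<Prod>i\<le>n. emeasure (measure_pmf L) (if i \<in> insert k J then A i else {a i}))"
    proof -
      have "(\<Prod>i\<in>{..n} - {k}. emeasure (measure_pmf L) (if i \<in> insert k J then A i else {a i})) = ?P"
        by (intro prod.cong) auto
      then show ?thesis using k by (subst prod.remove[of "{..n}" k]) (auto simp: mult.commute)
    qed
    finally show ?case .
  qed
  have cyl: "emeasure M {\<omega>\<in>space M. \<forall>i\<le>n. p i \<omega> \<in> A i} = (\<Prod>i\<le>n. emeasure (measure_pmf L) (A i))" for n A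
  proof -
    have "{\<omega>\<in>space M. \<forall>i\<le>n. p i \<omega> \<in> A i}
      = {\<omega>\<in>space M. \<forall>i\<le>n. p i \<omega> \<in> (if i \<in> {..n} then A i else {undefined})}" by auto
    then show ?thesis using step[of "{..n}" n A "\<lambda>_. undefined"] by simp
  qed
  have marginal: "emeasure M (p i -` B \<inter> space M) = emeasure (measure_pmf L) B" for i B
  proof -
    have "p i -` B \<inter> space M = {\<omega>\<in>space M. \<forall>j\<le>i. p j \<omega> \<in> (if j = i then B else UNIV)}" by auto
    also have "emeasure M \<dots> = (\<Prod>j\<le>i. emeasure (measure_pmf L) (if j = i then B else UNIV))" by (rule cyl)
    also have "\<dots> = (\<Prod>j\<le>i. if j = i then emeasure (measure_pmf L) B else 1)"
      by (intro prod.cong) (auto simp: measure_pmf.emeasure_space_1[simplified])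
    also have "\<dots> = emeasure (measure_pmf L) B" by simp
    finally show ?thesis .
  qed
  show "distr M (count_space UNIV) (p i) = measure_pmf L"
    by (rule measure_eqI) (simp_all add: emeasure_distr marginal)
  show "indep_vars (\<lambda>_. count_space UNIV) p UNIV"
    unfolding indep_vars_def2
  proof (intro conjI ballI indep_setsI)
    fix A J assume J: "J \<noteq> {}" "J \<subseteq> (UNIV :: nat set)" "finite J"
      and A: "\<forall>j\<in>J. A j \<in> {p j -` B \<inter> space M |B. B \<in> sets (count_space UNIV)}"
    then obtain B where B: "\<And>j. j \<in> J \<Longrightarrow> A j = p j -` B j \<inter> space M"
      by simp metis
    define n where "n = Max J"
    have Jn: "J \<subseteq> {..n}" using J by (auto simp: n_def)
    have "(\<Inter>j\<in>J. A j) = {\<omega>\<in>space M. \<forall>i\<le>n. p i \<omega> \<in> (if i \<in> J then B i else UNIV)}"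
      using B J(1) Jn by auto
    then have "emeasure M (\<Inter>j\<in>J. A j) = (\<Prod>i\<le>n. emeasure (measure_pmf L) (if i \<in> J then B i else UNIV))"
      by (simp only: cyl)
    also have "\<dots> = (\<Prod>i\<in>J. emeasure (measure_pmf L) (B i))"
      using Jn by (intro prod.mono_neutral_cong_right) (auto simp: measure_pmf.emeasure_space_1[simplified])
    also have "\<dots> = (\<Prod>j\<in>J. emeasure M (A j))"
      by (intro prod.cong) (simp_all add: B marginal)
    finally show "prob (\<Inter>j\<in>J. A j) = (\<Prod>j\<in>J. prob (A j))"
      by (simp add: emeasure_eq_measure prod_ennreal prod_nonneg)
  qed auto
qed

lemma measure_pair_pmf:
  fixes A :: "'a::countable pmf" and B :: "'b::countable pmf"
  shows "measure_pmf (pair_pmf A B) = measure_pmf A \<Otimes>\<^sub>M measure_pmf B"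
proof (rule measure_eqI_countable[where A = UNIV])
  have "sets (measure_pmf A \<Otimes>\<^sub>M measure_pmf B) = sets (count_space UNIV \<Otimes>\<^sub>M count_space UNIV)"
    by (rule sets_pair_measure_cong) simp_all
  also have "\<dots> = Pow UNIV" by (subst pair_measure_countable) auto
  finally show "sets (measure_pmf A \<Otimes>\<^sub>M measure_pmf B) = Pow UNIV" .
  fix x :: "'a \<times> 'b"
  obtain a b where x: "x = (a, b)" by force
  have "emeasure (measure_pmf A \<Otimes>\<^sub>M measure_pmf B) ({a} \<times> {b}) = ennreal (pmf A a) * ennreal (pmf B b)"
    by (subst measure_pmf.emeasure_pair_measure_Times) (simp_all add: emeasure_pmf_single)
  then show "emeasure (measure_pmf (pair_pmf A B)) {x} = emeasure (measure_pmf A \<Otimes>\<^sub>M measure_pmf B) {x}"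
    by (simp add: x emeasure_pmf_single pmf_pair ennreal_mult)
qed auto

lemma pair_pmf_product:
  fixes A :: "'a::countable pmf" and B :: "'b::countable pmf" and F H :: "_ \<Rightarrow> real"
  assumes F: "integrable (measure_pmf A) F" and H: "integrable (measure_pmf B) H"
  shows "integrable (measure_pmf (pair_pmf A B)) (\<lambda>(a, b). F a * H b)"
    and "measure_pmf.expectation (pair_pmf A B) (\<lambda>(a, b). F a * H b) = measure_pmf.expectation A F * measure_pmf.expectation B H"
proof -
  interpret pair_sigma_finite "measure_pmf A" "measure_pmf B" ..
  have "sets (measure_pmf A \<Otimes>\<^sub>M measure_pmf B) = UNIV"
    unfolding measure_pair_pmf[symmetric] by simp
  then have m: "(\<lambda>(a, b). F a * H b) \<in> borel_measurable (measure_pmf A \<Otimes>\<^sub>M measure_pmf B)"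
    unfolding measure_pair_pmf[symmetric] by simp
  show int: "integrable (measure_pmf (pair_pmf A B)) (\<lambda>(a, b). F a * H b)"
    unfolding measure_pair_pmf
    by (rule Fubini_integrable[OF m]) (use F H in \<open>auto simp: abs_mult\<close>)
  show "measure_pmf.expectation (pair_pmf A B) (\<lambda>(a, b). F a * H b) = measure_pmf.expectation A F * measure_pmf.expectation B H"
    using integral_fst'[OF int[unfolded measure_pair_pmf]] by (simp add: measure_pair_pmf)
qed

section \<open>Moments of the geometric law\<close>

text \<open>
  Bernoulli's inequality gives \<open>1 + n \<le> (20/3) * 1.15 ^ n\<close>, as \<open>20/3 = 1/0.15\<close>, and \<open>1.15 ^ 4 < 1.75\<close>. The base
  \<open>1.75\<close> is below \<open>1 / dcc_rho\<close>, so all fourth moments needed below are finite.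
\<close>

lemma polynomial_le_geometric: "(1 + real n) ^ 4 \<le> (20 / 3) ^ 4 * (1.75 :: real) ^ n"
proof -
  have "1 + real n * 0.15 \<le> (1 + 0.15 :: real) ^ n"
    using Bernoulli_inequality[of "0.15::real" n] by simp
  then have "(1 + real n) ^ 4 \<le> (20 / 3 * (1.15 :: real) ^ n) ^ 4"
    by (intro power_mono) auto
  also have "\<dots> = (20 / 3) ^ 4 * ((1.15 :: real) ^ 4) ^ n"
  proof -
    have "(b ^ n) ^ 4 = (b ^ 4) ^ n" for b :: real by (simp add: mult.commute flip: power_mult)
    then show ?thesis by (simp only: power_mult_distrib)
  qed
  also have "\<dots> \<le> (20 / 3) ^ 4 * (1.75 :: real) ^ n"
    by (intro mult_left_mono power_mono) (auto simp: eval_nat_numeral)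
  finally show ?thesis .
qed

lemma geometric_pmf_integrable:
  fixes F :: "nat \<Rightarrow> real"
  assumes r: "0 \<le> r" "r * 1.75 < 1" and F: "\<And>i. \<bar>F i\<bar> \<le> C * (1 + real i) ^ 4"
  shows "integrable (measure_pmf (geometric_pmf (1 - r))) F"
proof -
  have p: "0 < 1 - r" "1 - r \<le> 1" using r by auto
  have C: "0 \<le> C" using order_trans[OF abs_ge_zero F[of 0]] by simp
  have "(\<integral>\<^sup>+i. ennreal (norm (F i)) \<partial>measure_pmf (geometric_pmf (1 - r)))
    = (\<integral>\<^sup>+i. ennreal (pmf (geometric_pmf (1 - r)) i) * ennreal (norm (F i)) \<partial>count_space UNIV)"
    by (rule nn_integral_measure_pmf)
  also have "\<dots> \<le> (\<integral>\<^sup>+i. ennreal (C * (20 / 3) ^ 4 * (1 - r) * (r * 1.75) ^ i) \<partial>count_space UNIV)"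
  proof (rule nn_integral_mono)
    fix i
    have "\<bar>F i\<bar> \<le> C * ((20 / 3) ^ 4 * 1.75 ^ i)"
      by (rule order_trans[OF F mult_left_mono[OF polynomial_le_geometric C]])
    then have "pmf (geometric_pmf (1 - r)) i * \<bar>F i\<bar> \<le> (r ^ i * (1 - r)) * (C * ((20 / 3) ^ 4 * 1.75 ^ i))"
      using r by (intro mult_mono) (auto simp: pmf_geometric[OF p])
    also have "\<dots> = C * (20 / 3) ^ 4 * (1 - r) * (r * 1.75) ^ i" by (simp only: power_mult_distrib mult_ac)
    finally show "ennreal (pmf (geometric_pmf (1 - r)) i) * ennreal (norm (F i)) \<le> ennreal (C * (20 / 3) ^ 4 * (1 - r) * (r * 1.75) ^ i)"
      by (simp add: ennreal_mult'[symmetric] ennreal_leI)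
  qed
  also have "\<dots> = (\<Sum>i. ennreal (C * (20 / 3) ^ 4 * (1 - r) * (r * 1.75) ^ i))" by (rule nn_integral_count_space_nat)
  also have "\<dots> < \<infinity>"
  proof -
    have "summable (\<lambda>i. C * (20 / 3) ^ 4 * (1 - r) * (r * 1.75) ^ i)"
      using r by (intro summable_mult summable_geometric) auto
    then show ?thesis using C r by (subst suminf_ennreal2) auto
  qed
  finally show ?thesis by (intro integrableI_bounded) auto
qed

text \<open>
  A geometric variable is 0 with probability \<open>1 - r\<close> and otherwise distributed like its successor. This
  turns every moment into the solution of a linear equation.
\<close>

lemma geometric_pmf_expectation_Suc:
  fixes F :: "nat \<Rightarrow> real"
  assumes r: "0 \<le> r" "r < 1" and F: "integrable (measure_pmf (geometric_pmf (1 - r))) F"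
    and FS: "integrable (measure_pmf (geometric_pmf (1 - r))) (\<lambda>i. F (Suc i))"
  shows "measure_pmf.expectation (geometric_pmf (1 - r)) F
    = (1 - r) * F 0 + r * measure_pmf.expectation (geometric_pmf (1 - r)) (\<lambda>i. F (Suc i))"
proof -
  have p: "0 < 1 - r" "1 - r \<le> 1" using r by auto
  have sums: "(\<lambda>i. r ^ i * (1 - r) * G i) sums measure_pmf.expectation (geometric_pmf (1 - r)) G"
    if "integrable (measure_pmf (geometric_pmf (1 - r))) G" for G :: "nat \<Rightarrow> real"
  proof -
    have "integrable (count_space UNIV) (\<lambda>i. pmf (geometric_pmf (1 - r)) i *\<^sub>R G i)"
      using that by (simp add: measure_pmf_eq_density integrable_density pmf_nonneg)
    from sums_integral_count_space_nat[OF this]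
    have "(\<lambda>i. pmf (geometric_pmf (1 - r)) i *\<^sub>R G i) sums measure_pmf.expectation (geometric_pmf (1 - r)) G"
      by (simp add: measure_pmf_eq_density integral_density pmf_nonneg)
    then show ?thesis by (simp add: pmf_geometric[OF p])
  qed
  have "(\<lambda>i. r ^ Suc i * (1 - r) * F (Suc i)) sums (r * measure_pmf.expectation (geometric_pmf (1 - r)) (\<lambda>i. F (Suc i)))"
    using sums_mult[OF sums[OF FS], of r] by (simp add: mult_ac)
  then have "(\<lambda>i. r ^ i * (1 - r) * F i) sums (r * measure_pmf.expectation (geometric_pmf (1 - r)) (\<lambda>i. F (Suc i)) + (1 - r) * F 0)"
    by (subst (asm) sums_Suc_iff) simp
  from sums_unique2[OF sums[OF F] this] show ?thesis by simp
qed

section \<open>The law of the columns\<close>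

lemma dcc_rho_facts: "0 < dcc_rho" "dcc_rho * 1.75 < 1" "dcc_rho < 1" "dcc_rho\<^sup>2 = 3 * dcc_rho - 1" "(1 - dcc_rho)\<^sup>2 = dcc_rho"
proof -
  have s: "(2.236::real) < sqrt 5" by (rule real_less_rsqrt) (simp add: power2_eq_square)
  have s': "sqrt 5 < (2.237::real)" by (rule real_less_lsqrt) (simp_all add: power2_eq_square)
  show "0 < dcc_rho" "dcc_rho * 1.75 < 1" "dcc_rho < 1" using s s' by (auto simp: dcc_rho_def)
  have "(sqrt 5)\<^sup>2 = (5::real)" by simp
  then show "dcc_rho\<^sup>2 = 3 * dcc_rho - 1" "(1 - dcc_rho)\<^sup>2 = dcc_rho"
    unfolding dcc_rho_def by (simp_all add: power2_eq_square field_simps)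
qed

definition dcc_height :: "nat pmf" where
  "dcc_height = geometric_pmf (1 - dcc_rho)"

text \<open>
  With \<open>u - 1\<close> and \<open>x - u\<close> independent and geometric, the pair \<open>(u, x)\<close> has mass
  \<open>(1 - dcc_rho)\<^sup>2 * dcc_rho ^ (x - 1) = dcc_rho ^ x\<close> on \<open>1 \<le> u \<le> x\<close>, which is the law of a column: \<open>x\<close> has
  mass \<open>x * dcc_rho ^ x\<close>, and \<open>u\<close> is uniform given \<open>x\<close>.
\<close>

definition dcc_column :: "(nat \<times> nat) pmf" where
  "dcc_column = map_pmf (\<lambda>(a, b). (a + 1, a + b + 1)) (pair_pmf dcc_height dcc_height)"

lemma pmf_dcc_height: "pmf dcc_height i = dcc_rho ^ i * (1 - dcc_rho)"
  using dcc_rho_facts by (simp add: dcc_height_def)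

lemma pmf_dcc_column: "pmf dcc_column (j, k) = (if 1 \<le> j \<and> j \<le> k then dcc_rho ^ k else 0)"
proof (cases "1 \<le> j \<and> j \<le> k")
  case True
  let ?g = "\<lambda>(a::nat, b::nat). (a + 1, a + b + 1)"
  have "inj ?g" by (auto simp: inj_on_def)
  moreover have "?g (j - 1, k - j) = (j, k)" using True by auto
  ultimately have "pmf dcc_column (j, k) = pmf (pair_pmf dcc_height dcc_height) (j - 1, k - j)"
    using pmf_map_inj'[of ?g "pair_pmf dcc_height dcc_height" "(j - 1, k - j)"] by (simp add: dcc_column_def)
  also have "\<dots> = (dcc_rho ^ (j - 1) * dcc_rho ^ (k - j)) * (1 - dcc_rho)\<^sup>2"
    by (simp add: pmf_pair pmf_dcc_height power2_eq_square)
  also have "\<dots> = dcc_rho ^ k"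
  proof -
    have "dcc_rho ^ (j - 1) * dcc_rho ^ (k - j) * dcc_rho = dcc_rho ^ Suc ((j - 1) + (k - j))"
      by (simp add: power_add)
    also have "Suc ((j - 1) + (k - j)) = k" using True by auto
    finally show ?thesis by (simp add: dcc_rho_facts)
  qed
  finally show ?thesis using True by simp
next
  case False
  then have "(j, k) \<notin> set_pmf dcc_column" by (auto simp: dcc_column_def)
  then have "pmf dcc_column (j, k) = 0" by (simp add: set_pmf_iff)
  then show ?thesis unfolding if_not_P[OF False] .
qed

context dcc_columns
begin

definition col :: "nat \<Rightarrow> 'a \<Rightarrow> nat \<times> nat" where
  "col d \<omega> = (u d \<omega>, x d \<omega>)"

lemma x_measurable [measurable]: "x d \<in> M \<rightarrow>\<^sub>M count_space UNIV"
  using sizes by (simp add: stationary_markov_chain_def)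

declare u_measurable [measurable]

lemma col_measurable [measurable]: "col d \<in> M \<rightarrow>\<^sub>M count_space UNIV"
proof -
  have "(\<lambda>\<omega>. (u d \<omega>, x d \<omega>)) \<in> M \<rightarrow>\<^sub>M count_space UNIV \<Otimes>\<^sub>M count_space UNIV" by measurable
  then show ?thesis by (simp add: col_def[abs_def] pair_measure_countable)
qed

lemma prob_sizes: "\<P>(\<omega> in M. \<forall>i\<le>n. x i \<omega> = k i) = (\<Prod>i\<le>n. real (k i) * dcc_rho ^ k i)"
proof (induction n)
  case 0
  then show ?case using sizes by (simp add: stationary_markov_chain_def)
next
  case (Suc n)
  have "\<P>(\<omega> in M. \<forall>i\<le>Suc n. x i \<omega> = k i) = \<P>(\<omega> in M. \<forall>i\<le>n. x i \<omega> = k i) * (real (k (Suc n)) * dcc_rho ^ k (Suc n))"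
    using sizes unfolding stationary_markov_chain_def by blast
  then show ?case by (simp add: Suc)
qed

text \<open>
  If the sizes have positive probability, the conditional law of the positions contributes a factor \<open>1 / k i\<close>
  for each column. Otherwise some \<open>k i\<close> is 0, and both sides vanish.
\<close>

lemma prob_columns: "prob {\<omega>\<in>space M. \<forall>i\<le>n. col i \<omega> = a i} = (\<Prod>i\<le>n. pmf dcc_column (a i))"
proof -
  define j where "j i = fst (a i)" for i
  define k where "k i = snd (a i)" for i
  have a: "a i = (j i, k i)" for i by (simp add: j_def k_def)
  let ?X = "\<P>(\<omega> in M. \<forall>i\<le>n. x i \<omega> = k i)"
  let ?UX = "\<P>(\<omega> in M. (\<forall>i\<le>n. u i \<omega> = j i) \<and> (\<forall>i\<le>n. x i \<omega> = k i))"
  have UX: "prob {\<omega>\<in>space M. \<forall>i\<le>n. col i \<omega> = a i} = ?UX"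
    by (rule arg_cong[where f = prob]) (auto simp: col_def a)
  have meas: "{\<omega>\<in>space M. \<forall>i\<le>n. x i \<omega> = k i} \<in> events" by measurable
  show ?thesis
  proof (cases "?X > 0")
    case True
    have kpos: "0 < k i" if "i \<le> n" for i
    proof (rule ccontr)
      assume "\<not> 0 < k i"
      then have "?X = 0" unfolding prob_sizes using that by (intro prod_zero) auto
      with True show False by simp
    qed
    have "?UX / ?X = (\<Prod>i\<le>n. pmf (pmf_of_set {1..k i}) (j i))"
      using u_uniform[OF True, of j] by (simp add: cond_prob_def)
    then have "?UX = (\<Prod>i\<le>n. pmf (pmf_of_set {1..k i}) (j i)) * ?X"
      using True by (simp add: field_simps)
    also have "\<dots> = (\<Prod>i\<le>n. pmf (pmf_of_set {1..k i}) (j i) * (real (k i) * dcc_rho ^ k i))"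
      by (simp add: prob_sizes prod.distrib)
    also have "\<dots> = (\<Prod>i\<le>n. pmf dcc_column (a i))"
    proof (rule prod.cong)
      fix i assume "i \<in> {..n}"
      then have "0 < k i" using kpos by simp
      then show "pmf (pmf_of_set {1..k i}) (j i) * (real (k i) * dcc_rho ^ k i) = pmf dcc_column (a i)"
        by (subst pmf_of_set) (auto simp: a pmf_dcc_column indicator_def)
    qed simp
    finally show ?thesis using UX by simp
  next
    case False
    then have X0: "?X = 0" using measure_nonneg[of M "{\<omega>\<in>space M. \<forall>i\<le>n. x i \<omega> = k i}"] by linarith
    have "?UX \<le> ?X" by (rule finite_measure_mono[OF _ meas]) auto
    then have "?UX = 0" using X0 measure_nonneg[of M "{\<omega>\<in>space M. (\<forall>i\<le>n. u i \<omega> = j i) \<and> (\<forall>i\<le>n. x i \<omega> = k i)}"] by linarith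
    moreover have "(\<Prod>i\<le>n. pmf dcc_column (a i)) = 0"
    proof -
      have "(\<Prod>i\<le>n. real (k i) * dcc_rho ^ k i) = 0" using X0 unfolding prob_sizes .
      then obtain i where "i \<le> n" "real (k i) * dcc_rho ^ k i = 0" by (auto simp: prod_zero_iff)
      then have "i \<le> n" "k i = 0" using dcc_rho_facts by auto
      then show ?thesis by (intro prod_zero) (auto simp: a pmf_dcc_column intro!: bexI[of _ i])
    qed
    ultimately show ?thesis using UX by simp
  qed
qed

lemma distr_col: "distr M (count_space UNIV) (col d) = measure_pmf dcc_column"
  by (rule iid_from_joint_mass_function(1)[OF col_measurable prob_columns])

sublocale columns: independent_sequence M col
  by unfold_locales (rule iid_from_joint_mass_function(2)[OF col_measurable prob_columns])

lemma expectation_col: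
  fixes K :: "nat \<times> nat \<Rightarrow> real"
  shows "expectation (\<lambda>\<omega>. K (col d \<omega>)) = measure_pmf.expectation (pair_pmf dcc_height dcc_height) (\<lambda>(a, b). K (a + 1, a + b + 1))"
    and "integrable M (\<lambda>\<omega>. K (col d \<omega>)) \<longleftrightarrow> integrable (measure_pmf (pair_pmf dcc_height dcc_height)) (\<lambda>(a, b). K (a + 1, a + b + 1))"
proof -
  have "expectation (\<lambda>\<omega>. K (col d \<omega>)) = integral\<^sup>L (distr M (count_space UNIV) (col d)) K"
    by (subst integral_distr) auto
  also have "\<dots> = measure_pmf.expectation (pair_pmf dcc_height dcc_height) (\<lambda>(a, b). K (a + 1, a + b + 1))"
    unfolding distr_col dcc_column_def by (simp add: case_prod_unfold)
  finally show "expectation (\<lambda>\<omega>. K (col d \<omega>)) = measure_pmf.expectation (pair_pmf dcc_height dcc_height) (\<lambda>(a, b). K (a + 1, a + b + 1))" .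
  have "integrable M (\<lambda>\<omega>. K (col d \<omega>)) \<longleftrightarrow> integrable (distr M (count_space UNIV) (col d)) K"
    by (subst integrable_distr_eq) auto
  also have "\<dots> \<longleftrightarrow> integrable (measure_pmf (pair_pmf dcc_height dcc_height)) (\<lambda>(a, b). K (a + 1, a + b + 1))"
    unfolding distr_col dcc_column_def by (simp add: case_prod_unfold)
  finally show "integrable M (\<lambda>\<omega>. K (col d \<omega>)) \<longleftrightarrow> integrable (measure_pmf (pair_pmf dcc_height dcc_height)) (\<lambda>(a, b). K (a + 1, a + b + 1))" .
qed

end

section \<open>Moments of the columns\<close>

definition (in prob_space) fourth_moment_le :: "real \<Rightarrow> ('a \<Rightarrow> real) \<Rightarrow> bool" where
  "fourth_moment_le K X \<longleftrightarrow> X \<in> borel_measurable M \<and> integrable M (\<lambda>\<omega>. X \<omega> ^ 4) \<and> expectation (\<lambda>\<omega>. X \<omega> ^ 4) \<le> K"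

context prob_space
begin

lemma fourth_moment_le_const: "fourth_moment_le (c ^ 4) (\<lambda>_. c)" by (simp add: fourth_moment_le_def prob_space)

lemma fourth_moment_le_cmult: "fourth_moment_le K X \<Longrightarrow> fourth_moment_le (c ^ 4 * K) (\<lambda>\<omega>. c * X \<omega>)"
  by (auto simp: fourth_moment_le_def power_mult_distrib intro!: mult_left_mono)

lemma fourth_moment_le_abs: "fourth_moment_le K X \<Longrightarrow> fourth_moment_le K (\<lambda>\<omega>. \<bar>X \<omega>\<bar>)"
  by (auto simp: fourth_moment_le_def power_even_abs)

lemma fourth_moment_le_add:
  assumes "fourth_moment_le K X" "fourth_moment_le K' Y" shows "fourth_moment_le (8 * (K + K')) (\<lambda>\<omega>. X \<omega> + Y \<omega>)"
proof -
  have [measurable]: "X \<in> borel_measurable M" "Y \<in> borel_measurable M" using assms by (simp_all add: fourth_moment_le_def)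
  have int: "integrable M (\<lambda>\<omega>. 8 * (X \<omega> ^ 4 + Y \<omega> ^ 4))" using assms by (simp add: fourth_moment_le_def)
  have i: "integrable M (\<lambda>\<omega>. (X \<omega> + Y \<omega>) ^ 4)"
    by (rule Bochner_Integration.integrable_bound[OF int])
      (use fourth_power_sum_le in \<open>auto intro!: AE_I2 order_trans[OF _ abs_ge_self]\<close>)
  have "expectation (\<lambda>\<omega>. (X \<omega> + Y \<omega>) ^ 4) \<le> expectation (\<lambda>\<omega>. 8 * (X \<omega> ^ 4 + Y \<omega> ^ 4))"
    by (rule integral_mono[OF i int fourth_power_sum_le])
  also have "\<dots> \<le> 8 * (K + K')" using assms by (simp add: fourth_moment_le_def)
  finally show ?thesis using i by (simp add: fourth_moment_le_def)
qed

lemma fourth_moment_le_diff: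
  assumes "fourth_moment_le K X" "fourth_moment_le K' Y" shows "fourth_moment_le (8 * (K + K')) (\<lambda>\<omega>. X \<omega> - Y \<omega>)"
  using fourth_moment_le_add[OF assms(1) fourth_moment_le_cmult[OF assms(2), of "-1"]] by simp

lemma fourth_moment_le_mult_integrable: "fourth_moment_le K X \<Longrightarrow> fourth_moment_le K' Y \<Longrightarrow> integrable M (\<lambda>\<omega>. X \<omega> * Y \<omega>)"
  using integrable_power_mult(1)[of X Y 1 1] by (simp add: fourth_moment_le_def)

lemma fourth_moment_le_integrable: "fourth_moment_le K X \<Longrightarrow> integrable M X"
  using integrable_power_mult(1)[of X X 1 0] by (simp add: fourth_moment_le_def)

end

lemma dcc_height_integrable: "(\<And>i. \<bar>F i\<bar> \<le> C * (1 + real i) ^ 4) \<Longrightarrow> integrable (measure_pmf dcc_height) F"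
  unfolding dcc_height_def using dcc_rho_facts by (intro geometric_pmf_integrable) auto

lemma dcc_height_expectation_Suc:
  assumes "integrable (measure_pmf dcc_height) F" "integrable (measure_pmf dcc_height) (\<lambda>i. F (Suc i))"
  shows "measure_pmf.expectation dcc_height F
    = (1 - dcc_rho) * F 0 + dcc_rho * measure_pmf.expectation dcc_height (\<lambda>i. F (Suc i))"
  using assms dcc_rho_facts unfolding dcc_height_def by (intro geometric_pmf_expectation_Suc) auto

lemma dcc_height_moment_integrable:
  assumes "a \<le> 2" "0 \<le> q" "q \<le> 1"
  shows "integrable (measure_pmf dcc_height) (\<lambda>i. real i ^ a * q ^ i)"
    and "integrable (measure_pmf dcc_height) (\<lambda>i. real (Suc i) ^ a * q ^ Suc i)"
proof -
  have 1: "\<bar>real n ^ a * q ^ n\<bar> \<le> 1 * (1 + real i) ^ 4" if "n \<le> Suc i" for n i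
  proof -
    have "real n ^ a * q ^ n \<le> (1 + real i) ^ a * 1"
      using assms that by (intro mult_mono power_mono power_le_one) auto
    also have "\<dots> \<le> (1 + real i) ^ 4" using assms by (simp add: power_increasing)
    finally show ?thesis using assms by simp
  qed
  show "integrable (measure_pmf dcc_height) (\<lambda>i. real i ^ a * q ^ i)"
    by (rule dcc_height_integrable[where C = 1], rule 1) simp
  show "integrable (measure_pmf dcc_height) (\<lambda>i. real (Suc i) ^ a * q ^ Suc i)"
    by (rule dcc_height_integrable[where C = 1], rule 1) simp
qed

lemma dcc_height_moment_recursion:
  fixes q :: real
  assumes "0 \<le> q" "q \<le> 1"
  defines "e \<equiv> \<lambda>a::nat. measure_pmf.expectation dcc_height (\<lambda>i. real i ^ a * q ^ i)"
  shows "e 0 = (1 - dcc_rho) + dcc_rho * q * e 0"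
    and "e 1 = dcc_rho * q * (e 1 + e 0)"
    and "e 2 = dcc_rho * q * (e 2 + 2 * e 1 + e 0)"
proof -
  note int = dcc_height_moment_integrable[OF _ assms(1,2)]
  have i: "integrable (measure_pmf dcc_height) (\<lambda>i. q ^ i)" "integrable (measure_pmf dcc_height) (\<lambda>i. real i * q ^ i)"
      "integrable (measure_pmf dcc_height) (\<lambda>i. (real i)\<^sup>2 * q ^ i)"
    using int(1)[of 0] int(1)[of 1] int(1)[of 2] by simp_all
  have s: "e a = (1 - dcc_rho) * (real 0 ^ a * q ^ 0) + dcc_rho * measure_pmf.expectation dcc_height (\<lambda>i. real (Suc i) ^ a * q ^ Suc i)"
    if "a \<le> 2" for a
    unfolding e_def using int[OF that] by (rule dcc_height_expectation_Suc)
  show "e 0 = (1 - dcc_rho) + dcc_rho * q * e 0" using s[of 0] by (simp add: e_def)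
  have "(\<lambda>i. real (Suc i) ^ 1 * q ^ Suc i) = (\<lambda>i. q * (real i * q ^ i + q ^ i))"
    by (simp add: fun_eq_iff algebra_simps)
  with s[of 1] show "e 1 = dcc_rho * q * (e 1 + e 0)" using i by (simp add: e_def)
  have "(\<lambda>i. real (Suc i) ^ 2 * q ^ Suc i) = (\<lambda>i. q * ((real i)\<^sup>2 * q ^ i + 2 * (real i * q ^ i) + q ^ i))"
    by (simp add: fun_eq_iff algebra_simps power2_eq_square)
  with s[of 2] show "e 2 = dcc_rho * q * (e 2 + 2 * e 1 + e 0)" using i by (simp add: e_def)
qed

lemma dcc_height_moments:
  shows "measure_pmf.expectation dcc_height (\<lambda>i. real i) = (sqrt 5 - 1) / 2"
    and "measure_pmf.expectation dcc_height (\<lambda>i. (real i)\<^sup>2) = (5 - sqrt 5) / 2"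
    and "measure_pmf.expectation dcc_height (\<lambda>i. dcc_rho ^ i) = (5 + sqrt 5) / 10"
    and "measure_pmf.expectation dcc_height (\<lambda>i. real i * dcc_rho ^ i) = (sqrt 5 - 1) / 10"
    and "measure_pmf.expectation dcc_height (\<lambda>i. (real i)\<^sup>2 * dcc_rho ^ i) = (15 - 3 * sqrt 5) / 50"
    and "measure_pmf.expectation dcc_height (\<lambda>i. (dcc_rho\<^sup>2) ^ i) = (3 + sqrt 5) / 8"
    and "measure_pmf.expectation dcc_height (\<lambda>i. real i * (dcc_rho\<^sup>2) ^ i) = (sqrt 5 - 1) / 32"
proof -
  define s :: real where "s = sqrt 5"
  have ss: "s * s = 5" by (simp add: s_def)
  then have sss: "s * (s * y) = 5 * y" for y by (simp flip: mult.assoc)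
  have r: "dcc_rho = (3 - s) / 2" by (simp add: dcc_rho_def s_def)
  have r2: "dcc_rho\<^sup>2 = (7 - 3 * s) / 2" unfolding r power2_eq_square by (simp add: field_simps ss sss)
  have rr: "dcc_rho * dcc_rho = (7 - 3 * s) / 2" using r2 by (simp add: power2_eq_square)
  have r3: "dcc_rho * dcc_rho\<^sup>2 = 9 - 4 * s" unfolding r2 unfolding r by (simp add: field_simps ss sss)
  have solve: "e = d * k" if "e = d + c * e" "(1 - c) * k = 1" for e d c k :: real
  proof -
    have "e = e * ((1 - c) * k)" using that(2) by simp
    also have "\<dots> = (e - c * e) * k" by (simp add: algebra_simps)
    also have "e - c * e = d" using that(1) by simp
    finally show ?thesis .
  qed
  have q: "0 \<le> dcc_rho" "dcc_rho \<le> 1" "0 \<le> dcc_rho\<^sup>2" "dcc_rho\<^sup>2 \<le> 1"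
    using dcc_rho_facts(1,3) power_le_one[of dcc_rho 2] by (simp_all only: less_imp_le zero_le_power2)
  define e where "e q a = measure_pmf.expectation dcc_height (\<lambda>i. real i ^ a * q ^ i)" for q :: real and a :: nat
  note rec = dcc_height_moment_recursion[folded e_def]
  have k0: "(1 - dcc_rho * 1) * ((1 + s) / 2) = 1" unfolding r by (simp add: field_simps ss sss)
  have k1: "(1 - dcc_rho * dcc_rho) * ((3 * s + 5) / 10) = 1" unfolding rr by (simp add: field_simps ss sss)
  have k2: "(1 - dcc_rho * dcc_rho\<^sup>2) * ((s + 2) / 4) = 1" unfolding r3 by (simp add: field_simps ss sss)
  have e00: "e 1 0 = 1" by (simp add: e_def)
  have e01: "e 1 1 = (s - 1) / 2"
  proof -
    have "e 1 1 = dcc_rho * 1 * e 1 0 + dcc_rho * 1 * e 1 1" using rec(2)[of 1] by (simp add: distrib_left)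
    from solve[OF this k0] show ?thesis unfolding e00 r by (simp add: field_simps ss sss)
  qed
  have e02: "e 1 2 = (5 - s) / 2"
  proof -
    have "e 1 2 = dcc_rho * 1 * (2 * e 1 1 + e 1 0) + dcc_rho * 1 * e 1 2" using rec(3)[of 1] by (simp add: algebra_simps)
    from solve[OF this k0] show ?thesis unfolding e00 e01 r by (simp add: field_simps ss sss)
  qed
  have e10: "e dcc_rho 0 = (5 + s) / 10"
  proof -
    have "e dcc_rho 0 = (1 - dcc_rho) + dcc_rho * dcc_rho * e dcc_rho 0" using rec(1)[OF q(1,2)] .
    from solve[OF this k1] show ?thesis unfolding r by (simp add: field_simps ss sss)
  qed
  have e11: "e dcc_rho 1 = (s - 1) / 10"
  proof -
    have "e dcc_rho 1 = dcc_rho * dcc_rho * e dcc_rho 0 + dcc_rho * dcc_rho * e dcc_rho 1"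
      using rec(2)[OF q(1,2)] by (simp add: distrib_left)
    from solve[OF this k1] show ?thesis unfolding e10 rr by (simp add: field_simps ss sss)
  qed
  have e12: "e dcc_rho 2 = (15 - 3 * s) / 50"
  proof -
    have "e dcc_rho 2 = dcc_rho * dcc_rho * (2 * e dcc_rho 1 + e dcc_rho 0) + dcc_rho * dcc_rho * e dcc_rho 2"
      using rec(3)[OF q(1,2)] by (simp add: algebra_simps)
    from solve[OF this k1] show ?thesis unfolding e10 e11 rr by (simp add: field_simps ss sss)
  qed
  have e20: "e (dcc_rho\<^sup>2) 0 = (3 + s) / 8"
  proof -
    have "e (dcc_rho\<^sup>2) 0 = (1 - dcc_rho) + dcc_rho * dcc_rho\<^sup>2 * e (dcc_rho\<^sup>2) 0" using rec(1)[OF q(3,4)] .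
    from solve[OF this k2] show ?thesis unfolding r by (simp add: field_simps ss sss)
  qed
  have e21: "e (dcc_rho\<^sup>2) 1 = (s - 1) / 32"
  proof -
    have "e (dcc_rho\<^sup>2) 1 = dcc_rho * dcc_rho\<^sup>2 * e (dcc_rho\<^sup>2) 0 + dcc_rho * dcc_rho\<^sup>2 * e (dcc_rho\<^sup>2) 1"
      using rec(2)[OF q(3,4)] by (simp add: distrib_left)
    from solve[OF this k2] show ?thesis unfolding e20 r3 by (simp add: field_simps ss sss)
  qed
  show "measure_pmf.expectation dcc_height (\<lambda>i. real i) = (sqrt 5 - 1) / 2" using e01 by (simp add: e_def s_def)
  show "measure_pmf.expectation dcc_height (\<lambda>i. (real i)\<^sup>2) = (5 - sqrt 5) / 2" using e02 by (simp add: e_def s_def)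
  show "measure_pmf.expectation dcc_height (\<lambda>i. dcc_rho ^ i) = (5 + sqrt 5) / 10" using e10 by (simp add: e_def s_def)
  show "measure_pmf.expectation dcc_height (\<lambda>i. real i * dcc_rho ^ i) = (sqrt 5 - 1) / 10" using e11 by (simp add: e_def s_def)
  show "measure_pmf.expectation dcc_height (\<lambda>i. (real i)\<^sup>2 * dcc_rho ^ i) = (15 - 3 * sqrt 5) / 50" using e12 by (simp add: e_def s_def)
  show "measure_pmf.expectation dcc_height (\<lambda>i. (dcc_rho\<^sup>2) ^ i) = (3 + sqrt 5) / 8" using e20 by (simp add: e_def s_def)
  show "measure_pmf.expectation dcc_height (\<lambda>i. real i * (dcc_rho\<^sup>2) ^ i) = (sqrt 5 - 1) / 32" using e21 by (simp add: e_def s_def)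
qed

text \<open>
  All functions of \<open>u\<close> that occur in the variance of the perimeter are polynomials of degree at most 2 in
  \<open>i\<close> and in \<open>dcc_rho ^ i\<close>, so their expectations can be read off from their coefficients.
\<close>

lemma dcc_height_expectationI:
  fixes F :: "nat \<Rightarrow> real"
  assumes F: "\<And>i. F i = c0 + c1 * real i + c2 * (real i)\<^sup>2 + (c3 + c4 * real i + c5 * (real i)\<^sup>2) * dcc_rho ^ i
      + (c6 + c7 * real i) * (dcc_rho ^ i)\<^sup>2"
  shows "integrable (measure_pmf dcc_height) F"
    and "measure_pmf.expectation dcc_height F = c0 + c1 * ((sqrt 5 - 1) / 2) + c2 * ((5 - sqrt 5) / 2)
      + c3 * ((5 + sqrt 5) / 10) + c4 * ((sqrt 5 - 1) / 10) + c5 * ((15 - 3 * sqrt 5) / 50)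
      + c6 * ((3 + sqrt 5) / 8) + c7 * ((sqrt 5 - 1) / 32)"
proof -
  have q: "0 \<le> dcc_rho" "dcc_rho \<le> 1" "0 \<le> dcc_rho\<^sup>2" "dcc_rho\<^sup>2 \<le> 1"
    using dcc_rho_facts(1,3) power_le_one[of dcc_rho 2] by (simp_all only: less_imp_le zero_le_power2)
  note int = dcc_height_moment_integrable(1)
  have i: "integrable (measure_pmf dcc_height) (\<lambda>i. real i)" "integrable (measure_pmf dcc_height) (\<lambda>i. (real i)\<^sup>2)"
    "integrable (measure_pmf dcc_height) (\<lambda>i. dcc_rho ^ i)" "integrable (measure_pmf dcc_height) (\<lambda>i. real i * dcc_rho ^ i)"
    "integrable (measure_pmf dcc_height) (\<lambda>i. (real i)\<^sup>2 * dcc_rho ^ i)"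
    "integrable (measure_pmf dcc_height) (\<lambda>i. (dcc_rho\<^sup>2) ^ i)" "integrable (measure_pmf dcc_height) (\<lambda>i. real i * (dcc_rho\<^sup>2) ^ i)"
    using int[of 1 1] int[of 2 1] int[of 0 dcc_rho] int[of 1 dcc_rho] int[of 2 dcc_rho] int[of 0 "dcc_rho\<^sup>2"] int[of 1 "dcc_rho\<^sup>2"] q
    by simp_all
  have pw: "(dcc_rho\<^sup>2) ^ i = (dcc_rho ^ i)\<^sup>2" for i by (simp add: mult.commute flip: power_mult)
  have F': "F = (\<lambda>i. c0 + c1 * real i + c2 * (real i)\<^sup>2 + c3 * dcc_rho ^ i + c4 * (real i * dcc_rho ^ i)
      + c5 * ((real i)\<^sup>2 * dcc_rho ^ i) + c6 * (dcc_rho\<^sup>2) ^ i + c7 * (real i * (dcc_rho\<^sup>2) ^ i))"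
    by (simp add: fun_eq_iff F pw algebra_simps)
  show "integrable (measure_pmf dcc_height) F" unfolding F' using i by simp
  show "measure_pmf.expectation dcc_height F = c0 + c1 * ((sqrt 5 - 1) / 2) + c2 * ((5 - sqrt 5) / 2)
      + c3 * ((5 + sqrt 5) / 10) + c4 * ((sqrt 5 - 1) / 10) + c5 * ((15 - 3 * sqrt 5) / 50)
      + c6 * ((3 + sqrt 5) / 8) + c7 * ((sqrt 5 - 1) / 32)"
    unfolding F' using i by (simp add: dcc_height_moments)
qed

text \<open>
  The dependence on the second variable \<open>b = x - u\<close> is limited to the five functions \<open>1\<close>, \<open>b\<close>, \<open>b\<^sup>2\<close>,
  \<open>dcc_rho ^ b\<close> and \<open>b * dcc_rho ^ b\<close>.
\<close>

lemma dcc_pair_expectation: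
  fixes F0 F1 F2 F3 F4 :: "nat \<Rightarrow> real"
  assumes F: "integrable (measure_pmf dcc_height) F0" "integrable (measure_pmf dcc_height) F1"
      "integrable (measure_pmf dcc_height) F2" "integrable (measure_pmf dcc_height) F3" "integrable (measure_pmf dcc_height) F4"
    and K: "\<And>a b. K (a, b) = F0 a + F1 a * real b + F2 a * (real b)\<^sup>2 + F3 a * dcc_rho ^ b + F4 a * (real b * dcc_rho ^ b)"
  shows "measure_pmf.expectation (pair_pmf dcc_height dcc_height) K =
      measure_pmf.expectation dcc_height F0 + measure_pmf.expectation dcc_height F1 * ((sqrt 5 - 1) / 2)
      + measure_pmf.expectation dcc_height F2 * ((5 - sqrt 5) / 2)
      + measure_pmf.expectation dcc_height F3 * ((5 + sqrt 5) / 10)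
      + measure_pmf.expectation dcc_height F4 * ((sqrt 5 - 1) / 10)"
proof -
  define P where "P G H = (\<lambda>(a, b). G a * H b)" for G H :: "nat \<Rightarrow> real"
  have i: "integrable (measure_pmf dcc_height) (\<lambda>i. 1::real)" "integrable (measure_pmf dcc_height) (\<lambda>i. real i)"
    "integrable (measure_pmf dcc_height) (\<lambda>i. (real i)\<^sup>2)" "integrable (measure_pmf dcc_height) (\<lambda>i. dcc_rho ^ i)"
    "integrable (measure_pmf dcc_height) (\<lambda>i. real i * dcc_rho ^ i)"
    using dcc_height_moment_integrable(1)[of 0 1] dcc_height_moment_integrable(1)[of 1 1] dcc_height_moment_integrable(1)[of 2 1]
      dcc_height_moment_integrable(1)[of 0 dcc_rho] dcc_height_moment_integrable(1)[of 1 dcc_rho] dcc_rho_facts(1,3)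
    by simp_all
  note PI = pair_pmf_product(1)[where A = dcc_height and B = dcc_height, folded P_def]
  note PE = pair_pmf_product(2)[where A = dcc_height and B = dcc_height, folded P_def]
  have "K = (\<lambda>z. P F0 (\<lambda>_. 1) z + P F1 real z + P F2 (\<lambda>b. (real b)\<^sup>2) z + P F3 (\<lambda>b. dcc_rho ^ b) z
      + P F4 (\<lambda>b. real b * dcc_rho ^ b) z)"
    by (auto simp: fun_eq_iff K P_def)
  then show ?thesis
    using PI[OF F(1) i(1)] PI[OF F(2) i(2)] PI[OF F(3) i(3)] PI[OF F(4) i(4)] PI[OF F(5) i(5)]
    by (simp add: PE[OF F(1) i(1)] PE[OF F(2) i(2)] PE[OF F(3) i(3)] PE[OF F(4) i(4)] PE[OF F(5) i(5)] dcc_height_moments)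
qed

text \<open>
  The mean of \<open>\<bar>k - u\<bar>\<close> over the position \<open>u\<close> of a column (\<open>column_moments\<close>).
\<close>

definition mean_dist_to_position :: "nat \<Rightarrow> real" where
  "mean_dist_to_position k = real k - (1 + sqrt 5) / 2 + (1 + sqrt 5) * dcc_rho ^ k"

text \<open>
  The mean of \<open>\<bar>x - j\<bar>\<close> over the size \<open>x\<close> of a column (\<open>column_moments\<close>). The closed form also holds for
  \<open>j = 0\<close>, a position of probability zero for which the martingale property is nevertheless required.
\<close>

definition mean_dist_to_size :: "nat \<Rightarrow> real" where
  "mean_dist_to_size j = real j - sqrt 5 + 2 * dcc_rho ^ j * (real j + sqrt 5)"

lemma mean_dist_to_size_bound: "\<bar>mean_dist_to_size j\<bar> \<le> 10 * (1 + real j)"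
proof -
  have s: "0 < sqrt 5" "sqrt 5 < (2.237::real)"
    by (simp, rule real_less_lsqrt) (simp_all add: power2_eq_square)
  define t where "t = dcc_rho ^ j * (real j + sqrt 5)"
  have "t \<le> 1 * (real j + sqrt 5)" "0 \<le> t"
    unfolding t_def using dcc_rho_facts s by (intro mult_right_mono power_le_one mult_nonneg_nonneg; simp)+
  moreover have "mean_dist_to_size j = real j - sqrt 5 + 2 * t" by (simp add: mean_dist_to_size_def t_def)
  ultimately show ?thesis using s by (simp add: abs_le_iff)
qed

lemma expectation_abs_diff_height: "measure_pmf.expectation dcc_height (\<lambda>a. \<bar>real k - real (Suc a)\<bar>) = mean_dist_to_position k"
proof (induction k)
  case 0
  have "integrable (measure_pmf dcc_height) (\<lambda>i. real i)"
    by (rule dcc_height_integrable[where C = 1]) (simp add: self_le_power order_trans[OF _ self_le_power])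
  then show ?case using dcc_height_moments(1) by (simp add: mean_dist_to_position_def field_simps)
next
  case (Suc k)
  have b: "\<bar>real k - real n\<bar> \<le> (2 + real k) * (1 + real i) ^ 4" if "n \<le> Suc i" for n i
  proof -
    have "\<bar>real k - real n\<bar> \<le> (2 + real k) * (1 + real i)"
    proof -
      have "real n \<le> real i + 1" using that by simp
      moreover have "0 \<le> real k * real i" by simp
      moreover have "(2 + real k) * (1 + real i) = 2 + 2 * real i + real k + real k * real i" by (simp add: algebra_simps)
      ultimately show ?thesis unfolding abs_le_iff by linarith
    qed
    also have "\<dots> \<le> (2 + real k) * (1 + real i) ^ 4"
      by (intro mult_left_mono self_le_power) auto
    finally show ?thesis .
  qed
  have "measure_pmf.expectation dcc_height (\<lambda>a. \<bar>real k - real a\<bar>)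
    = (1 - dcc_rho) * \<bar>real k - real 0\<bar> + dcc_rho * measure_pmf.expectation dcc_height (\<lambda>a. \<bar>real k - real (Suc a)\<bar>)"
    by (rule dcc_height_expectation_Suc; rule dcc_height_integrable[where C = "2 + real k"]; unfold abs_abs; rule b; simp)
  also have "\<dots> = mean_dist_to_position (Suc k)"
  proof -
    define s :: real where "s = sqrt 5"
    have ss: "s * s = 5" by (simp add: s_def)
    have r: "dcc_rho = (3 - s) / 2" by (simp add: dcc_rho_def s_def)
    have "dcc_rho * ((1 + s) / 2) = (1 + s) / 2 - 1" unfolding r using ss by (simp add: field_simps)
    then show ?thesis unfolding Suc mean_dist_to_position_def by (simp add: s_def algebra_simps)
  qed
  finally show ?case by simp
qed

lemma dcc_height_pair_integrable:
  assumes "\<And>a b. \<bar>F (a, b)\<bar> \<le> C * ((1 + real a) ^ 4 * (1 + real b) ^ 4)"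
  shows "integrable (measure_pmf (pair_pmf dcc_height dcc_height)) (F :: nat \<times> nat \<Rightarrow> real)"
proof -
  have i: "integrable (measure_pmf dcc_height) (\<lambda>i. (1 + real i) ^ 4)"
    by (rule dcc_height_integrable[where C = 1]) simp
  have "integrable (measure_pmf (pair_pmf dcc_height dcc_height)) (\<lambda>z. C * (case z of (a, b) \<Rightarrow> (1 + real a) ^ 4 * (1 + real b) ^ 4))"
    using pair_pmf_product(1)[OF i i] by simp
  then show ?thesis
    by (rule Bochner_Integration.integrable_bound)
      (auto intro!: AE_I2 order_trans[OF assms abs_ge_self] simp: split_beta)
qed

lemma dcc_height_pair_Suc:
  fixes F :: "nat \<times> nat \<Rightarrow> real"
  assumes F: "integrable (measure_pmf (pair_pmf dcc_height dcc_height)) F"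
    and FS: "integrable (measure_pmf (pair_pmf dcc_height dcc_height)) (\<lambda>(a, b). F (Suc a, b))"
  shows "measure_pmf.expectation (pair_pmf dcc_height dcc_height) F
    = (1 - dcc_rho) * measure_pmf.expectation dcc_height (\<lambda>b. F (0, b))
      + dcc_rho * measure_pmf.expectation (pair_pmf dcc_height dcc_height) (\<lambda>(a, b). F (Suc a, b))"
proof -
  interpret pair_sigma_finite "measure_pmf dcc_height" "measure_pmf dcc_height" ..
  note F' = F[unfolded measure_pair_pmf] and FS' = FS[unfolded measure_pair_pmf]
  show ?thesis
    unfolding measure_pair_pmf integral_fst'[OF F', symmetric] integral_fst'[OF FS', symmetric]
    using dcc_height_expectation_Suc[OF integrable_fst'[OF F']] integrable_fst'[OF FS'] by simp
qed

text \<open>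
  Induction on \<open>j\<close>: if the first geometric variable is 0, the expectation is one over the second variable
  alone; otherwise it has been shifted by 1, which amounts to decreasing \<open>j\<close>.
\<close>

lemma expectation_abs_diff_pair:
  "measure_pmf.expectation (pair_pmf dcc_height dcc_height) (\<lambda>(a, b). \<bar>real (Suc (a + b)) - real j\<bar>) = mean_dist_to_size j"
proof (induction j)
  case 0
  have i: "integrable (measure_pmf dcc_height) (\<lambda>i. real i)" "integrable (measure_pmf dcc_height) (\<lambda>i. 1::real)"
    by (rule dcc_height_integrable[where C = 1]; simp add: self_le_power order_trans[OF _ self_le_power])+
  have "(\<lambda>(a, b). \<bar>real (Suc (a + b)) - real 0\<bar>)
    = (\<lambda>z. (case z of (a, b) \<Rightarrow> real a * 1) + (case z of (a, b) \<Rightarrow> 1 * real b) + 1)"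
    by (auto simp: fun_eq_iff)
  then show ?case
    using pair_pmf_product[OF i] pair_pmf_product[OF i(2,1)] dcc_height_moments(1)
    by (simp add: mean_dist_to_size_def field_simps)
next
  case (Suc j)
  have b: "\<bar>real n - real j\<bar> \<le> (1 + real j) * ((1 + real a) ^ 4 * (1 + real b) ^ 4)" if "n \<le> Suc (a + b)" for n a b
  proof -
    have "\<bar>real n - real j\<bar> \<le> (1 + real j) * ((1 + real a) * (1 + real b))"
    proof -
      have "1 + real a + real b \<le> (1 + real a) * (1 + real b)" by (simp add: algebra_simps)
      then have "real n \<le> (1 + real a) * (1 + real b)" using that by simp
      moreover have "1 \<le> (1 + real a) * (1 + real b)" by (simp add: algebra_simps)
      then have "real j \<le> real j * ((1 + real a) * (1 + real b))" by (simp add: mult_le_cancel_left1)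
      moreover have "0 \<le> (1 + real a) * (1 + real b)" by simp
      ultimately show ?thesis unfolding distrib_right[of 1 "real j"] by linarith
    qed
    also have "\<dots> \<le> (1 + real j) * ((1 + real a) ^ 4 * (1 + real b) ^ 4)"
      by (intro mult_left_mono mult_mono self_le_power) auto
    finally show ?thesis .
  qed
  have "measure_pmf.expectation (pair_pmf dcc_height dcc_height) (\<lambda>(a, b). \<bar>real (a + b) - real j\<bar>)
    = (1 - dcc_rho) * measure_pmf.expectation dcc_height (\<lambda>b. \<bar>real b - real j\<bar>)
      + dcc_rho * measure_pmf.expectation (pair_pmf dcc_height dcc_height) (\<lambda>(a, b). \<bar>real (Suc (a + b)) - real j\<bar>)"
  proof -
    have "integrable (measure_pmf (pair_pmf dcc_height dcc_height)) (\<lambda>(a, b). \<bar>real (a + b) - real j\<bar>)"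
      by (rule dcc_height_pair_integrable[where C = "1 + real j"], unfold prod.case abs_abs, rule b) simp
    moreover have "integrable (measure_pmf (pair_pmf dcc_height dcc_height)) (\<lambda>(a, b). \<bar>real (Suc (a + b)) - real j\<bar>)"
      by (rule dcc_height_pair_integrable[where C = "1 + real j"], unfold prod.case abs_abs, rule b) simp
    ultimately show ?thesis
      using dcc_height_pair_Suc[of "\<lambda>(a, b). \<bar>real (a + b) - real j\<bar>"] by (simp add: add.assoc)
  qed
  also have "measure_pmf.expectation dcc_height (\<lambda>b. \<bar>real b - real j\<bar>) = mean_dist_to_position (Suc j)"
    using expectation_abs_diff_height[of "Suc j"] by (simp add: abs_minus_commute)
  also have "(1 - dcc_rho) * mean_dist_to_position (Suc j) + dcc_rho * measure_pmf.expectation (pair_pmf dcc_height dcc_height) (\<lambda>(a, b). \<bar>real (Suc (a + b)) - real j\<bar>)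
    = mean_dist_to_size (Suc j)"
  proof -
    define s :: real where "s = sqrt 5"
    have ss: "s * s = 5" by (simp add: s_def)
    have r: "dcc_rho = (3 - s) / 2" by (simp add: dcc_rho_def s_def)
    have r1: "(1 - dcc_rho) * (1 + s) = 2" "(1 - dcc_rho) * (real (Suc j) - (1 + s) / 2) + dcc_rho * (real j - s) = real (Suc j) - s"
      unfolding r using ss by (simp_all add: field_simps)
    have r2: "2 + 2 * (real j + s) = 2 * (real (Suc j) + s)" by simp
    have "(1 - dcc_rho) * mean_dist_to_position (Suc j) + dcc_rho * mean_dist_to_size j =
      ((1 - dcc_rho) * (real (Suc j) - (1 + s) / 2) + dcc_rho * (real j - s))
      + (((1 - dcc_rho) * (1 + s)) + 2 * (real j + s)) * dcc_rho ^ Suc j"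
      unfolding mean_dist_to_position_def mean_dist_to_size_def s_def[symmetric] by (simp add: algebra_simps)
    also have "\<dots> = mean_dist_to_size (Suc j)"
      unfolding r1 r2 mean_dist_to_size_def s_def[symmetric] by (simp add: algebra_simps)
    finally show ?thesis unfolding Suc .
  qed
  finally show ?case by simp
qed

context dcc_columns
begin

text \<open>
  The bound \<open>B\<close> is the fourth moment under the common law of all columns, hence the same for every \<open>d\<close>.
\<close>

lemma fourth_moment_col:
  fixes K :: "nat \<times> nat \<Rightarrow> real"
  assumes K: "\<And>a b. \<bar>K (a + 1, a + b + 1)\<bar> \<le> C * (1 + real a + real b)"
  obtains B where "\<And>d. fourth_moment_le B (\<lambda>\<omega>. K (col d \<omega>))"
proof -
  have b: "\<bar>(case (a, b) of (a, b) \<Rightarrow> K (a + 1, a + b + 1) ^ 4)\<bar> \<le> C ^ 4 * ((1 + real a) ^ 4 * (1 + real b) ^ 4)" for a b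
  proof -
    have C: "0 \<le> C" using order_trans[OF abs_ge_zero K[of 0 0]] by simp
    have "\<bar>K (a + 1, a + b + 1)\<bar> \<le> C * ((1 + real a) * (1 + real b))"
      by (rule order_trans[OF K mult_left_mono[OF _ C]]) (simp add: algebra_simps)
    then have "\<bar>K (a + 1, a + b + 1)\<bar> ^ 4 \<le> (C * ((1 + real a) * (1 + real b))) ^ 4"
      by (intro power_mono) auto
    then show ?thesis by (simp add: power_mult_distrib power_abs)
  qed
  have "fourth_moment_le (measure_pmf.expectation (pair_pmf dcc_height dcc_height) (\<lambda>(a, b). K (a + 1, a + b + 1) ^ 4)) (\<lambda>\<omega>. K (col d \<omega>))" for d
    unfolding fourth_moment_le_def
    using expectation_col[of "\<lambda>c. K c ^ 4" d] dcc_height_pair_integrable[of "\<lambda>(a, b). K (a + 1, a + b + 1) ^ 4", OF b]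
    by simp
  then show ?thesis using that by blast
qed

lemma column_moments:
  shows "expectation (\<lambda>\<omega>. real (x d \<omega>)) = sqrt 5"
    and "expectation (\<lambda>\<omega>. real (u d \<omega>)) = (1 + sqrt 5) / 2"
    and "expectation (\<lambda>\<omega>. \<bar>real (x d \<omega>) - real j\<bar>) = mean_dist_to_size j"
    and "expectation (\<lambda>\<omega>. \<bar>real k - real (u d \<omega>)\<bar>) = mean_dist_to_position k"
proof -
  have i1: "integrable (measure_pmf dcc_height) (\<lambda>i. 1::real)"
    by (rule dcc_height_integrable[where C = 1]) simp
  have fst: "expectation (\<lambda>\<omega>. F (u d \<omega>)) = measure_pmf.expectation dcc_height (\<lambda>a. F (Suc a))"
    if "integrable (measure_pmf dcc_height) (\<lambda>a. F (Suc a))" for F :: "nat \<Rightarrow> real"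
    using expectation_col(1)[of "\<lambda>c. F (fst c)" d] pair_pmf_product(2)[OF that i1]
    by (simp add: col_def)
  show phi: "expectation (\<lambda>\<omega>. \<bar>real (x d \<omega>) - real j\<bar>) = mean_dist_to_size j" for j
    using expectation_col(1)[of "\<lambda>c. \<bar>real (snd c) - real j\<bar>" d] expectation_abs_diff_pair[of j]
    by (simp add: col_def add.assoc)
  show "expectation (\<lambda>\<omega>. real (x d \<omega>)) = sqrt 5" using phi[of 0] by (simp add: mean_dist_to_size_def)
  have bound: "\<bar>\<bar>real k - real (Suc i)\<bar>\<bar> \<le> (1 + real k) * (1 + real i) ^ 4" for k i
  proof -
    have "\<bar>real k - real (Suc i)\<bar> \<le> (1 + real k) * (1 + real i)"
    proof -
      have "0 \<le> real k * real i" by simp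
      moreover have "(1 + real k) * (1 + real i) = 1 + real i + real k + real k * real i" by (simp add: algebra_simps)
      ultimately show ?thesis unfolding abs_le_iff by simp
    qed
    also have "\<dots> \<le> (1 + real k) * (1 + real i) ^ 4" by (intro mult_left_mono self_le_power) auto
    finally show ?thesis by simp
  qed
  show psi: "expectation (\<lambda>\<omega>. \<bar>real k - real (u d \<omega>)\<bar>) = mean_dist_to_position k" for k
    using fst[of "\<lambda>j. \<bar>real k - real j\<bar>", OF dcc_height_integrable[OF bound]]
    unfolding expectation_abs_diff_height .
  show "expectation (\<lambda>\<omega>. real (u d \<omega>)) = (1 + sqrt 5) / 2" using psi[of 0] by (simp add: mean_dist_to_position_def field_simps)
qed

lemma fourth_moment_size: obtains B where "\<And>d. fourth_moment_le B (\<lambda>\<omega>. real (x d \<omega>))"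
proof -
  obtain B where "\<And>d. fourth_moment_le B (\<lambda>\<omega>. real (snd (col d \<omega>)))"
    using fourth_moment_col[of "\<lambda>c. real (snd c)" 1] by force
  then show ?thesis by (intro that[of B]) (simp add: col_def)
qed

lemma fourth_moment_u: obtains B where "\<And>d. fourth_moment_le B (\<lambda>\<omega>. real (u d \<omega>))"
proof -
  obtain B where "\<And>d. fourth_moment_le B (\<lambda>\<omega>. real (fst (col d \<omega>)))"
    using fourth_moment_col[of "\<lambda>c. real (fst c)" 1] by force
  then show ?thesis by (intro that[of B]) (simp add: col_def)
qed

lemma fourth_moment_dist_to_size: obtains B where "\<And>d. fourth_moment_le B (\<lambda>\<omega>. mean_dist_to_size (u d \<omega>))"
proof -
  have "\<bar>mean_dist_to_size (a + 1)\<bar> \<le> 20 * (1 + real a + real b)" for a b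
    using mean_dist_to_size_bound[of "a + 1"] by simp
  then obtain B where "\<And>d. fourth_moment_le B (\<lambda>\<omega>. mean_dist_to_size (fst (col d \<omega>)))"
    using fourth_moment_col[of "\<lambda>c. mean_dist_to_size (fst c)" 20] by force
  then show ?thesis by (intro that[of B]) (simp add: col_def)
qed

lemma fourth_moment_dist_to_position: obtains B where "\<And>d. fourth_moment_le B (\<lambda>\<omega>. mean_dist_to_position (x d \<omega>))"
proof -
  have "\<bar>mean_dist_to_position (a + b + 1)\<bar> \<le> 10 * (1 + real a + real b)" for a b
  proof -
    have s: "0 < sqrt 5" "sqrt 5 < (3::real)"
      by (simp, rule real_less_lsqrt) (simp_all add: power2_eq_square)
    define t where "t = (1 + sqrt 5) * dcc_rho ^ (a + b + 1)"
    have "t \<le> (1 + sqrt 5) * 1" "0 \<le> t"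
      unfolding t_def using dcc_rho_facts s by (intro mult_left_mono power_le_one mult_nonneg_nonneg; simp)+
    moreover have "\<bar>1 + A + B - (1 + q) / 2 + t\<bar> \<le> 10 * (1 + A + B)"
      if "t \<le> (1 + q) * 1" "0 \<le> t" "0 \<le> A" "0 \<le> B" "0 < q" "q < 3" for t A B q :: real
      using that by (simp add: abs_le_iff field_simps)
    ultimately have "\<bar>1 + real a + real b - (1 + sqrt 5) / 2 + t\<bar> \<le> 10 * (1 + real a + real b)" using s by simp
    then show ?thesis by (simp add: mean_dist_to_position_def t_def)
  qed
  then obtain B where "\<And>d. fourth_moment_le B (\<lambda>\<omega>. mean_dist_to_position (snd (col d \<omega>)))"
    using fourth_moment_col[of "\<lambda>c. mean_dist_to_position (snd c)" 10] by force
  then show ?thesis by (intro that[of B]) (simp add: col_def)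
qed

lemma size_variance: "expectation (\<lambda>\<omega>. (real (x d \<omega>) - sqrt 5)\<^sup>2) = 2"
proof -
  define s :: real where "s = sqrt 5"
  have ss: "s * s = 5" by (simp add: s_def)
  then have sss: "s * (s * y) = 5 * y" for y by (simp flip: mult.assoc)
  define F0 where "F0 a = (real a + 1 - s)\<^sup>2" for a
  define F1 where "F1 a = 2 * (real a + 1 - s)" for a
  define F2 :: "nat \<Rightarrow> real" where "F2 a = 1" for a
  define Z :: "nat \<Rightarrow> real" where "Z a = 0" for a
  note E0 = dcc_height_expectationI[of F0 "(1 - s)\<^sup>2" "2 * (1 - s)" 1 0 0 0 0 0]
  note E1 = dcc_height_expectationI[of F1 "2 * (1 - s)" 2 0 0 0 0 0 0]
  note E2 = dcc_height_expectationI[of F2 1 0 0 0 0 0 0 0]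
  note EZ = dcc_height_expectationI[of Z 0 0 0 0 0 0 0 0]
  have 0: "F0 i = (1 - s)\<^sup>2 + 2 * (1 - s) * real i + 1 * (real i)\<^sup>2 + (0 + 0 * real i + 0 * (real i)\<^sup>2) * dcc_rho ^ i + (0 + 0 * real i) * (dcc_rho ^ i)\<^sup>2" for i
    by (simp add: F0_def power2_eq_square algebra_simps)
  have 1: "F1 i = 2 * (1 - s) + 2 * real i + 0 * (real i)\<^sup>2 + (0 + 0 * real i + 0 * (real i)\<^sup>2) * dcc_rho ^ i + (0 + 0 * real i) * (dcc_rho ^ i)\<^sup>2" for i
    by (simp add: F1_def algebra_simps)
  have "expectation (\<lambda>\<omega>. (real (x d \<omega>) - s)\<^sup>2)
    = measure_pmf.expectation (pair_pmf dcc_height dcc_height) (\<lambda>(a, b). (real (a + b + 1) - s)\<^sup>2)"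
    using expectation_col(1)[of "\<lambda>z. (real (snd z) - s)\<^sup>2" d] by (simp add: col_def)
  also have "\<dots> = measure_pmf.expectation dcc_height F0 + measure_pmf.expectation dcc_height F1 * ((s - 1) / 2)
      + measure_pmf.expectation dcc_height F2 * ((5 - s) / 2)
      + measure_pmf.expectation dcc_height Z * ((5 + s) / 10) + measure_pmf.expectation dcc_height Z * ((s - 1) / 10)"
    unfolding s_def
    by (rule dcc_pair_expectation[OF E0(1)[OF 0] E1(1)[OF 1] E2(1) EZ(1) EZ(1)])
      (simp_all add: F0_def F1_def F2_def Z_def s_def power2_eq_square algebra_simps)
  also have "\<dots> = 2"
  proof -
    have "measure_pmf.expectation dcc_height F2 = 1" "measure_pmf.expectation dcc_height Z = 0"
      by (simp_all add: F2_def[abs_def] Z_def[abs_def])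
    then show ?thesis
      unfolding E0(2)[OF 0] E1(2)[OF 1] unfolding s_def[symmetric] by (simp add: power2_eq_square field_simps ss sss)
  qed
  finally show ?thesis by (simp add: s_def)
qed

section \<open>Area and perimeter\<close>

theorem area_invariance_principle:
  assumes B: "standard_brownian_motion N B"
  shows "converges_in_distribution skorokhod_topology M
      (\<lambda>\<nu>::real. sample_path (\<lambda>t \<omega>.
         (real (dcc_area x (nat \<lfloor>\<nu> * t\<rfloor>) \<omega>) - sqrt 5 * \<nu> * t) / (sqrt \<nu> * sqrt 2)))
      at_top N (sample_path B)"
proof -
  define f :: "nat \<times> nat \<Rightarrow> nat \<times> nat \<Rightarrow> real" where "f q c = real (snd c) - sqrt 5" for q c
  obtain K where K: "\<And>d. fourth_moment_le K (\<lambda>\<omega>. real (x d \<omega>))" using fourth_moment_size by blast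
  have L: "fourth_moment_le (8 * (K + sqrt 5 ^ 4)) (\<lambda>\<omega>. f q (col d \<omega>))" for q d
    using fourth_moment_le_diff[OF K[of d] fourth_moment_le_const] by (simp add: f_def col_def)
  interpret A: one_dependent_martingale M col f "8 * (K + sqrt 5 ^ 4)" "sqrt 2"
  proof
    fix d :: nat and q
    show "integrable M (\<lambda>\<omega>. f q (col (Suc d) \<omega>))" by (rule fourth_moment_le_integrable[OF L])
    show "expectation (\<lambda>\<omega>. f q (col (Suc d) \<omega>)) = 0"
      using column_moments(1)[of "Suc d"] fourth_moment_le_integrable[OF K] by (simp add: f_def col_def prob_space)
    have f: "f (col d \<omega>) = f (0, 0)" for \<omega> by (simp add: f_def fun_eq_iff)
    show "integrable M (\<lambda>\<omega>. f (col d \<omega>) (col (Suc d) \<omega>) ^ 4)"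
      "expectation (\<lambda>\<omega>. f (col d \<omega>) (col (Suc d) \<omega>) ^ 4) \<le> 8 * (K + sqrt 5 ^ 4)"
      using L[of "(0, 0)" "Suc d"] by (simp_all add: f fourth_moment_le_def)
    show "expectation (\<lambda>\<omega>. (f (col d \<omega>) (col (Suc d) \<omega>))\<^sup>2) = (sqrt 2)\<^sup>2"
      using size_variance[of "Suc d"] by (simp add: f_def col_def)
  qed simp
  have "converges_in_distribution skorokhod_topology M
      (\<lambda>\<nu>. sample_path (A.rescaled (\<lambda>_ _. 0) (sqrt 5) \<nu>)) at_top N (sample_path B)"
    by (rule A.invariance_principle[where \<kappa>R = 0, OF _ _ _ B]) (auto intro: determined_const)
  moreover have "A.rescaled (\<lambda>_ _. 0) (sqrt 5) \<nu> = (\<lambda>t \<omega>. (real (dcc_area x (nat \<lfloor>\<nu> * t\<rfloor>) \<omega>) - sqrt 5 * \<nu> * t) / (sqrt \<nu> * sqrt 2))" for \<nu>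
  proof (intro ext)
    fix t \<omega>
    have S: "A.S 0 n \<omega> = real (dcc_area x n \<omega>) - sqrt 5 * real n" for n
      by (simp add: A.S_def A.D_def f_def col_def dcc_area_def sum_subtractf atLeastSucAtMost_greaterThanAtMost flip: One_nat_def)
        (simp add: atLeastSucAtMost_greaterThanAtMost)
    show "A.rescaled (\<lambda>_ _. 0) (sqrt 5) \<nu> t \<omega> = (real (dcc_area x (nat \<lfloor>\<nu> * t\<rfloor>) \<omega>) - sqrt 5 * \<nu> * t) / (sqrt \<nu> * sqrt 2)"
      unfolding A.rescaled_def S by (simp add: algebra_simps)
  qed
  ultimately show ?thesis by simp
qed

text \<open>
  The martingale increment of the perimeter: the contribution \<open>T\<close> of the column \<open>c\<close> after the column \<open>q\<close>,
  centred, and corrected by the difference of the conditional means of the next and of the present \<open>\<bar>w\<bar>\<close>.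
\<close>

definition perimeter_increment :: "nat \<times> nat \<Rightarrow> nat \<times> nat \<Rightarrow> real" where
  "perimeter_increment q c = \<bar>real (snd c) - real (fst q)\<bar> + (real (snd c) - real (fst c))
    + mean_dist_to_size (fst c) - mean_dist_to_size (fst q) - (6 * sqrt 5 - 4) / 5"

lemma expectation_mean_dist_to_size: "expectation (\<lambda>\<omega>. mean_dist_to_size (u d \<omega>)) = (6 * sqrt 5 - 4) / 5 - (sqrt 5 - 1) / 2"
proof -
  define s :: real where "s = sqrt 5"
  have ss: "s * s = 5" by (simp add: s_def)
  then have sss: "s * (s * y) = 5 * y" for y by (simp flip: mult.assoc)
  have r: "dcc_rho = (3 - s) / 2" by (simp add: dcc_rho_def s_def)
  let ?F = "\<lambda>a. mean_dist_to_size (a + 1)"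
  have F: "?F i = (1 - s) + 1 * real i + 0 * (real i)\<^sup>2 + (2 * dcc_rho * (1 + s) + 2 * dcc_rho * real i + 0 * (real i)\<^sup>2) * dcc_rho ^ i
    + (0 + 0 * real i) * (dcc_rho ^ i)\<^sup>2" for i
    by (simp add: mean_dist_to_size_def s_def algebra_simps)
  have i1: "integrable (measure_pmf dcc_height) (\<lambda>i. 1::real)"
    by (rule dcc_height_integrable[where C = 1]) simp
  have "expectation (\<lambda>\<omega>. mean_dist_to_size (u d \<omega>)) = measure_pmf.expectation dcc_height ?F"
    using expectation_col(1)[of "\<lambda>c. mean_dist_to_size (fst c)" d] pair_pmf_product(2)[OF dcc_height_expectationI(1)[OF F] i1]
    by (simp add: col_def)
  also have "\<dots> = (6 * s - 4) / 5 - (s - 1) / 2"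
    unfolding dcc_height_expectationI(2)[OF F] unfolding s_def[symmetric] r by (simp add: field_simps ss sss)
  finally show ?thesis by (simp add: s_def)
qed

text \<open>
  The variance of a perimeter increment after the previous column has been integrated out, so that a single
  column \<open>(u, x)\<close> remains; the last summand on the right is the cross term \<open>2 * E x * E u\<close>. In \<open>a = u - 1\<close>
  and \<open>b = x - u\<close> the integrand is a combination of the five functions of \<open>b\<close> admitted by
  \<open>dcc_pair_expectation\<close>, with coefficients \<open>F0\<close> to \<open>F4\<close> of the form required by
  \<open>dcc_height_expectationI\<close>; the squares of \<open>mean_dist_to_size u\<close> cancel.
\<close>

lemma perimeter_quadratic_expectation:
  defines "\<mu> \<equiv> (6 * sqrt 5 - 4) / 5"
  shows "expectation (\<lambda>\<omega>. (real (x d \<omega>))\<^sup>2 + (real (u d \<omega>))\<^sup>2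
      + 2 * (mean_dist_to_position (x d \<omega>) * (real (x d \<omega>) - real (u d \<omega>) + mean_dist_to_size (u d \<omega>) - \<mu>))
      + (real (x d \<omega>) - real (u d \<omega>) + mean_dist_to_size (u d \<omega>) - \<mu>)\<^sup>2 - (mean_dist_to_size (u d \<omega>))\<^sup>2)
    = 229 / 50 + sqrt 5 / 25 + 2 * sqrt 5 * ((1 + sqrt 5) / 2)"
proof -
  define s :: real where "s = sqrt 5"
  have ss: "s * s = 5" by (simp add: s_def)
  then have sss: "s * (s * y) = 5 * y" for y by (simp flip: mult.assoc)
  have r: "dcc_rho = (3 - s) / 2" by (simp add: dcc_rho_def s_def)
  define A where "A = (1 + s) / 2"
  define p0 where "p0 = 1 - s"
  define q0 where "q0 = 2 * dcc_rho * (1 + s)"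
  define q1 where "q1 = 2 * dcc_rho"
  define K :: "nat \<times> nat \<Rightarrow> real" where
    "K c = (real (snd c))\<^sup>2 + (real (fst c))\<^sup>2 + 2 * (mean_dist_to_position (snd c) * (real (snd c) - real (fst c) + mean_dist_to_size (fst c) - \<mu>))
      + (real (snd c) - real (fst c) + mean_dist_to_size (fst c) - \<mu>)\<^sup>2 - (mean_dist_to_size (fst c))\<^sup>2" for c
  define \<phi> where "\<phi> a = p0 + real a + (q0 + q1 * real a) * dcc_rho ^ a" for a
  have phi: "mean_dist_to_size (Suc a) = \<phi> a" for a
    by (simp add: \<phi>_def mean_dist_to_size_def p0_def q0_def q1_def s_def algebra_simps)
  have psi: "mean_dist_to_position (Suc (a + b)) = 1 + real a + real b - A + 2 * A * (dcc_rho * dcc_rho ^ a * dcc_rho ^ b)" for a b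
    by (simp add: mean_dist_to_position_def A_def s_def power_add)
  define F0 where "F0 a = 2 * (real a + 1)\<^sup>2 + 2 * (real a + 1 - A) * (\<phi> a - \<mu>) - 2 * \<mu> * \<phi> a + \<mu>\<^sup>2" for a
  define F1 where "F1 a = 4 * (real a + 1) - 2 * A + 4 * (\<phi> a - \<mu>)" for a
  define F2 :: "nat \<Rightarrow> real" where "F2 a = 4" for a
  define F3 where "F3 a = 4 * A * dcc_rho * dcc_rho ^ a * (\<phi> a - \<mu>)" for a
  define F4 where "F4 a = 4 * A * dcc_rho * dcc_rho ^ a" for a
  have 0: "F0 i = (2 + 2 * (1 - A) * (p0 - \<mu>) - 2 * \<mu> * p0 + \<mu>\<^sup>2) + (4 + 2 * (p0 - \<mu>) + 2 * (1 - A) - 2 * \<mu>) * real i + 4 * (real i)\<^sup>2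
    + ((2 * (1 - A) * q0 - 2 * \<mu> * q0) + (2 * q0 + 2 * (1 - A) * q1 - 2 * \<mu> * q1) * real i + 2 * q1 * (real i)\<^sup>2) * dcc_rho ^ i
    + (0 + 0 * real i) * (dcc_rho ^ i)\<^sup>2" for i
    by (simp add: F0_def \<phi>_def power2_eq_square algebra_simps)
  have 1: "F1 i = (4 - 2 * A + 4 * (p0 - \<mu>)) + 8 * real i + 0 * (real i)\<^sup>2
    + (4 * q0 + 4 * q1 * real i + 0 * (real i)\<^sup>2) * dcc_rho ^ i + (0 + 0 * real i) * (dcc_rho ^ i)\<^sup>2" for i
    by (simp add: F1_def \<phi>_def algebra_simps)
  have 2: "F2 i = 4 + 0 * real i + 0 * (real i)\<^sup>2
    + (0 + 0 * real i + 0 * (real i)\<^sup>2) * dcc_rho ^ i + (0 + 0 * real i) * (dcc_rho ^ i)\<^sup>2" for i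
    by (simp add: F2_def)
  have 3: "F3 i = 0 + 0 * real i + 0 * (real i)\<^sup>2
    + (4 * A * dcc_rho * (p0 - \<mu>) + 4 * A * dcc_rho * real i + 0 * (real i)\<^sup>2) * dcc_rho ^ i
    + (4 * A * dcc_rho * q0 + 4 * A * dcc_rho * q1 * real i) * (dcc_rho ^ i)\<^sup>2" for i
    by (simp add: F3_def \<phi>_def power2_eq_square algebra_simps)
  have 4: "F4 i = 0 + 0 * real i + 0 * (real i)\<^sup>2
    + (4 * A * dcc_rho + 0 * real i + 0 * (real i)\<^sup>2) * dcc_rho ^ i + (0 + 0 * real i) * (dcc_rho ^ i)\<^sup>2" for i
    by (simp add: F4_def)
  note E0 = dcc_height_expectationI[OF 0] and E1 = dcc_height_expectationI[OF 1] and E2 = dcc_height_expectationI[OF 2]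
    and E3 = dcc_height_expectationI[OF 3] and E4 = dcc_height_expectationI[OF 4]
  have "expectation (\<lambda>\<omega>. K (col d \<omega>)) = measure_pmf.expectation (pair_pmf dcc_height dcc_height) (\<lambda>(a, b). K (a + 1, a + b + 1))"
    by (rule expectation_col(1))
  also have "\<dots> = measure_pmf.expectation dcc_height F0 + measure_pmf.expectation dcc_height F1 * ((sqrt 5 - 1) / 2)
      + measure_pmf.expectation dcc_height F2 * ((5 - sqrt 5) / 2)
      + measure_pmf.expectation dcc_height F3 * ((5 + sqrt 5) / 10) + measure_pmf.expectation dcc_height F4 * ((sqrt 5 - 1) / 10)"
  proof (rule dcc_pair_expectation[OF E0(1) E1(1) E2(1) E3(1) E4(1)])
    fix a b
    define R where "R = dcc_rho ^ a"
    define T where "T = dcc_rho ^ b"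
    define y where "y = \<phi> a"
    show "(case (a, b) of (a, b) \<Rightarrow> K (a + 1, a + b + 1)) = F0 a + F1 a * real b + F2 a * (real b)\<^sup>2 + F3 a * dcc_rho ^ b + F4 a * (real b * dcc_rho ^ b)"
      unfolding F0_def F1_def F2_def F3_def F4_def K_def prod.case fst_conv snd_conv Suc_eq_plus1[symmetric] phi psi
        R_def[symmetric] T_def[symmetric] y_def[symmetric]
      by (simp add: power2_eq_square algebra_simps)
  qed
  also have "\<dots> = 229 / 50 + s / 25 + 2 * s * ((1 + s) / 2)"
    unfolding E0(2) E1(2) E2(2) E3(2) E4(2)
    unfolding p0_def q0_def q1_def A_def \<mu>_def s_def[symmetric] r
    by (simp add: power2_eq_square field_simps ss sss)
  finally show ?thesis by (simp add: K_def col_def s_def)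
qed

text \<open>
  The increment is \<open>W + G - H\<close> with \<open>W = \<bar>x (d + 1) - u d\<bar>\<close>, where \<open>G\<close> depends on column \<open>d + 1\<close> and has mean
  zero, and \<open>H\<close> depends on column \<open>d\<close>. In the mixed moments of \<open>W\<close> one of the two columns is integrated
  out first, which replaces \<open>W\<close> by \<open>mean_dist_to_position (x (d + 1))\<close> or by \<open>H\<close>.
\<close>

lemma perimeter_increment_variance:
  "expectation (\<lambda>\<omega>. (perimeter_increment (col d \<omega>) (col (Suc d) \<omega>))\<^sup>2) = 229 / 50 + sqrt 5 / 25"
proof -
  define \<mu> :: real where "\<mu> = (6 * sqrt 5 - 4) / 5"
  define X where "X \<omega> = real (x (Suc d) \<omega>)" for \<omega>
  define U where "U \<omega> = real (u (Suc d) \<omega>)" for \<omega>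
  define V where "V \<omega> = real (u d \<omega>)" for \<omega>
  define W where "W \<omega> = \<bar>X \<omega> - V \<omega>\<bar>" for \<omega>
  define G where "G \<omega> = X \<omega> - U \<omega> + mean_dist_to_size (u (Suc d) \<omega>) - \<mu>" for \<omega>
  define H where "H \<omega> = mean_dist_to_size (u d \<omega>)" for \<omega>
  define \<Psi> where "\<Psi> \<omega> = mean_dist_to_position (x (Suc d) \<omega>)" for \<omega>
  obtain Kx Ku Kp Ks where L: "\<And>d. fourth_moment_le Kx (\<lambda>\<omega>. real (x d \<omega>))" "\<And>d. fourth_moment_le Ku (\<lambda>\<omega>. real (u d \<omega>))"
    "\<And>d. fourth_moment_le Kp (\<lambda>\<omega>. mean_dist_to_size (u d \<omega>))" "\<And>d. fourth_moment_le Ks (\<lambda>\<omega>. mean_dist_to_position (x d \<omega>))"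
    using fourth_moment_size fourth_moment_u fourth_moment_dist_to_size fourth_moment_dist_to_position by metis
  have LX: "fourth_moment_le Kx X" and LU: "fourth_moment_le Ku U" and LV: "fourth_moment_le Ku V" and LH: "fourth_moment_le Kp H" and L\<Psi>: "fourth_moment_le Ks \<Psi>"
    unfolding X_def U_def V_def H_def \<Psi>_def by (rule L)+
  obtain Kw where LW: "fourth_moment_le Kw W" unfolding W_def using fourth_moment_le_abs[OF fourth_moment_le_diff[OF LX LV]] by blast
  obtain Kg where LG: "fourth_moment_le Kg G"
    unfolding G_def using fourth_moment_le_diff[OF fourth_moment_le_add[OF fourth_moment_le_diff[OF LX LU] L(3)] fourth_moment_le_const] by blast
  have i: "integrable M (\<lambda>\<omega>. X \<omega> * X \<omega>)" "integrable M (\<lambda>\<omega>. X \<omega> * V \<omega>)" "integrable M (\<lambda>\<omega>. V \<omega> * V \<omega>)"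
    "integrable M (\<lambda>\<omega>. W \<omega> * G \<omega>)" "integrable M (\<lambda>\<omega>. G \<omega> * G \<omega>)" "integrable M (\<lambda>\<omega>. W \<omega> * H \<omega>)"
    "integrable M (\<lambda>\<omega>. G \<omega> * H \<omega>)" "integrable M (\<lambda>\<omega>. H \<omega> * H \<omega>)" "integrable M (\<lambda>\<omega>. U \<omega> * U \<omega>)"
    "integrable M (\<lambda>\<omega>. \<Psi> \<omega> * G \<omega>)" "integrable M (\<lambda>\<omega>. mean_dist_to_size (u (Suc d) \<omega>) * mean_dist_to_size (u (Suc d) \<omega>))"
    by (rule fourth_moment_le_mult_integrable[OF LX LX] fourth_moment_le_mult_integrable[OF LX LV] fourth_moment_le_mult_integrable[OF LV LV]
      fourth_moment_le_mult_integrable[OF LW LG] fourth_moment_le_mult_integrable[OF LG LG] fourth_moment_le_mult_integrable[OF LW LH] fourth_moment_le_mult_integrable[OF LG LH]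
      fourth_moment_le_mult_integrable[OF LH LH] fourth_moment_le_mult_integrable[OF LU LU] fourth_moment_le_mult_integrable[OF L\<Psi> LG] fourth_moment_le_mult_integrable[OF L(3) L(3)])+
  have i1: "integrable M X" "integrable M V" "integrable M U" "integrable M G" "integrable M H"
    by (rule fourth_moment_le_integrable[OF LX] fourth_moment_le_integrable[OF LV] fourth_moment_le_integrable[OF LU] fourth_moment_le_integrable[OF LG] fourth_moment_le_integrable[OF LH])+
  have det: "determined col {Suc d} X" "determined col {Suc d} G" "determined col {d} V" "determined col {d} H"
    unfolding determined_def X_def G_def V_def H_def U_def by (auto simp: col_def)
  have XV: "expectation (\<lambda>\<omega>. X \<omega> * V \<omega>) = sqrt 5 * ((1 + sqrt 5) / 2)"
    using columns.expectation_determined_mult[OF det(1,3) _ _ _ i1(1,2)] column_moments(1)[of "Suc d"] column_moments(2)[of d]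
    unfolding X_def[abs_def] V_def[abs_def] by simp
  have EG: "expectation G = 0"
    using i1(1,3) column_moments(1)[of "Suc d"] column_moments(2)[of "Suc d"] expectation_mean_dist_to_size[of "Suc d"] fourth_moment_le_integrable[OF L(3)]
    unfolding G_def X_def U_def by (simp add: prob_space \<mu>_def field_simps)
  have GH: "expectation (\<lambda>\<omega>. G \<omega> * H \<omega>) = 0"
    using columns.expectation_determined_mult[OF det(2,4) _ _ _ i1(4,5)] EG by simp
  have WG: "expectation (\<lambda>\<omega>. W \<omega> * G \<omega>) = expectation (\<lambda>\<omega>. \<Psi> \<omega> * G \<omega>)"
  proof -
    have "expectation (\<lambda>\<omega>. \<bar>X \<omega> - real (fst (col d \<omega>))\<bar> * G \<omega>)
      = expectation (\<lambda>\<omega>. expectation (\<lambda>\<omega>'. \<bar>X \<omega> - real (fst (col d \<omega>'))\<bar> * G \<omega>))"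
    proof (rule columns.expectation_freeze[where J = "{Suc d}"])
      show "determined col {Suc d} (\<lambda>\<omega>. \<bar>X \<omega> - real (fst b)\<bar> * G \<omega>)" for b
        by (rule determined_compose2[OF det(1,2)])
    qed (use i(4) in \<open>simp_all add: W_def V_def col_def\<close>)
    also have "\<dots> = expectation (\<lambda>\<omega>. \<Psi> \<omega> * G \<omega>)"
      by (simp add: col_def X_def column_moments(4) \<Psi>_def)
    finally show ?thesis by (simp add: W_def V_def col_def)
  qed
  have WH: "expectation (\<lambda>\<omega>. W \<omega> * H \<omega>) = expectation (\<lambda>\<omega>. H \<omega> * H \<omega>)"
  proof -
    have "expectation (\<lambda>\<omega>. \<bar>real (snd (col (Suc d) \<omega>)) - V \<omega>\<bar> * H \<omega>)
      = expectation (\<lambda>\<omega>. expectation (\<lambda>\<omega>'. \<bar>real (snd (col (Suc d) \<omega>')) - V \<omega>\<bar> * H \<omega>))"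
    proof (rule columns.expectation_freeze[where J = "{d}"])
      show "determined col {d} (\<lambda>\<omega>. \<bar>real (snd b) - V \<omega>\<bar> * H \<omega>)" for b
        by (rule determined_compose2[OF det(3,4)])
    qed (use i(6) in \<open>simp_all add: W_def X_def col_def\<close>)
    also have "\<dots> = expectation (\<lambda>\<omega>. H \<omega> * H \<omega>)"
      by (simp add: col_def V_def column_moments(3) H_def)
    finally show ?thesis by (simp add: W_def X_def col_def)
  qed
  have shift: "expectation (\<lambda>\<omega>. V \<omega> * V \<omega>) = expectation (\<lambda>\<omega>. U \<omega> * U \<omega>)"
    "expectation (\<lambda>\<omega>. H \<omega> * H \<omega>) = expectation (\<lambda>\<omega>. mean_dist_to_size (u (Suc d) \<omega>) * mean_dist_to_size (u (Suc d) \<omega>))"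
    using expectation_col(1)[of "\<lambda>c. real (fst c) * real (fst c)" d] expectation_col(1)[of "\<lambda>c. real (fst c) * real (fst c)" "Suc d"]
      expectation_col(1)[of "\<lambda>c. mean_dist_to_size (fst c) * mean_dist_to_size (fst c)" d] expectation_col(1)[of "\<lambda>c. mean_dist_to_size (fst c) * mean_dist_to_size (fst c)" "Suc d"]
    by (simp_all add: U_def V_def H_def col_def)
  have "(perimeter_increment (col d \<omega>) (col (Suc d) \<omega>))\<^sup>2 = X \<omega> * X \<omega> - 2 * (X \<omega> * V \<omega>) + V \<omega> * V \<omega> + 2 * (W \<omega> * G \<omega>) + G \<omega> * G \<omega>
    - 2 * (W \<omega> * H \<omega>) - 2 * (G \<omega> * H \<omega>) + H \<omega> * H \<omega>" for \<omega>
  proof -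
    have p: "perimeter_increment (col d \<omega>) (col (Suc d) \<omega>) = W \<omega> + G \<omega> - H \<omega>"
      by (simp add: perimeter_increment_def col_def W_def X_def V_def G_def U_def H_def \<mu>_def)
    have w: "W \<omega> * W \<omega> = (X \<omega> - V \<omega>) * (X \<omega> - V \<omega>)" by (simp add: W_def)
    have e: "(w + g - h)\<^sup>2 = w * w + 2 * (w * g) + g * g - 2 * (w * h) - 2 * (g * h) + h * h" for w g h :: real
      by (simp add: power2_eq_square algebra_simps)
    show ?thesis unfolding p e w by (simp add: algebra_simps)
  qed
  then have "expectation (\<lambda>\<omega>. (perimeter_increment (col d \<omega>) (col (Suc d) \<omega>))\<^sup>2) =
    expectation (\<lambda>\<omega>. X \<omega> * X \<omega>) - 2 * expectation (\<lambda>\<omega>. X \<omega> * V \<omega>) + expectation (\<lambda>\<omega>. V \<omega> * V \<omega>) + 2 * expectation (\<lambda>\<omega>. W \<omega> * G \<omega>)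
    + expectation (\<lambda>\<omega>. G \<omega> * G \<omega>) - 2 * expectation (\<lambda>\<omega>. W \<omega> * H \<omega>) - 2 * expectation (\<lambda>\<omega>. G \<omega> * H \<omega>) + expectation (\<lambda>\<omega>. H \<omega> * H \<omega>)"
    using i by simp
  also have "\<dots> = (expectation (\<lambda>\<omega>. X \<omega> * X \<omega>) + expectation (\<lambda>\<omega>. U \<omega> * U \<omega>) + 2 * expectation (\<lambda>\<omega>. \<Psi> \<omega> * G \<omega>)
    + expectation (\<lambda>\<omega>. G \<omega> * G \<omega>) - expectation (\<lambda>\<omega>. mean_dist_to_size (u (Suc d) \<omega>) * mean_dist_to_size (u (Suc d) \<omega>))) - 2 * (sqrt 5 * ((1 + sqrt 5) / 2))"
    unfolding XV GH WG WH shift by simp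
  also have "expectation (\<lambda>\<omega>. X \<omega> * X \<omega>) + expectation (\<lambda>\<omega>. U \<omega> * U \<omega>) + 2 * expectation (\<lambda>\<omega>. \<Psi> \<omega> * G \<omega>)
    + expectation (\<lambda>\<omega>. G \<omega> * G \<omega>) - expectation (\<lambda>\<omega>. mean_dist_to_size (u (Suc d) \<omega>) * mean_dist_to_size (u (Suc d) \<omega>))
    = expectation (\<lambda>\<omega>. X \<omega> * X \<omega> + U \<omega> * U \<omega> + 2 * (\<Psi> \<omega> * G \<omega>) + G \<omega> * G \<omega> - mean_dist_to_size (u (Suc d) \<omega>) * mean_dist_to_size (u (Suc d) \<omega>))"
    using i by simp
  also have "\<dots> = 229 / 50 + sqrt 5 / 25 + 2 * sqrt 5 * ((1 + sqrt 5) / 2)"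
    using perimeter_quadratic_expectation[of "Suc d"]
    unfolding X_def U_def G_def \<Psi>_def \<mu>_def power2_eq_square .
  finally show ?thesis by simp
qed

text \<open>
  The corrections in \<open>perimeter_increment\<close> telescope, so the martingale differs from the centred perimeter
  only by the difference of two boundary terms, which is the remainder \<open>R\<close>.
\<close>

theorem perimeter_invariance_principle:
  assumes B: "standard_brownian_motion N B"
  shows "converges_in_distribution skorokhod_topology M
      (\<lambda>\<nu>::real. sample_path (\<lambda>t \<omega>.
         (real_of_int (dcc_perimeter x u (nat \<lfloor>\<nu> * t\<rfloor>) \<omega>) - (6 * sqrt 5 - 4) / 5 * \<nu> * t)
           / (sqrt \<nu> * sqrt (229 / 50 + sqrt 5 / 25))))
      at_top N (sample_path B)"
proof -
  define \<mu> :: real where "\<mu> = (6 * sqrt 5 - 4) / 5"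
  define \<sigma> where "\<sigma> = sqrt (229 / 50 + sqrt 5 / 25)"
  obtain Kx Ku Kp where L: "\<And>d. fourth_moment_le Kx (\<lambda>\<omega>. real (x d \<omega>))" "\<And>d. fourth_moment_le Ku (\<lambda>\<omega>. real (u d \<omega>))" "\<And>d. fourth_moment_le Kp (\<lambda>\<omega>. mean_dist_to_size (u d \<omega>))"
    using fourth_moment_size fourth_moment_u fourth_moment_dist_to_size by metis
  have "\<exists>K. \<forall>d. fourth_moment_le K (\<lambda>\<omega>. perimeter_increment (col d \<omega>) (col (Suc d) \<omega>))"
    unfolding perimeter_increment_def col_def fst_conv snd_conv
    using fourth_moment_le_diff[OF fourth_moment_le_diff[OF fourth_moment_le_add[OF fourth_moment_le_add[OF fourth_moment_le_abs[OF fourth_moment_le_diff[OF L(1) L(2)]] fourth_moment_le_diff[OF L(1,2)]] L(3)] L(3)] fourth_moment_le_const] by blast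
  then obtain \<kappa> where \<kappa>: "\<And>d. fourth_moment_le \<kappa> (\<lambda>\<omega>. perimeter_increment (col d \<omega>) (col (Suc d) \<omega>))" by blast
  interpret A: one_dependent_martingale M col perimeter_increment \<kappa> \<sigma>
  proof
    fix d :: nat and q :: "nat \<times> nat"
    have i: "integrable M (\<lambda>\<omega>. \<bar>real (x (Suc d) \<omega>) - real (fst q)\<bar>)" "integrable M (\<lambda>\<omega>. real (x (Suc d) \<omega>))"
      "integrable M (\<lambda>\<omega>. real (u (Suc d) \<omega>))" "integrable M (\<lambda>\<omega>. mean_dist_to_size (u (Suc d) \<omega>))"
      by (rule fourth_moment_le_integrable[OF fourth_moment_le_abs[OF fourth_moment_le_diff[OF L(1) fourth_moment_le_const]]] fourth_moment_le_integrable[OF L(1)] fourth_moment_le_integrable[OF L(2)] fourth_moment_le_integrable[OF L(3)])+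
    show "integrable M (\<lambda>\<omega>. perimeter_increment q (col (Suc d) \<omega>))"
      unfolding perimeter_increment_def col_def fst_conv snd_conv using i by simp
    show "expectation (\<lambda>\<omega>. perimeter_increment q (col (Suc d) \<omega>)) = 0"
      unfolding perimeter_increment_def col_def fst_conv snd_conv
      using i column_moments(1,2)[of "Suc d"] column_moments(3)[of "Suc d" "fst q"] expectation_mean_dist_to_size[of "Suc d"]
      by (simp add: prob_space field_simps)
    show "integrable M (\<lambda>\<omega>. perimeter_increment (col d \<omega>) (col (Suc d) \<omega>) ^ 4)"
      "expectation (\<lambda>\<omega>. perimeter_increment (col d \<omega>) (col (Suc d) \<omega>) ^ 4) \<le> \<kappa>"
      using \<kappa>[of d] by (simp_all add: fourth_moment_le_def)
    show "expectation (\<lambda>\<omega>. (perimeter_increment (col d \<omega>) (col (Suc d) \<omega>))\<^sup>2) = \<sigma>\<^sup>2"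
      by (simp add: perimeter_increment_variance \<sigma>_def)
    show "0 < \<sigma>" by (simp add: \<sigma>_def add_pos_pos)
  qed
  define R where "R j \<omega> = mean_dist_to_size (u 0 \<omega>) - mean_dist_to_size (u j \<omega>)" for j \<omega>
  have LR: "fourth_moment_le (8 * (Kp + Kp)) (R j)" for j unfolding R_def by (rule fourth_moment_le_diff[OF L(3) L(3)])
  have "converges_in_distribution skorokhod_topology M (\<lambda>\<nu>. sample_path (A.rescaled R \<mu> \<nu>)) at_top N (sample_path B)"
  proof (rule A.invariance_principle[OF _ _ _ B])
    show "determined col {..j} (R j)" for j
      unfolding determined_def R_def col_def by auto
    show "integrable M (\<lambda>\<omega>. R j \<omega> ^ 4)" "expectation (\<lambda>\<omega>. R j \<omega> ^ 4) \<le> 8 * (Kp + Kp)" for j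
      using LR[of j] by (simp_all add: fourth_moment_le_def)
  qed
  moreover have "A.rescaled R \<mu> \<nu> = (\<lambda>t \<omega>. (real_of_int (dcc_perimeter x u (nat \<lfloor>\<nu> * t\<rfloor>) \<omega>) - \<mu> * \<nu> * t) / (sqrt \<nu> * \<sigma>))" for \<nu>
  proof (intro ext)
    fix t \<omega>
    have S: "A.S 0 n \<omega> = real_of_int (dcc_perimeter x u n \<omega>) - \<mu> * real n - R n \<omega>" for n
    proof (induction n)
      case 0
      then show ?case by (simp add: dcc_perimeter_def R_def)
    next
      case (Suc n)
      have "A.D (Suc n) \<omega> = real_of_int (dcc_T x u (Suc n) \<omega>) + mean_dist_to_size (u (Suc n) \<omega>) - mean_dist_to_size (u n \<omega>) - \<mu>"
        by (simp add: A.D_def perimeter_increment_def col_def dcc_T_def dcc_w_def dcc_z_def \<mu>_def)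
      then show ?case
        by (simp add: A.S_Suc Suc dcc_perimeter_def R_def algebra_simps)
    qed
    show "A.rescaled R \<mu> \<nu> t \<omega> = (real_of_int (dcc_perimeter x u (nat \<lfloor>\<nu> * t\<rfloor>) \<omega>) - \<mu> * \<nu> * t) / (sqrt \<nu> * \<sigma>)"
      unfolding A.rescaled_def S by (simp add: algebra_simps)
  qed
  ultimately show ?thesis by (simp add: \<mu>_def \<sigma>_def)
qed

end

theorem theorem2p5:
  fixes M :: "'a measure" and x u :: "nat \<Rightarrow> 'a \<Rightarrow> nat"
    and N1 :: "'b measure" and B1 :: "real \<Rightarrow> 'b \<Rightarrow> real"
    and N2 :: "'c measure" and B2 :: "real \<Rightarrow> 'c \<Rightarrow> real"
    and \<mu>2 \<sigma>2 \<mu>3 \<sigma>Q :: real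
  assumes dcc: "dcc_columns M x u"
    and B1: "standard_brownian_motion N1 B1"
    and B2: "standard_brownian_motion N2 B2"
    and vals: "\<mu>2 = sqrt 5" "\<sigma>2 = sqrt 2"
      "\<mu>3 = (6 * sqrt 5 - 4) / 5" "\<sigma>Q = sqrt (229 / 50 + sqrt 5 / 25)"
  shows "converges_in_distribution skorokhod_topology M
      (\<lambda>\<nu>::real. sample_path (\<lambda>t \<omega>.
         (real (dcc_area x (nat \<lfloor>\<nu> * t\<rfloor>) \<omega>) - \<mu>2 * \<nu> * t) / (sqrt \<nu> * \<sigma>2)))
      at_top N1 (sample_path B1)
    \<and> converges_in_distribution skorokhod_topology M
      (\<lambda>\<nu>::real. sample_path (\<lambda>t \<omega>.
         (real_of_int (dcc_perimeter x u (nat \<lfloor>\<nu> * t\<rfloor>) \<omega>) - \<mu>3 * \<nu> * t) / (sqrt \<nu> * \<sigma>Q)))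
      at_top N2 (sample_path B2)"
  unfolding vals
  by (intro conjI dcc_columns.area_invariance_principle[OF dcc B1] dcc_columns.perimeter_invariance_principle[OF dcc B2])

end
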